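(* Assume (H1), (H2), (H4), (G2), let $\Lambda\in H^{-1}(\Omega)$ and $f(v)=\int_\Omega j(x,v,\nabla v)-\int_\Omega G(x,v)-\langle\Lambda,v\rangle$ on $H_0^1(\Omega)$. Then for every $(u,\eta)\in\operatorname{epi}(f)$ with $f(u)<\eta$ one has $|d\mathcal{G}_f|(u,\eta)=1$. Moreover, if $j(x,-s,-\xi)=j(x,s,\xi)$, $g(x,-s)=-g(x,s)$ and $\Lambda=0$, then $|d_{\mathbb{Z}_2}\mathcal{G}_f|(0,\eta)=1$ for every $\eta>f(0)$.
   Context: $\Omega\subset\mathbb{R}^N$ bounded open, $N\ge3$; $H_0^1(\Omega)$ normed by $\|\nabla u\|_{L^2}$. $j$ measurable in $x$, $C^1$ in $(s,\xi)$, partial derivatives $j_s,j_\xi$. (H1) $\xi\mapsto j(x,s,\xi)$ strictly convex; (H2) $\alpha_0|\xi|^2\le j(x,s,\xi)\le\alpha(|s|)|\xi|^2$ ($\alpha_0>0$, $\alpha$ positive increasing continuous); (H4) $j_s(x,s,\xi)s\ge0$ for $|s|\ge R$, some $R>0$. $g$ Carathéodory, $G(x,s)=\int_0^sg(x,t)dt$; (G2) for every $\varepsilon>0$ there is $a_\varepsilon\in L^{2N/(N+2)}(\Omega)$ with $|g(x,s)|\le a_\varepsilon(x)+\varepsilon|s|^{(N+2)/(N-2)}$. Weak slope: for continuous $g$ on a complete metric space $Y$, $|dg|(y)$ is the sup of $\sigma\ge0$ such that there exist $\delta>0$ and continuous $\mathcal{H}:B(y,\delta)\times[0,\delta]\to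 Y$ with $d(\mathcal{H}(z,t),z)\le t$, $g(\mathcal{H}(z,t))\le g(z)-\sigma t$. $\operatorname{epi}(f)=\{(u,\eta):f(u)\le\eta\}$ with metric $(d(u,v)^2+(\eta-\mu)^2)^{1/2}$; $\mathcal{G}_f(u,\eta)=\eta$. Equivariant version: for even lsc $f$ on a normed space with $f(0)<\infty$, $|d_{\mathbb{Z}_2}\mathcal{G}_f|(0,\eta)$ is the sup of $\sigma\ge0$ such that there exist $\delta>0$ and continuous $\mathcal{H}=(\mathcal{H}_1,\mathcal{H}_2):(B((0,\eta),\delta)\cap\operatorname{epi}(f))\times[0,\delta]\to\operatorname{epi}(f)$ with $d(\mathcal{H}((w,\mu),t),(w,\mu))\le t$, $\mathcal{H}_2((w,\mu),t)\le\mu-\sigma t$, $\mathcal{H}_1((-w,\mu),t)=-\mathcal{H}_1((w,\mu),t)$. *)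

theory Defs
  imports "HOL-Analysis.Analysis"
begin

definition partial_deriv :: "'a::euclidean_space \<Rightarrow> ('a \<Rightarrow> real) \<Rightarrow> 'a \<Rightarrow> real" where
  "partial_deriv i f x = frechet_derivative f (at x) i"

fun Ck :: "nat \<Rightarrow> ('a::euclidean_space \<Rightarrow> real) \<Rightarrow> bool" where
  "Ck 0 f = continuous_on UNIV f"
| "Ck (Suc k) f = ((\<forall>x. f differentiable (at x)) \<and> (\<forall>i\<in>Basis. Ck k (partial_deriv i f)))"

definition smooth_fun :: "('a::euclidean_space \<Rightarrow> real) \<Rightarrow> bool" where
  "smooth_fun f \<longleftrightarrow> (\<forall>k. Ck k f)"

definition test_fun :: "'a::euclidean_space set \<Rightarrow> ('a \<Rightarrow> real) \<Rightarrow> bool" where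
  "test_fun \<Omega> \<phi> \<longleftrightarrow> smooth_fun \<phi> \<and> compact (closure {x. \<phi> x \<noteq> 0}) \<and> closure {x. \<phi> x \<noteq> 0} \<subseteq> \<Omega>"

definition grad :: "('a::euclidean_space \<Rightarrow> real) \<Rightarrow> 'a \<Rightarrow> 'a" where
  "grad \<phi> x = (\<Sum>i\<in>Basis. partial_deriv i \<phi> x *\<^sub>R i)"

definition L2_on :: "'a::euclidean_space set \<Rightarrow> ('a \<Rightarrow> real) \<Rightarrow> bool" where
  "L2_on \<Omega> u \<longleftrightarrow> set_borel_measurable lebesgue \<Omega> u \<and> set_integrable lebesgue \<Omega> (\<lambda>x. (u x)\<^sup>2)"

definition has_weak_grad :: "'a::euclidean_space set \<Rightarrow> ('a \<Rightarrow> real) \<Rightarrow> ('a \<Rightarrow> 'a) \<Rightarrow> bool" where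
  "has_weak_grad \<Omega> u w \<longleftrightarrow> L2_on \<Omega> u \<and> (\<forall>i\<in>Basis. L2_on \<Omega> (\<lambda>x. w x \<bullet> i)) \<and>
     (\<forall>\<phi>. test_fun \<Omega> \<phi> \<longrightarrow> (\<forall>i\<in>Basis.
        (LINT x:\<Omega>|lebesgue. u x * partial_deriv i \<phi> x) = - (LINT x:\<Omega>|lebesgue. (w x \<bullet> i) * \<phi> x)))"

definition wgrad :: "'a::euclidean_space set \<Rightarrow> ('a \<Rightarrow> real) \<Rightarrow> 'a \<Rightarrow> 'a" where
  "wgrad \<Omega> u = (SOME w. has_weak_grad \<Omega> u w)"

text \<open>H^1_0(Omega): closure of C_c^infinity(Omega) in the H^1 norm (functions, identified
  up to the pseudometric below).\<close>
definition H01 :: "'a::euclidean_space set \<Rightarrow> ('a \<Rightarrow> real) set" where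
  "H01 \<Omega> = {u. \<exists>w. has_weak_grad \<Omega> u w \<and>
     (\<exists>\<phi>::nat \<Rightarrow> 'a \<Rightarrow> real. (\<forall>k. test_fun \<Omega> (\<phi> k)) \<and>
        (\<lambda>k. LINT x:\<Omega>|lebesgue. (\<phi> k x - u x)\<^sup>2) \<longlonglongrightarrow> 0 \<and>
        (\<lambda>k. LINT x:\<Omega>|lebesgue. (norm (grad (\<phi> k) x - w x))\<^sup>2) \<longlonglongrightarrow> 0)}"

definition H01_dist :: "'a::euclidean_space set \<Rightarrow> ('a \<Rightarrow> real) \<Rightarrow> ('a \<Rightarrow> real) \<Rightarrow> real" where
  "H01_dist \<Omega> u v = sqrt (LINT x:\<Omega>|lebesgue. (norm (wgrad \<Omega> u x - wgrad \<Omega> v x))\<^sup>2)"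

definition Gprim :: "('a \<Rightarrow> real \<Rightarrow> real) \<Rightarrow> 'a \<Rightarrow> real \<Rightarrow> real" where
  "Gprim g x s = (LBINT t=0..s. g x t)"

definition functional ::
  "'a::euclidean_space set \<Rightarrow> ('a \<Rightarrow> real \<Rightarrow> 'a \<Rightarrow> real) \<Rightarrow> ('a \<Rightarrow> real \<Rightarrow> real)
     \<Rightarrow> (('a \<Rightarrow> real) \<Rightarrow> real) \<Rightarrow> ('a \<Rightarrow> real) \<Rightarrow> ereal" where
  "functional \<Omega> j g \<Lambda> v =
     enn2ereal (\<integral>\<^sup>+x\<in>\<Omega>. ennreal (j x (v x) (wgrad \<Omega> v x)) \<partial>lebesgue)
     - ereal (LINT x:\<Omega>|lebesgue. Gprim g x (v x)) - ereal (\<Lambda> v)"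

definition strictly_convex_on :: "'b::real_vector set \<Rightarrow> ('b \<Rightarrow> real) \<Rightarrow> bool" where
  "strictly_convex_on S h \<longleftrightarrow> convex S \<and>
     (\<forall>x\<in>S. \<forall>y\<in>S. x \<noteq> y \<longrightarrow> (\<forall>t. 0 < t \<and> t < 1 \<longrightarrow>
        h ((1 - t) *\<^sub>R x + t *\<^sub>R y) < (1 - t) * h x + t * h y))"

definition C1_fun :: "('b::real_normed_vector \<Rightarrow> real) \<Rightarrow> bool" where
  "C1_fun h \<longleftrightarrow> (\<exists>D :: 'b \<Rightarrow> ('b \<Rightarrow>\<^sub>L real). continuous_on UNIV D \<and>
      (\<forall>p. (h has_derivative blinfun_apply (D p)) (at p)))"

section \<open>Epigraph and weak slopes (on a pseudometric space given by a carrier and a distance)\<close>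

definition epi :: "'x set \<Rightarrow> ('x \<Rightarrow> ereal) \<Rightarrow> ('x \<times> real) set" where
  "epi X f = {(u, \<eta>). u \<in> X \<and> f u \<le> ereal \<eta>}"

definition epi_dist :: "('x \<Rightarrow> 'x \<Rightarrow> real) \<Rightarrow> ('x \<times> real) \<Rightarrow> ('x \<times> real) \<Rightarrow> real" where
  "epi_dist d p q = sqrt ((d (fst p) (fst q))\<^sup>2 + (snd p - snd q)\<^sup>2)"

definition cont_deform :: "('y \<Rightarrow> 'y \<Rightarrow> real) \<Rightarrow> 'y set \<Rightarrow> real \<Rightarrow> ('y \<Rightarrow> real \<Rightarrow> 'y) \<Rightarrow> bool" where
  "cont_deform d D \<delta> H \<longleftrightarrow>
     (\<forall>z\<in>D. \<forall>t\<in>{0..\<delta>}. \<forall>\<epsilon>>0. \<exists>\<rho>>0. \<forall>z'\<in>D. \<forall>t'\<in>{0..\<delta>}.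
        d z' z < \<rho> \<and> \<bar>t' - t\<bar> < \<rho> \<longrightarrow> d (H z' t') (H z t) < \<epsilon>)"

definition weak_slope :: "'y set \<Rightarrow> ('y \<Rightarrow> 'y \<Rightarrow> real) \<Rightarrow> ('y \<Rightarrow> real) \<Rightarrow> 'y \<Rightarrow> ereal" where
  "weak_slope Y d g y = Sup {ereal \<sigma> | \<sigma>. \<sigma> \<ge> 0 \<and>
     (\<exists>\<delta>>0. \<exists>H. cont_deform d {z\<in>Y. d z y < \<delta>} \<delta> H \<and>
        (\<forall>z\<in>Y. d z y < \<delta> \<longrightarrow> (\<forall>t\<in>{0..\<delta>}.
           H z t \<in> Y \<and> d (H z t) z \<le> t \<and> g (H z t) \<le> g z - \<sigma> * t)))}"

text \<open>Equivariant weak slope of \<open>\<G>_f\<close> at \<open>(0,\<eta>)\<close>; the symmetry condition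
  \<open>H_1((-w,\<mu>),t) = -H_1((w,\<mu>),t)\<close> is imposed as equality in the (pseudo)metric space.\<close>
definition weak_slope_Z2 ::
  "('a \<Rightarrow> real) set \<Rightarrow> (('a \<Rightarrow> real) \<Rightarrow> ('a \<Rightarrow> real) \<Rightarrow> real) \<Rightarrow> (('a \<Rightarrow> real) \<Rightarrow> ereal) \<Rightarrow> real \<Rightarrow> ereal" where
  "weak_slope_Z2 X d f \<eta> = Sup {ereal \<sigma> | \<sigma>. \<sigma> \<ge> 0 \<and>
     (\<exists>\<delta>>0. \<exists>H. cont_deform (epi_dist d) {p\<in>epi X f. epi_dist d p (\<lambda>x. 0, \<eta>) < \<delta>} \<delta> H \<and>
        (\<forall>p\<in>epi X f. epi_dist d p (\<lambda>x. 0, \<eta>) < \<delta> \<longrightarrow> (\<forall>t\<in>{0..\<delta>}.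
           H p t \<in> epi X f \<and> epi_dist d (H p t) p \<le> t \<and> snd (H p t) \<le> snd p - \<sigma> * t)) \<and>
        (\<forall>w \<mu>. (w, \<mu>) \<in> epi X f \<and> epi_dist d (w, \<mu>) (\<lambda>x. 0, \<eta>) < \<delta> \<and>
               (\<lambda>x. - w x, \<mu>) \<in> epi X f \<and> epi_dist d (\<lambda>x. - w x, \<mu>) (\<lambda>x. 0, \<eta>) < \<delta> \<longrightarrow>
           (\<forall>t\<in>{0..\<delta>}. d (fst (H (\<lambda>x. - w x, \<mu>) t)) (\<lambda>x. - fst (H (w, \<mu>) t) x) = 0)))}"

end

theory Submission
  imports Defs
begin

text \<open>
  Let \<open>\<theta>\<close> be an odd smooth truncation with \<open>\<theta> s = s\<close> for \<open>\<bar>s\<bar> \<le> k\<close>, \<open>k \<ge> R\<close>, and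
  \<open>\<psi> = \<theta>'\<close> with values in \<open>[0, 1]\<close> and compact support. Along the segment
  \<open>w\<^sub>s = (1 - s) w + s \<theta>(w)\<close> the sign condition on \<open>j\<^sub>s\<close> and the convexity in \<open>\<xi>\<close> give
  \<open>\<integral> j(x, w\<^sub>s, \<nabla>w\<^sub>s) \<le> (1 - s) \<integral> j(x, w, \<nabla>w) + s \<integral> \<psi>(w) j(x, w, \<nabla>w)\<close>, and the last integral, unlike
  \<open>\<integral> j(x, w, \<nabla>w)\<close>, is continuous in \<open>w\<close>. The terms with \<open>G\<close> and \<open>\<Lambda>\<close> change by \<open>s\<close> times a quantity
  that is small when \<open>k\<close> is large and \<open>w\<close> is close to \<open>u\<close>, so \<open>f(w\<^sub>s) \<le> \<mu> - s (\<mu> - f(u) - o(1))\<close>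
  whenever \<open>f(w) \<le> \<mu>\<close>. Since \<open>\<parallel>w\<^sub>s - w\<parallel> = s \<parallel>w - \<theta>(w)\<parallel>\<close> is \<open>s\<close> times something arbitrarily small,
  the epigraph is deformed downwards at a speed arbitrarily close to 1. As \<open>\<theta>\<close> is odd, the
  deformation is equivariant. Smoothness of \<open>\<theta>\<close> makes \<open>\<theta>(\<phi>)\<close> a test function for every test
  function \<open>\<phi>\<close>, so that the chain rule in \<open>H\<^sub>0\<^sup>1\<close> needs no Stampacchia-type argument.
\<close>

section \<open>Smooth functions\<close>

text \<open>The obstacle is that \<open>J\<close> may be infinite at points arbitrarily close to
  \<open>u\<close>, so no bound of \<open>J w\<close> by \<open>J u\<close> is available. None is
  used: on the epigraph \<open>J w\<close> is at most \<mu> + \<Gamma>(w) + \<Lambda>(w), and this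
  enters with the weight 1 - s, so that the level \<mu> itself pays for it. The weight s multiplies
  only the truncated energy, which is finite for every w. The gap \<eta> - f(u) > 0 links s to time:
  with e half of this gap and s = \<sigma> t / e the level drops by \<sigma> t, while the horizontal
  displacement is kept below \<sigma> t sqrt(1 - \<sigma>^2). The total displacement is then at most
  t. Continuity is always meant in the gradient seminorm. The terms of critical growth require the
  embedding into L^p with p = 2N/(N-2), which is derived by Gagliardo's method. The gradient in the
  definitions is picked by \<open>SOME\<close>, so its uniqueness a.e., that is, the fundamental
  lemma of the calculus of variations, underlies every computation.\<close>

lemma partial_deriv_eq:
  "(f has_derivative D) (at x) \<Longrightarrow> partial_deriv i f x = D i"
  using frechet_derivative_at[of f D x] by (simp add: partial_deriv_def)

lemma has_derivative_partial_deriv: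
  "f differentiable (at x) \<Longrightarrow> (f has_derivative (\<lambda>h. partial_deriv h f x)) (at x)"
  unfolding partial_deriv_def using frechet_derivative_works by auto

lemma Ck_SucI:
  assumes "\<And>x. (f has_derivative D x) (at x)" "\<And>i. i \<in> Basis \<Longrightarrow> Ck k (\<lambda>x. D x i)"
  shows "Ck (Suc k) f"
proof -
  have "partial_deriv i f = (\<lambda>x. D x i)" for i
    using partial_deriv_eq[OF assms(1)] by blast
  then show ?thesis
    using assms by (auto simp: differentiable_def)
qed

lemma Ck_SucI_real:
  fixes f :: "real \<Rightarrow> real"
  assumes "\<And>x. (f has_real_derivative f' x) (at x)" "Ck k f'"
  shows "Ck (Suc k) f"
  by (rule Ck_SucI[where D = "\<lambda>x h. f' x * h"])
     (use assms in \<open>auto simp: has_field_derivative_def\<close>)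

lemma Ck_Suc_imp_Ck: "Ck (Suc k) f \<Longrightarrow> Ck k f"
proof (induction k arbitrary: f)
  case 0
  then show ?case
    by (auto intro: differentiable_imp_continuous_on simp: differentiable_on_def
        intro!: differentiable_at_imp_differentiable_on)
qed (auto simp del: Ck.simps(1))

lemma Ck_const: "Ck k (\<lambda>x. c)"
proof (induction k arbitrary: c)
  case (Suc k)
  show ?case by (rule Ck_SucI[where D = "\<lambda>_ _. 0"]) (auto simp: Suc)
qed auto

lemma Ck_inner: "Ck k (\<lambda>x. x \<bullet> b)"
proof (cases k)
  case (Suc l)
  show ?thesis unfolding Suc
    by (rule Ck_SucI[where D = "\<lambda>_ h. h \<bullet> b"])
       (auto intro!: derivative_eq_intros Ck_const simp del: Ck.simps)
qed (auto intro!: continuous_intros)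

lemma Ck_add: "Ck k f \<Longrightarrow> Ck k g \<Longrightarrow> Ck k (\<lambda>x. f x + g x)"
proof (induction k arbitrary: f g)
  case (Suc k)
  show ?case
    by (rule Ck_SucI[where D = "\<lambda>x h. partial_deriv h f x + partial_deriv h g x"])
       (use Suc in \<open>auto intro!: derivative_eq_intros has_derivative_partial_deriv\<close>)
qed (auto intro!: continuous_intros)

lemma Ck_mult: "Ck k f \<Longrightarrow> Ck k g \<Longrightarrow> Ck k (\<lambda>x. f x * g x)"
proof (induction k arbitrary: f g)
  case (Suc k)
  note S = Suc.prems[THEN Ck_Suc_imp_Ck]
  show ?case
  proof (rule Ck_SucI[where D = "\<lambda>x h. f x * partial_deriv h g x + partial_deriv h f x * g x"])
    fix i :: 'a assume "i \<in> Basis"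
    then show "Ck k (\<lambda>x. f x * partial_deriv i g x + partial_deriv i f x * g x)"
      using Suc S by (auto intro!: Ck_add)
  qed (use Suc.prems in \<open>auto intro!: has_derivative_mult has_derivative_partial_deriv\<close>)
qed (auto intro!: continuous_intros)

lemma Ck_compose:
  fixes h :: "real \<Rightarrow> real"
  shows "Ck k h \<Longrightarrow> Ck k f \<Longrightarrow> Ck k (\<lambda>x. h (f x))"
proof (induction k arbitrary: h f)
  case 0
  then show ?case using continuous_on_compose2[of UNIV h UNIV f] by simp
next
  case (Suc k)
  \<comment> \<open>On \<open>real\<close> a direction is a scalar, so by linearity every
    directional derivative is a multiple of the one along the basis vector 1. This turns the chain
    rule into a product, to which \<open>Ck_mult\<close> applies.\<close>
  have lin: "partial_deriv (c::real) h y = c * partial_deriv 1 h y" for c y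
  proof -
    have "linear (\<lambda>c. partial_deriv c h y)"
      using Suc.prems(1) has_derivative_linear[OF has_derivative_partial_deriv, of h y] by simp
    from linear_scale[OF this, of c 1] show ?thesis by simp
  qed
  show ?case
  proof (rule Ck_SucI[where D = "\<lambda>x v. partial_deriv v f x * partial_deriv 1 h (f x)"])
    fix x
    have "((\<lambda>x. h (f x)) has_derivative (\<lambda>v. partial_deriv (partial_deriv v f x) h (f x))) (at x)"
      using has_derivative_compose[of f "\<lambda>v. partial_deriv v f x" x UNIV h "\<lambda>c. partial_deriv c h (f x)"]
        has_derivative_partial_deriv[of f x] has_derivative_partial_deriv[of h "f x"] Suc.prems
      by auto
    also have "(\<lambda>v. partial_deriv (partial_deriv v f x) h (f x))
        = (\<lambda>v. partial_deriv v f x * partial_deriv 1 h (f x))"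
      by (intro ext lin)
    finally show "((\<lambda>x. h (f x)) has_derivative (\<lambda>v. partial_deriv v f x * partial_deriv 1 h (f x))) (at x)" .
  next
    fix i :: 'a assume "i \<in> Basis"
    then show "Ck k (\<lambda>x. partial_deriv i f x * partial_deriv 1 h (f x))"
      using Ck_mult[OF _ Suc.IH[of "partial_deriv 1 h" f]] Suc.prems Ck_Suc_imp_Ck[OF Suc.prems(2)]
      by simp
  qed
qed

lemma Ck_prod: "(\<And>i. i \<in> I \<Longrightarrow> Ck k (f i)) \<Longrightarrow> Ck k (\<lambda>x. \<Prod>i\<in>I. f i x)"
  by (induction I rule: infinite_finite_induct) (auto intro!: Ck_const Ck_mult)

lemma Ck_inverse:
  fixes f :: "'a::euclidean_space \<Rightarrow> real"
  assumes nz: "\<And>x. f x \<noteq> 0"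
  shows "Ck k f \<Longrightarrow> Ck k (\<lambda>x. inverse (f x))"
proof (induction k)
  case 0
  then show ?case using nz by (auto intro!: continuous_intros)
next
  case (Suc k)
  show ?case
  \<comment> \<open>The sign is written as a factor \<open>- 1\<close> so that the derivative is
    assembled by \<open>Ck_mult\<close> and \<open>Ck_const\<close>; \<open>inverse (f x)\<close>
    occurs in it at order \<open>k\<close> only, where the induction hypothesis is
    available.\<close>
  proof (rule Ck_SucI[where D = "\<lambda>x v. - 1 * (inverse (f x) * partial_deriv v f x * inverse (f x))"])
    show "((\<lambda>x. inverse (f x)) has_derivative (\<lambda>v. - 1 * (inverse (f x) * partial_deriv v f x * inverse (f x)))) (at x)" for x
      using Deriv.has_derivative_inverse[of f x "\<lambda>v. partial_deriv v f x" UNIV] has_derivative_partial_deriv[of f x] Suc.prems nz by simp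
    show "Ck k (\<lambda>x. - 1 * (inverse (f x) * partial_deriv i f x * inverse (f x)))" if "i \<in> Basis" for i
      using that Suc Ck_Suc_imp_Ck[OF Suc.prems] by (intro Ck_mult Ck_const) auto
  qed
qed

text \<open>The factor \<open>inverse x ^ n\<close> makes the family closed under differentiation up
  to linear combinations, which a single exponential is not. Smoothness of all members then follows
  by one induction with \<open>n\<close> arbitrary.\<close>

definition flat_exp :: "nat \<Rightarrow> real \<Rightarrow> real" where
  "flat_exp n x = (if x \<le> 0 then 0 else inverse x ^ n * exp (- inverse x))"

lemma flat_exp_tendsto: "(flat_exp n \<longlongrightarrow> 0) (at 0)"
proof -
  have "((\<lambda>x::real. inverse x ^ n / exp (inverse x)) \<longlongrightarrow> 0) (at_right 0)"
    by (rule filterlim_compose[OF tendsto_power_div_exp_0 filterlim_inverse_at_top_right])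
  then have "(flat_exp n \<longlongrightarrow> 0) (at_right 0)"
    by (rule Lim_transform_eventually)
       (auto simp: flat_exp_def eventually_at_filter exp_minus divide_inverse)
  moreover have "(flat_exp n \<longlongrightarrow> 0) (at_left 0)"
    by (rule Lim_transform_eventually[OF tendsto_const])
       (auto simp: flat_exp_def eventually_at_filter)
  ultimately show ?thesis by (simp add: filterlim_at_split)
qed

text \<open>Off the origin this is calculus on either side. At the origin the difference quotient of
  \<open>flat_exp n\<close> is \<open>flat_exp (Suc n)\<close>, whose limit 0 is known.\<close>

lemma flat_exp_has_derivative:
  "(flat_exp n has_real_derivative (- real n * flat_exp (Suc n) x + flat_exp (Suc (Suc n)) x)) (at x)"
proof -
  consider "x < 0" | "x = 0" | "x > 0" by linarith
  then show ?thesis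
  proof cases
    case 1
    have "((\<lambda>_. 0) has_real_derivative 0) (at x)" by simp
    then have "(flat_exp n has_real_derivative 0) (at x)"
      by (rule has_field_derivative_transform_within_open[of _ _ _ "{..<0}"])
         (use 1 in \<open>auto simp: flat_exp_def\<close>)
    then show ?thesis using 1 by (simp add: flat_exp_def)
  next
    case 2
    have "((\<lambda>h. flat_exp n h / h) \<longlongrightarrow> 0) (at 0)"
      by (rule Lim_transform_eventually[OF flat_exp_tendsto[of "Suc n"]])
         (auto simp: flat_exp_def eventually_at_filter divide_inverse)
    then show ?thesis using 2 by (simp add: has_field_derivative_iff flat_exp_def)
  next
    case 3
    have "((\<lambda>x. inverse x ^ n * exp (- inverse x)) has_real_derivative
           (- real n * flat_exp (Suc n) x + flat_exp (Suc (Suc n)) x)) (at x)"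
    proof -
      have i: "(inverse has_real_derivative - (inverse x * inverse x)) (at x)"
        using DERIV_inverse[of x UNIV] 3 by (simp add: power2_eq_square)
      have "((\<lambda>x. inverse x ^ n * exp (- inverse x)) has_real_derivative
          (real n * (- (inverse x * inverse x) * inverse x ^ (n - Suc 0)) * exp (- inverse x)
           + exp (- inverse x) * - (- (inverse x * inverse x)) * inverse x ^ n)) (at x)"
        by (intro DERIV_mult DERIV_power DERIV_chain2[OF DERIV_exp] DERIV_minus i)
      then show ?thesis using 3
        by (cases n) (simp_all add: flat_exp_def algebra_simps)
    qed
    then show ?thesis
      by (rule has_field_derivative_transform_within_open[of _ _ _ "{0<..}"])
         (use 3 in \<open>auto simp: flat_exp_def\<close>)
  qed
qed

lemma Ck_flat_exp: "Ck k (flat_exp n)"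
proof (induction k arbitrary: n)
  case 0
  show ?case
    using DERIV_continuous_on[OF has_field_derivative_at_within[OF flat_exp_has_derivative]] by simp
next
  case (Suc k)
  show ?case
    by (rule Ck_SucI_real[OF flat_exp_has_derivative]) (intro Ck_add Ck_mult Ck_const Suc)
qed

text \<open>The integral from 0 is defined by the sign of its endpoint. On each window
  \<open>{-M..M}\<close> it differs by a constant from the integral that starts at
  \<open>-M\<close>, and this one is differentiated by the fundamental theorem of calculus.\<close>

lemma continuous_has_antiderivative:
  fixes f :: "real \<Rightarrow> real"
  assumes "continuous_on UNIV f"
  obtains F where "F 0 = 0" "\<And>x. (F has_real_derivative f x) (at x)"
proof -
  define F where "F x = (if x \<ge> 0 then integral {0..x} f else - integral {x..0} f)" for x :: real
  have io: "f integrable_on {a..b}" for a b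
    by (intro integrable_continuous_real continuous_on_subset[OF assms]) auto
  have F: "F x = integral {-M..x} f - integral {-M..0} f" if "x \<in> {-M..M}" for x M
    using that Henstock_Kurzweil_Integration.integral_combine[OF _ _ io, of "-M" 0 x]
      Henstock_Kurzweil_Integration.integral_combine[OF _ _ io, of "-M" x 0]
    by (auto simp: F_def)
  have "(F has_real_derivative f x) (at x)" for x
  proof -
    define M where "M = \<bar>x\<bar> + 1"
    have "((\<lambda>x. integral {-M..x} f) has_real_derivative f x) (at x within {-M..M})"
      by (intro integral_has_real_derivative continuous_on_subset[OF assms]) (auto simp: M_def)
    then have "((\<lambda>x. integral {-M..x} f - integral {-M..0} f) has_real_derivative f x) (at x)"
      by (subst (asm) at_within_interior) (auto simp: M_def intro!: derivative_eq_intros)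
    then show ?thesis
      by (rule has_field_derivative_transform_within_open[of _ _ _ "{-M<..<M}"])
         (use F[of _ M] in \<open>auto simp: M_def\<close>)
  qed
  moreover have "F 0 = 0" by (simp add: F_def)
  ultimately show thesis using that by blast
qed

section \<open>Smooth truncations\<close>

text \<open>Two clauses carry the estimates. Since \<psi> vanishes from k + 1 on, the growth
  function \<alpha> is only met on [0, k + 1]. Since \<theta>(s) lies between k and s for s \<ge> k,
  the way from s to \<theta>(s) stays where the sign condition holds, provided k \<ge> R.\<close>

definition truncation :: "real \<Rightarrow> (real \<Rightarrow> real) \<Rightarrow> (real \<Rightarrow> real) \<Rightarrow> bool" where
  "truncation k \<theta> \<psi> \<longleftrightarrow> smooth_fun \<theta> \<and> continuous_on UNIV \<psi> \<and>
     (\<forall>s. (\<theta> has_real_derivative \<psi> s) (at s)) \<and> (\<forall>s. 0 \<le> \<psi> s \<and> \<psi> s \<le> 1) \<and>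
     (\<forall>s. \<bar>s\<bar> \<le> k \<longrightarrow> \<theta> s = s \<and> \<psi> s = 1) \<and> (\<forall>s. \<bar>s\<bar> \<ge> k + 1 \<longrightarrow> \<psi> s = 0) \<and>
     (\<forall>s. \<theta> (- s) = - \<theta> s) \<and> (\<forall>s\<ge>k. k \<le> \<theta> s \<and> \<theta> s \<le> s)"

lemma truncation_exists:
  assumes "k > 0"
  obtains \<theta> \<psi> where "truncation k \<theta> \<psi>"
proof -
  \<comment> \<open>\<open>A\<close> is positive exactly for \<bar>s\<bar> < k + 1 and
    \<open>B\<close> exactly for \<bar>s\<bar> > k, so \<open>A + B\<close> never vanishes and the
    quotient is a smooth cutoff. Writing both in terms of \<open>s * s\<close> makes them even and
    keeps the absolute value out of the smoothness proof.\<close>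
  define A where "A s = flat_exp 0 ((k + 1)\<^sup>2 + - 1 * (s * s))" for s :: real
  define B where "B s = flat_exp 0 (s * s + - (k\<^sup>2))" for s :: real
  define \<psi> where "\<psi> s = A s * inverse (A s + B s)" for s
  have sq: "\<bar>s\<bar> \<le> c \<longleftrightarrow> s * s \<le> c\<^sup>2" if "c \<ge> 0" for s c :: real
    using abs_le_square_iff[of s c] that by (simp add: power2_eq_square)
  have A0: "A s \<ge> 0" "B s \<ge> 0" for s by (auto simp: A_def B_def flat_exp_def)
  have Apos: "A s > 0" if "\<bar>s\<bar> < k + 1" for s
    using that sq[of "k+1" s] abs_le_square_iff[of "k+1" s] assms by (auto simp: A_def flat_exp_def power2_eq_square)
  have Bpos: "B s > 0" if "\<bar>s\<bar> > k" for s
    using that sq[of k s] assms by (auto simp: B_def flat_exp_def)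
  have Az: "A s = 0" if "\<bar>s\<bar> \<ge> k + 1" for s
    using that abs_le_square_iff[of "k+1" s] assms by (auto simp: A_def flat_exp_def power2_eq_square)
  have Bz: "B s = 0" if "\<bar>s\<bar> \<le> k" for s
    using that sq[of k s] assms by (auto simp: B_def flat_exp_def)
  have pos: "A s + B s > 0" for s
    using Apos[of s] Bpos[of s] A0[of s] by (cases "\<bar>s\<bar> < k + 1") (auto intro: add_pos_nonneg add_nonneg_pos)
  have nz: "A s + B s \<noteq> 0" for s using pos[of s] by simp
  have id: "Ck n (\<lambda>s::real. s)" for n using Ck_inner[of n "1::real"] by simp
  have cA: "Ck n A" "Ck n B" for n
    unfolding A_def B_def by (intro Ck_compose[OF Ck_flat_exp] Ck_add Ck_mult Ck_const id)+
  have c\<psi>: "Ck n \<psi>" for n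
    unfolding \<psi>_def by (intro Ck_mult Ck_inverse Ck_add cA nz)
  have cont: "continuous_on UNIV \<psi>" using c\<psi>[of 0] by simp
  then obtain \<theta> where \<theta>: "\<theta> 0 = 0" "\<And>x. (\<theta> has_real_derivative \<psi> x) (at x)"
    using continuous_has_antiderivative by metis
  have "Ck n \<theta>" for n
    using Ck_SucI_real[OF \<theta>(2) c\<psi>, of n] Ck_Suc_imp_Ck by blast
  then have sm: "smooth_fun \<theta>" by (simp add: smooth_fun_def)
  have \<psi>01: "0 \<le> \<psi> s" "\<psi> s \<le> 1" for s
    using pos[of s] A0[of s] by (auto simp: \<psi>_def field_simps)
  have \<psi>1: "\<psi> s = 1" if "\<bar>s\<bar> \<le> k" for s
    using Bz[OF that] pos[of s] by (auto simp: \<psi>_def)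
  have \<psi>0: "\<psi> s = 0" if "\<bar>s\<bar> \<ge> k + 1" for s
    using Az[OF that] by (auto simp: \<psi>_def)
  have ev: "\<psi> (- s) = \<psi> s" for s by (simp add: \<psi>_def A_def B_def)
  have odd: "\<theta> (- s) = - \<theta> s" for s
  proof -
    \<comment> \<open>Oddness of the primitive comes from evenness of \<psi>: the sum has derivative
      0 and vanishes at the origin.\<close>
    have "((\<lambda>s. \<theta> s + \<theta> (- s)) has_real_derivative 0) (at x)" for x
      using DERIV_add[OF \<theta>(2)[of x] DERIV_chain2[OF \<theta>(2)[of "-x"] DERIV_minus[OF DERIV_ident]]]
      by (simp add: ev)
    then have "\<theta> s + \<theta> (- s) = \<theta> 0 + \<theta> (- 0)"
      using DERIV_isconst_all[of "\<lambda>s. \<theta> s + \<theta> (- s)" s 0] by blast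
    then show ?thesis using \<theta>(1) by simp
  qed
  have le: "\<theta> t - \<theta> s \<le> t - s" "\<theta> s \<le> \<theta> t" if "s \<le> t" for s t
  proof -
    show "\<theta> s \<le> \<theta> t"
      by (rule DERIV_nonneg_imp_nondecreasing[OF that]) (use \<theta>(2) \<psi>01 in blast)
    have "(\<lambda>x. x - \<theta> x) s \<le> (\<lambda>x. x - \<theta> x) t"
      by (rule DERIV_nonneg_imp_nondecreasing[OF that])
         (use \<psi>01 in \<open>auto intro!: exI DERIV_diff DERIV_ident \<theta>(2)\<close>)
    then show "\<theta> t - \<theta> s \<le> t - s" by simp
  qed
  have eqp: "\<theta> s = s" if "0 \<le> s" "s \<le> k" for s
  proof (cases "s = 0")
    case False
    then have "0 < s" using that by simp
    have "\<exists>z. 0 < z \<and> z < s \<and> \<theta> s - \<theta> 0 = (s - 0) * \<psi> z"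
      by (rule MVT2[OF \<open>0 < s\<close>]) (use \<theta>(2) in auto)
    then obtain z where "0 < z" "z < s" "\<theta> s - \<theta> 0 = (s - 0) * \<psi> z" by auto
    with \<psi>1[of z] that \<theta>(1) show ?thesis by auto
  qed (simp add: \<theta>)
  have eq: "\<theta> s = s" if "\<bar>s\<bar> \<le> k" for s
    using eqp[of "\<bar>s\<bar>"] odd[of s] that by (cases "s \<ge> 0") auto
  have ge: "k \<le> \<theta> s \<and> \<theta> s \<le> s" if "s \<ge> k" for s
    using le[OF that] eq[of k] assms by auto
  show thesis
    by (rule that[of \<theta> \<psi>]) (auto simp: truncation_def sm cont \<theta> \<psi>01 \<psi>1 \<psi>0 odd eq ge)
qed

lemma truncationD:
  assumes "truncation k \<theta> \<psi>" "k > 0"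
  shows "\<bar>\<theta> s - \<theta> t\<bar> \<le> \<bar>s - t\<bar>" "\<theta> 0 = 0" "0 \<le> \<psi> s" "\<psi> s \<le> 1" "continuous_on UNIV \<psi>" "continuous_on UNIV \<theta>"
    "(\<theta> has_real_derivative \<psi> s) (at s)"
proof -
  note t = assms[unfolded truncation_def]
  show "\<theta> 0 = 0" "0 \<le> \<psi> s" "\<psi> s \<le> 1" "continuous_on UNIV \<psi>" "(\<theta> has_real_derivative \<psi> s) (at s)"
    using t by auto
  have D: "(\<theta> has_real_derivative \<psi> s) (at s)" for s using t by auto
  then show "continuous_on UNIV \<theta>" by (meson DERIV_continuous_on has_field_derivative_at_within)
  show "\<bar>\<theta> s - \<theta> t\<bar> \<le> \<bar>s - t\<bar>"
    using field_differentiable_bound[of UNIV \<theta> \<psi> 1 s t] D t by (auto simp: dist_norm)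
qed

lemma truncation_props:
  assumes T: "truncation k \<theta> \<psi>" "k > 0"
  shows "\<bar>\<theta> s\<bar> \<le> \<bar>s\<bar>" "\<bar>s - \<theta> s\<bar> \<le> \<bar>s\<bar>" "\<bar>s\<bar> \<le> k \<Longrightarrow> \<theta> s = s \<and> \<psi> s = 1"
    "s \<ge> k \<Longrightarrow> k \<le> \<theta> s \<and> \<theta> s \<le> s" "s \<le> - k \<Longrightarrow> s \<le> \<theta> s \<and> \<theta> s \<le> - k"
    "\<bar>s\<bar> \<ge> k + 1 \<Longrightarrow> \<psi> s = 0" "\<theta> (- s) = - \<theta> s"
proof -
  note t = T[unfolded truncation_def]
  show 1: "\<bar>s\<bar> \<le> k \<Longrightarrow> \<theta> s = s \<and> \<psi> s = 1" "s \<ge> k \<Longrightarrow> k \<le> \<theta> s \<and> \<theta> s \<le> s"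
    "\<bar>s\<bar> \<ge> k + 1 \<Longrightarrow> \<psi> s = 0" "\<theta> (- s) = - \<theta> s" for s
    using t by auto
  show 2: "s \<le> - k \<Longrightarrow> s \<le> \<theta> s \<and> \<theta> s \<le> - k" for s
    using 1(2)[of "- s"] 1(4)[of s] by auto
  have "\<bar>s\<bar> \<le> k \<or> s \<ge> k \<or> s \<le> - k" by linarith
  then show "\<bar>\<theta> s\<bar> \<le> \<bar>s\<bar>" "\<bar>s - \<theta> s\<bar> \<le> \<bar>s\<bar>"
    using 1(1,2)[of s] 2[of s] T(2) by auto
qed

section \<open>Integration by parts\<close>

lemma partial_deriv_eq_0_outside:
  assumes "closed K" "\<And>x. x \<notin> K \<Longrightarrow> \<Phi> x = 0" "x \<notin> K"
  shows "partial_deriv i \<Phi> x = 0"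
proof -
  have "(\<Phi> has_derivative (\<lambda>_. 0)) (at x)"
    by (rule has_derivative_transform_within_open[of "\<lambda>_. 0" "\<lambda>_. 0" x UNIV "- K"])
       (use assms in auto)
  then show ?thesis by (rule partial_deriv_eq)
qed

lemma integrable_compact_support:
  fixes f :: "'a::euclidean_space \<Rightarrow> real"
  assumes "compact K" "continuous_on UNIV f" "\<And>x. x \<notin> K \<Longrightarrow> f x = 0"
  shows "integrable lborel f"
proof -
  have "integrable lborel (\<lambda>x. indicator K x *\<^sub>R f x)"
    using assms(1) continuous_on_subset[OF assms(2)] by (intro borel_integrable_compact) auto
  also have "(\<lambda>x. indicator K x *\<^sub>R f x) = f"
    using assms(3) by (auto simp: indicator_def fun_eq_iff)
  finally show ?thesis .
qed

lemma bounded_compact_support: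
  fixes f :: "'a::euclidean_space \<Rightarrow> real"
  assumes "compact K" "continuous_on UNIV f" "\<And>x. x \<notin> K \<Longrightarrow> f x = 0"
  obtains B where "B \<ge> 0" "\<And>x. \<bar>f x\<bar> \<le> B"
proof -
  have "compact (f ` K)"
    using assms(1) continuous_on_subset[OF assms(2)] by (intro compact_continuous_image) auto
  then obtain B where B: "\<And>y. y \<in> f ` K \<Longrightarrow> norm y \<le> B"
    using compact_imp_bounded bounded_iff by metis
  show thesis
  proof (rule that[of "max B 0"])
    show "\<bar>f x\<bar> \<le> max B 0" for x
      using B[of "f x"] assms(3)[of x] by (cases "x \<in> K") auto
  qed auto
qed

lemma has_derivative_line:
  assumes "\<Phi> differentiable (at (x + t *\<^sub>R i))"
  shows "((\<lambda>t. \<Phi> (x + t *\<^sub>R i)) has_real_derivative partial_deriv i \<Phi> (x + t *\<^sub>R i)) (at t)"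
proof -
  have D: "(\<Phi> has_derivative (\<lambda>h. partial_deriv h \<Phi> (x + t *\<^sub>R i))) (at (x + t *\<^sub>R i))"
    by (rule has_derivative_partial_deriv[OF assms])
  have "((\<lambda>t. \<Phi> (x + t *\<^sub>R i)) has_derivative (\<lambda>s. partial_deriv (s *\<^sub>R i) \<Phi> (x + t *\<^sub>R i))) (at t)"
    by (rule has_derivative_compose[of "\<lambda>t. x + t *\<^sub>R i" "\<lambda>s. s *\<^sub>R i" t UNIV \<Phi>, OF _ D])
       (auto intro!: derivative_eq_intros)
  moreover have "partial_deriv (s *\<^sub>R i) \<Phi> (x + t *\<^sub>R i) = partial_deriv i \<Phi> (x + t *\<^sub>R i) * s" for s
    using linear_scale[OF has_derivative_linear[OF D], of s i] by simp
  ultimately show ?thesis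
    by (simp add: has_field_derivative_def)
qed

lemma integral_lborel_translate:
  fixes f :: "'a::euclidean_space \<Rightarrow> real"
  assumes [measurable]: "f \<in> borel_measurable borel"
  shows "integral\<^sup>L lborel (\<lambda>x. f (x + c)) = integral\<^sup>L lborel f"
proof -
  have "distr lborel borel (\<lambda>x. x + c) = lborel"
    using lborel_affine[of 1 c] by (simp add: density_1 add.commute)
  then have "integral\<^sup>L lborel f = integral\<^sup>L (distr lborel borel (\<lambda>x. x + c)) f" by simp
  also have "\<dots> = integral\<^sup>L lborel (\<lambda>x. f (x + c))"
    by (subst integral_distr) auto
  finally show ?thesis by simp
qed

text \<open>A difference quotient in direction \<open>i\<close> has integral 0 because Lebesgue
  measure is translation invariant, and dominated convergence passes this to the derivative.\<close>

lemma integral_partial_deriv_eq_0: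
  fixes \<Phi> :: "'a::euclidean_space \<Rightarrow> real"
  assumes C: "Ck (Suc 0) \<Phi>" and K: "compact K" "\<And>x. x \<notin> K \<Longrightarrow> \<Phi> x = 0" and i: "i \<in> Basis"
  shows "integral\<^sup>L lborel (partial_deriv i \<Phi>) = 0"
proof -
  have c: "continuous_on UNIV (partial_deriv i \<Phi>)" "continuous_on UNIV \<Phi>"
    using C i Ck_Suc_imp_Ck[OF C] by simp_all
  have [measurable]: "partial_deriv i \<Phi> \<in> borel_measurable borel" "\<Phi> \<in> borel_measurable borel"
    using c by (auto intro: borel_measurable_continuous_onI)
  have d: "\<Phi> differentiable (at x)" for x using C by simp
  have z: "partial_deriv i \<Phi> x = 0" if "x \<notin> K" for x
    using partial_deriv_eq_0_outside[of K \<Phi> x i] K that compact_imp_closed by blast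
  obtain B where B: "B \<ge> 0" "\<And>x. \<bar>partial_deriv i \<Phi> x\<bar> \<le> B"
    using bounded_compact_support[OF K(1) c(1) z] by metis
  obtain r where r: "K \<subseteq> ball 0 r"
    using compact_imp_bounded[OF K(1)] bounded_subset_ballD by blast
  define e where "e n = inverse (real (Suc n))" for n
  have e: "0 < e n" "e n \<le> 1" for n by (auto simp: e_def field_simps)
  define q where "q n x = (\<Phi> (x + e n *\<^sub>R i) - \<Phi> x) / e n" for n x
  have q_meas[measurable]: "q n \<in> borel_measurable borel" for n unfolding q_def by measurable
  have intq: "integral\<^sup>L lborel (q n) = 0" for n
  proof -
    have I: "integrable lborel \<Phi>" by (rule integrable_compact_support[OF K(1) c(2) K(2)])
    have "integrable lborel (\<lambda>x. \<Phi> (x + e n *\<^sub>R i))"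
    proof (rule integrable_compact_support)
      show "compact ((\<lambda>x. - (e n *\<^sub>R i) + x) ` K)"
        by (rule compact_translation[OF K(1)])
      show "continuous_on UNIV (\<lambda>x. \<Phi> (x + e n *\<^sub>R i))"
        by (rule continuous_on_compose2[OF c(2)]) (auto intro!: continuous_intros)
      show "\<Phi> (x + e n *\<^sub>R i) = 0" if "x \<notin> (\<lambda>x. - (e n *\<^sub>R i) + x) ` K" for x
        using that K(2)[of "x + e n *\<^sub>R i"] image_eqI[of x "\<lambda>x. - (e n *\<^sub>R i) + x" "x + e n *\<^sub>R i" K] by force
    qed
    with I show ?thesis
      unfolding q_def by (simp add: integral_lborel_translate)
  qed
  have "(\<lambda>n. integral\<^sup>L lborel (q n)) \<longlonglongrightarrow> integral\<^sup>L lborel (partial_deriv i \<Phi>)"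
  \<comment> \<open>By the mean value theorem the quotients are bounded by \<open>B\<close>. The
    steps \<open>e n\<close> are at most 1, so all quotients vanish outside the ball of radius
    \<open>r + 1\<close>.\<close>
  proof (rule integral_dominated_convergence[where w = "\<lambda>x. B * indicator (cball 0 (r + 1)) x"])
    show "integrable lborel (\<lambda>x::'a. B * indicator (cball 0 (r + 1)) x)"
      using borel_integrable_compact[of "cball 0 (r+1) :: 'a set" "\<lambda>_. B"]
      by (simp add: mult.commute)
    have "(\<lambda>n. q n x) \<longlonglongrightarrow> partial_deriv i \<Phi> x" for x
    proof -
      have "((\<lambda>t. \<Phi> (x + t *\<^sub>R i)) has_real_derivative partial_deriv i \<Phi> (x + 0 *\<^sub>R i)) (at 0)"
        by (rule has_derivative_line) (use d in simp)
      then have *: "((\<lambda>h. (\<Phi> (x + h *\<^sub>R i) - \<Phi> x) / h) \<longlongrightarrow> partial_deriv i \<Phi> x) (at 0)"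
        by (simp add: has_field_derivative_iff)
      have "filterlim e (at 0) sequentially"
        unfolding filterlim_at e_def using LIMSEQ_inverse_real_of_nat by auto
      from filterlim_compose[OF * this] show ?thesis by (simp add: q_def)
    qed
    then show "AE x in lborel. (\<lambda>n. q n x) \<longlonglongrightarrow> partial_deriv i \<Phi> x" by simp
    have "norm (q n x) \<le> B * indicator (cball 0 (r + 1)) x" for n x
    proof (cases "x \<in> cball 0 (r + 1)")
      case True
      have "\<exists>t. 0 < t \<and> t < e n \<and>
          \<Phi> (x + e n *\<^sub>R i) - \<Phi> (x + 0 *\<^sub>R i) = (e n - 0) * partial_deriv i \<Phi> (x + t *\<^sub>R i)"
        by (rule MVT2[OF e(1)]) (use d in \<open>auto intro!: has_derivative_line\<close>)
      then obtain t where "\<Phi> (x + e n *\<^sub>R i) - \<Phi> x = e n * partial_deriv i \<Phi> (x + t *\<^sub>R i)" by auto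
      then have "q n x = partial_deriv i \<Phi> (x + t *\<^sub>R i)"
        using e(1)[of n] by (simp add: q_def)
      then show ?thesis using B True by simp
    next
      case False
      then have n: "norm x > r + 1" by simp
      have "norm (x + e n *\<^sub>R i) \<ge> norm x - norm (e n *\<^sub>R i)" by (rule norm_diff_ineq)
      moreover have "norm (e n *\<^sub>R i) \<le> 1" using e[of n] i by simp
      ultimately have "norm (x + e n *\<^sub>R i) > r" using n by linarith
      then have "\<Phi> (x + e n *\<^sub>R i) = 0" "\<Phi> x = 0"
        using r n K(2)[of x] K(2)[of "x + e n *\<^sub>R i"] by fastforce+
      then show ?thesis using False by (simp add: q_def)
    qed
    then show "AE x in lborel. norm (q n x) \<le> B * indicator (cball 0 (r + 1)) x" for n by simp
  qed auto
  then show ?thesis by (simp add: intq LIMSEQ_const_iff)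
qed

lemma partial_deriv_mult:
  assumes "f differentiable (at x)" "g differentiable (at x)"
  shows "partial_deriv i (\<lambda>x. f x * g x) x = f x * partial_deriv i g x + partial_deriv i f x * g x"
  by (rule partial_deriv_eq) (intro has_derivative_mult has_derivative_partial_deriv assms)

lemma partial_deriv_compose:
  assumes "f differentiable (at x)" "(h has_real_derivative h') (at (f x))"
  shows "partial_deriv i (\<lambda>x. h (f x)) x = h' * partial_deriv i f x"
  by (rule partial_deriv_eq)
     (use has_derivative_compose[OF has_derivative_partial_deriv[OF assms(1)],
        of h "\<lambda>y. h' * y"] assms(2) in \<open>simp add: has_field_derivative_def\<close>)

lemma test_fun_support:
  assumes "test_fun \<Omega> \<phi>"
  obtains K where "compact K" "K \<subseteq> \<Omega>" "\<And>x. x \<notin> K \<Longrightarrow> \<phi> x = 0"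
  using assms closure_subset[of "{x. \<phi> x \<noteq> 0}"] unfolding test_fun_def by blast

lemma test_funI:
  assumes "smooth_fun \<phi>" "compact K" "K \<subseteq> \<Omega>" "\<And>x. x \<notin> K \<Longrightarrow> \<phi> x = 0"
  shows "test_fun \<Omega> \<phi>"
proof -
  have "closure {x. \<phi> x \<noteq> 0} \<subseteq> K"
    using assms by (intro closure_minimal compact_imp_closed) auto
  then show ?thesis unfolding test_fun_def
    using assms compact_Int_closed[OF assms(2) closed_closure, of "{x. \<phi> x \<noteq> 0}"]
    by (auto simp: Int_absorb1)
qed

lemma test_fun_Ck: "test_fun \<Omega> \<phi> \<Longrightarrow> Ck k \<phi>"
  by (auto simp: test_fun_def smooth_fun_def)

lemma test_fun_differentiable: "test_fun \<Omega> \<phi> \<Longrightarrow> \<phi> differentiable (at x)"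
  using test_fun_Ck[of \<Omega> \<phi> "Suc 0"] by simp

lemma test_fun_continuous:
  assumes "test_fun \<Omega> \<phi>"
  shows "continuous_on UNIV \<phi>" "i \<in> Basis \<Longrightarrow> continuous_on UNIV (partial_deriv i \<phi>)"
  using test_fun_Ck[OF assms, of 0] test_fun_Ck[OF assms, of "Suc 0"] by simp_all

lemma test_fun_borel [measurable_dest]: "test_fun \<Omega> \<phi> \<Longrightarrow> \<phi> \<in> borel_measurable borel"
  using test_fun_continuous(1) borel_measurable_continuous_onI by blast

lemma test_fun_partial_borel: "test_fun \<Omega> \<phi> \<Longrightarrow> i \<in> Basis \<Longrightarrow> partial_deriv i \<phi> \<in> borel_measurable borel"
  using test_fun_continuous(2) borel_measurable_continuous_onI by blast

text \<open>Compact support of \<open>\<phi>\<close> suffices: the product \<open>u * \<phi>\<close>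
  inherits it, and the integral of its derivative is 0.\<close>

lemma integration_by_parts:
  fixes u :: "'a::euclidean_space \<Rightarrow> real"
  assumes u: "Ck (Suc 0) u" and \<phi>: "test_fun \<Omega> \<phi>" and i: "i \<in> Basis"
  shows "integral\<^sup>L lborel (\<lambda>x. u x * partial_deriv i \<phi> x) = - integral\<^sup>L lborel (\<lambda>x. partial_deriv i u x * \<phi> x)"
proof -
  obtain K where K: "compact K" "\<And>x. x \<notin> K \<Longrightarrow> \<phi> x = 0" using test_fun_support[OF \<phi>] by metis
  have z: "partial_deriv i \<phi> x = 0" if "x \<notin> K" for x
    using partial_deriv_eq_0_outside[of K \<phi> x i] K that compact_imp_closed by blast
  have c: "continuous_on UNIV u" "continuous_on UNIV (partial_deriv i u)"
    using Ck_Suc_imp_Ck[OF u] u i by simp_all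
  have I: "integrable lborel (\<lambda>x. u x * partial_deriv i \<phi> x)" "integrable lborel (\<lambda>x. partial_deriv i u x * \<phi> x)"
    using test_fun_continuous[OF \<phi>] i K z c
    by (auto intro!: integrable_compact_support[OF K(1)] continuous_intros)
  have "0 = integral\<^sup>L lborel (partial_deriv i (\<lambda>x. u x * \<phi> x))"
    by (rule integral_partial_deriv_eq_0[OF Ck_mult[OF u test_fun_Ck[OF \<phi>]] K(1) _ i, symmetric])
       (use K in auto)
  also have "partial_deriv i (\<lambda>x. u x * \<phi> x) = (\<lambda>x. u x * partial_deriv i \<phi> x + partial_deriv i u x * \<phi> x)"
    using u by (intro ext partial_deriv_mult test_fun_differentiable[OF \<phi>]) simp
  also have "integral\<^sup>L lborel \<dots> = integral\<^sup>L lborel (\<lambda>x. u x * partial_deriv i \<phi> x) + integral\<^sup>L lborel (\<lambda>x. partial_deriv i u x * \<phi> x)"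
    by (rule Bochner_Integration.integral_add[OF I])
  finally show ?thesis by simp
qed

section \<open>The fundamental lemma of the calculus of variations\<close>

lemma set_borel_measurable_lebesgue_on:
  fixes u :: "'a::euclidean_space \<Rightarrow> 'b::real_normed_vector"
  shows "open \<Omega> \<Longrightarrow> set_borel_measurable lebesgue \<Omega> u \<longleftrightarrow> u \<in> borel_measurable (lebesgue_on \<Omega>)"
  unfolding set_borel_measurable_def by (subst borel_measurable_restrict_space_iff) auto

lemma set_integrable_lebesgue_on:
  fixes u :: "'a::euclidean_space \<Rightarrow> 'b::{banach, second_countable_topology}"
  shows "open \<Omega> \<Longrightarrow> set_integrable lebesgue \<Omega> u \<longleftrightarrow> integrable (lebesgue_on \<Omega>) u"
  unfolding set_integrable_def by (subst integrable_restrict_space) auto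

lemma set_lebesgue_integral_lebesgue_on:
  fixes u :: "'a::euclidean_space \<Rightarrow> 'b::{banach, second_countable_topology}"
  shows "open \<Omega> \<Longrightarrow> set_lebesgue_integral lebesgue \<Omega> u = integral\<^sup>L (lebesgue_on \<Omega>) u"
  unfolding set_lebesgue_integral_def by (subst integral_restrict_space) auto

lemma AE_lebesgue_on:
  "open \<Omega> \<Longrightarrow> (AE x in lebesgue. x \<in> \<Omega> \<longrightarrow> P x) \<longleftrightarrow> (AE x in lebesgue_on \<Omega>. P x)"
  for \<Omega> :: "'a::euclidean_space set"
  by (subst AE_restrict_space_iff) auto

lemma borel_measurable_lebesgue_onI:
  "f \<in> borel_measurable borel \<Longrightarrow> f \<in> borel_measurable (lebesgue_on S)"
  by (simp add: measurable_completion measurable_restrict_space1)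

lemma integral_lebesgue_on_eq_lborel:
  fixes f :: "'a::euclidean_space \<Rightarrow> real"
  assumes "open \<Omega>" "f \<in> borel_measurable borel" "\<And>x. x \<notin> \<Omega> \<Longrightarrow> f x = 0"
  shows "integral\<^sup>L (lebesgue_on \<Omega>) f = integral\<^sup>L lborel f"
proof -
  have "integral\<^sup>L (lebesgue_on \<Omega>) f = integral\<^sup>L lebesgue (\<lambda>x. indicator \<Omega> x *\<^sub>R f x)"
    by (subst integral_restrict_space) (use assms in auto)
  also have "(\<lambda>x. indicator \<Omega> x *\<^sub>R f x) = f" using assms(3) by (auto simp: indicator_def fun_eq_iff)
  also have "integral\<^sup>L lebesgue f = integral\<^sup>L lborel f"
    using assms by (intro integral_completion) auto
  finally show ?thesis .
qed

lemma integrable_lebesgue_on_lborel: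
  fixes f :: "'a::euclidean_space \<Rightarrow> real"
  assumes "open \<Omega>" "integrable lborel f"
  shows "integrable (lebesgue_on \<Omega>) f"
  using assms integrable_completion[of f lborel] integrable_mult_indicator[of \<Omega> lebesgue f]
  by (subst integrable_restrict_space) auto

lemma finite_measure_bounded_open:
  fixes \<Omega> :: "'a::euclidean_space set"
  shows "bounded \<Omega> \<Longrightarrow> open \<Omega> \<Longrightarrow> finite_measure (lebesgue_on \<Omega>)"
  by (intro finite_measure_lebesgue_on lmeasurable_open)

text \<open>A smooth function that vanishes off an open box: each factor vanishes beyond one face.
  The scaling by \<open>Suc n\<close> drives a factor to 1 wherever its argument is positive, so the
  bumps converge pointwise to the indicator of the box and stay below 1.\<close>

definition box_bump :: "'a::euclidean_space \<Rightarrow> 'a \<Rightarrow> nat \<Rightarrow> 'a \<Rightarrow> real" where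
  "box_bump a b n x = (\<Prod>i\<in>Basis. flat_exp 0 (real (Suc n) * (x \<bullet> i + - (a \<bullet> i))) *
      flat_exp 0 (real (Suc n) * (b \<bullet> i + - 1 * (x \<bullet> i))))"

lemma flat_exp_0_bounds: "0 \<le> flat_exp 0 x" "flat_exp 0 x \<le> 1"
  by (auto simp: flat_exp_def)

lemma smooth_box_bump: "smooth_fun (box_bump a b n)"
  unfolding smooth_fun_def box_bump_def
  by (intro allI Ck_prod Ck_mult Ck_compose[OF Ck_flat_exp] Ck_const Ck_add Ck_inner)

lemma box_bump_eq_0: "x \<notin> box a b \<Longrightarrow> box_bump a b n x = 0"
proof -
  assume "x \<notin> box a b"
  then obtain i where i: "i \<in> Basis" "x \<bullet> i \<le> a \<bullet> i \<or> b \<bullet> i \<le> x \<bullet> i"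
    by (auto simp: mem_box not_less)
  then have "flat_exp 0 (real (Suc n) * (x \<bullet> i + - (a \<bullet> i))) *
      flat_exp 0 (real (Suc n) * (b \<bullet> i + - 1 * (x \<bullet> i))) = 0"
    by (auto simp: flat_exp_def not_le zero_less_mult_iff simp del: of_nat_Suc)
  with i(1) show ?thesis unfolding box_bump_def by (intro prod_zero) auto
qed

lemma box_bump_bounds: "0 \<le> box_bump a b n x" "box_bump a b n x \<le> 1"
  unfolding box_bump_def
  by (auto intro!: prod_nonneg prod_le_1 mult_nonneg_nonneg mult_le_one flat_exp_0_bounds)

lemma flat_exp_0_tendsto_1:
  assumes "c > 0"
  shows "(\<lambda>n. flat_exp 0 (real (Suc n) * c)) \<longlonglongrightarrow> 1"
proof -
  have "(\<lambda>n. exp (- (inverse c * inverse (real (Suc n))))) \<longlonglongrightarrow> exp (- (inverse c * 0))"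
    by (intro tendsto_intros LIMSEQ_inverse_real_of_nat)
  moreover have "flat_exp 0 (real (Suc n) * c) = exp (- (inverse c * inverse (real (Suc n))))" for n
    using assms by (simp add: flat_exp_def not_le mult_ac del: of_nat_Suc)
  ultimately show ?thesis by simp
qed

lemma box_bump_tendsto: "(\<lambda>n. box_bump a b n x) \<longlonglongrightarrow> indicator (box a b) x"
proof (cases "x \<in> box a b")
  case True
  have "(\<lambda>n. box_bump a b n x) \<longlonglongrightarrow> (\<Prod>i\<in>(Basis::'a set). 1 * 1)"
    unfolding box_bump_def
    by (intro tendsto_prod tendsto_mult flat_exp_0_tendsto_1) (use True in \<open>auto simp: mem_box\<close>)
  then show ?thesis using True by simp
qed (simp add: box_bump_eq_0)

text \<open>The positive and the negative part of \<open>v\<close> are densities of two measures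
  that agree on boxes, an intersection-stable generator of the Borel sets. So the measures are
  equal, and their densities agree a.e.\<close>

lemma AE_eq_0_if_box_integrals_eq_0:
  fixes v :: "'a::euclidean_space \<Rightarrow> real"
  assumes I: "integrable lborel v" and z: "\<And>a b. integral\<^sup>L lborel (\<lambda>x. indicator (box a b) x * v x) = 0"
  shows "AE x in lborel. v x = 0"
proof -
  have [measurable]: "v \<in> borel_measurable borel" using I by auto
  define p where "p x = ennreal (v x)" for x
  define m where "m x = ennreal (- v x)" for x
  have [measurable]: "p \<in> borel_measurable borel" "m \<in> borel_measurable borel"
    unfolding p_def m_def by measurable
  have e: "emeasure (density lborel p) (box a b) = ennreal (\<integral>x. indicator (box a b) x * max 0 (v x) \<partial>lborel)"
    "emeasure (density lborel m) (box a b) = ennreal (\<integral>x. indicator (box a b) x * max 0 (- v x) \<partial>lborel)"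
    "integrable lborel (\<lambda>x. indicator (box a b) x * max 0 (v x))"
    "integrable lborel (\<lambda>x. indicator (box a b) x * max 0 (- v x))" for a b
  proof -
    show i1: "integrable lborel (\<lambda>x. indicator (box a b) x * max 0 (v x))"
      and i2: "integrable lborel (\<lambda>x. indicator (box a b) x * max 0 (- v x))"
      using I by (auto intro!: Bochner_Integration.integrable_bound[OF I] simp: indicator_def max_def)
    show "emeasure (density lborel p) (box a b) = ennreal (\<integral>x. indicator (box a b) x * max 0 (v x) \<partial>lborel)"
      by (subst emeasure_density, simp, simp, subst nn_integral_eq_integral[OF i1, symmetric])
         (auto intro!: nn_integral_cong simp: p_def indicator_def max_def ennreal_neg)
    show "emeasure (density lborel m) (box a b) = ennreal (\<integral>x. indicator (box a b) x * max 0 (- v x) \<partial>lborel)"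
      by (subst emeasure_density, simp, simp, subst nn_integral_eq_integral[OF i2, symmetric])
         (auto intro!: nn_integral_cong simp: m_def indicator_def max_def ennreal_neg)
  qed
  have "density lborel p = density lborel m"
  proof (rule measure_eqI_generator_eq)
    let ?E = "range (\<lambda>(a, b). box a b::'a set)"
    show "Int_stable ?E"
      by (auto simp: Int_stable_def box_Int_box)
    show "?E \<subseteq> Pow UNIV" "sets (density lborel p) = sigma_sets UNIV ?E" "sets (density lborel m) = sigma_sets UNIV ?E"
      by (simp_all add: borel_eq_box)
    let ?A = "\<lambda>n::nat. box (- (real n *\<^sub>R One)) (real n *\<^sub>R One) :: 'a set"
    show "range ?A \<subseteq> ?E" "(\<Union>i. ?A i) = UNIV"
      unfolding UN_box_eq_UNIV by auto
    show "emeasure (density lborel p) (?A i) \<noteq> \<infinity>" for i by (simp add: e)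
    show "emeasure (density lborel p) X = emeasure (density lborel m) X" if X: "X \<in> ?E" for X
    proof -
      obtain a b where [simp]: "X = box a b" using X by auto
      have "0 = (\<integral>x. indicator (box a b) x * max 0 (v x) - indicator (box a b) x * max 0 (- v x) \<partial>lborel)"
        by (subst z[of a b, symmetric]) (intro Bochner_Integration.integral_cong, auto simp: max_def algebra_simps)
      then show ?thesis using e[of a b] by simp
    qed
  qed
  then have "AE x in lborel. p x = m x"
    by (subst (asm) sigma_finite_measure.density_unique_iff[OF sigma_finite_lborel]) auto
  then show ?thesis
  proof eventually_elim
    case (elim x)
    then show ?case
      by (cases "v x \<ge> 0") (auto simp: p_def m_def ennreal_neg)
  qed
qed

text \<open>Bumps reduce the claim to integrals over boxes. These vanish for boxes whose closure
  lies in \<open>\<Omega>\<close>, so the argument is local and is patched together by a countable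
  cover.\<close>

lemma fundamental_lemma:
  fixes u :: "'a::euclidean_space \<Rightarrow> real"
  assumes \<Omega>: "open \<Omega>" and I: "integrable (lebesgue_on \<Omega>) u"
    and z: "\<And>\<phi>. test_fun \<Omega> \<phi> \<Longrightarrow> integral\<^sup>L (lebesgue_on \<Omega>) (\<lambda>x. u x * \<phi> x) = 0"
  shows "AE x in lebesgue_on \<Omega>. u x = 0"
proof -
  \<comment> \<open>Extension by zero gives a function on the whole space, and its Borel version
    \<open>v\<close> lives on \<open>lborel\<close>, where the statement about boxes
    applies.\<close>
  define w where "w x = indicator \<Omega> x *\<^sub>R u x" for x
  have Iw: "integrable lebesgue w"
    using I \<Omega> unfolding w_def by (subst (asm) integrable_restrict_space) auto
  then obtain v where v: "v \<in> borel_measurable lborel" "AE x in lborel. w x = v x"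
    using completion_ex_borel_measurable_real[of w lborel] by auto
  have [measurable]: "v \<in> borel_measurable borel" using v by simp
  have ae: "AE x in lebesgue. w x = v x" using v(2) by (rule AE_completion)
  have vl: "v \<in> borel_measurable lebesgue" using v(1) by (rule measurable_completion)
  have Iv: "integrable lborel v"
    using integrable_cong_AE[of w lebesgue v] Iw ae vl integrable_completion[OF v(1)] by auto
  have bx: "integral\<^sup>L lborel (\<lambda>x. indicator (box a b) x * v x) = 0" if "cbox a b \<subseteq> \<Omega>" for a b
  proof -
    have "(\<lambda>n. integral\<^sup>L lborel (\<lambda>x. box_bump a b n x * v x)) \<longlonglongrightarrow> integral\<^sup>L lborel (\<lambda>x. indicator (box a b) x * v x)"
    proof (rule integral_dominated_convergence[where w = "\<lambda>x. \<bar>v x\<bar>"])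
      have t: "test_fun \<Omega> (box_bump a b n)" for n
        by (rule test_funI[OF smooth_box_bump compact_cbox that]) (use box_bump_eq_0 box_subset_cbox in blast)
      show "(\<lambda>x. box_bump a b n x * v x) \<in> borel_measurable lborel" for n
        using test_fun_borel[OF t[of n]] by simp
      show "AE x in lborel. (\<lambda>n. box_bump a b n x * v x) \<longlonglongrightarrow> indicator (box a b) x * v x"
        by (intro AE_I2 tendsto_mult box_bump_tendsto tendsto_const)
      show "AE x in lborel. norm (box_bump a b n x * v x) \<le> \<bar>v x\<bar>" for n
        using box_bump_bounds[of a b n] by (auto simp: abs_mult intro!: mult_left_le_one_le)
    qed (use Iv in auto)
    moreover have "integral\<^sup>L lborel (\<lambda>x. box_bump a b n x * v x) = 0" for n
    proof -
      have t: "test_fun \<Omega> (box_bump a b n)"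
        by (rule test_funI[OF smooth_box_bump compact_cbox that]) (use box_bump_eq_0 box_subset_cbox in blast)
      note [measurable] = test_fun_borel[OF t]
      have "integral\<^sup>L lborel (\<lambda>x. box_bump a b n x * v x) = integral\<^sup>L lebesgue (\<lambda>x. box_bump a b n x * v x)"
        by (subst integral_completion) auto
      also have "\<dots> = integral\<^sup>L lebesgue (\<lambda>x. box_bump a b n x * w x)"
      proof (rule integral_cong_AE)
        have "box_bump a b n \<in> borel_measurable lebesgue"
          by (rule measurable_completion) simp
        then show "(\<lambda>x. box_bump a b n x * v x) \<in> borel_measurable lebesgue"
          "(\<lambda>x. box_bump a b n x * w x) \<in> borel_measurable lebesgue"
          using vl borel_measurable_integrable[OF Iw] by (simp_all add: borel_measurable_times)
      qed (use ae in auto)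
      also have "\<dots> = integral\<^sup>L (lebesgue_on \<Omega>) (\<lambda>x. u x * box_bump a b n x)"
        using \<Omega> by (subst integral_restrict_space) (auto simp: w_def mult_ac)
      finally show ?thesis using z[OF t] by simp
    qed
    ultimately show ?thesis by (simp add: LIMSEQ_const_iff)
  qed
  have loc: "AE x in lborel. x \<in> box a b \<longrightarrow> v x = 0" if ab: "cbox a b \<subseteq> \<Omega>" for a b
  proof -
    have "AE x in lborel. indicator (box a b) x * v x = 0"
    proof (rule AE_eq_0_if_box_integrals_eq_0)
      show "integrable lborel (\<lambda>x. indicator (box a b) x * v x)"
        using integrable_mult_indicator[OF _ Iv, of "box a b"] by simp
      fix c d :: 'a
      obtain c' d' where cd: "box c d \<inter> box a b = box c' d'"
        by (simp add: box_Int_box)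
      have "integral\<^sup>L lborel (\<lambda>x. indicator (box c' d') x * v x) = 0"
      \<comment> \<open>An empty open box may have corners whose closed box is not contained in
        \<open>\<Omega>\<close>. For a nonempty one the closed box is the closure, which stays
        inside \<open>cbox a b\<close>.\<close>
      proof (cases "box c' d' = {}")
        case False
        then have "cbox c' d' = closure (box c' d')" by (simp add: closure_box)
        also have "\<dots> \<subseteq> closure (box a b)" using cd by (intro closure_mono) auto
        also have "\<dots> \<subseteq> cbox a b" by (intro closure_minimal box_subset_cbox closed_cbox)
        finally show ?thesis using ab by (intro bx) auto
      qed simp
      moreover have "indicator (box c d) x * (indicator (box a b) x * v x) = indicator (box c' d') x * v x" for x
        using cd by (auto simp: indicator_def)
      ultimately show "integral\<^sup>L lborel (\<lambda>x. indicator (box c d) x * (indicator (box a b) x * v x)) = 0"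
        by (simp only:)
    qed
    then show ?thesis by eventually_elim (auto simp: indicator_def split: if_splits)
  qed
  define F where "F = {box a b | a b. cbox a b \<subseteq> \<Omega>}"
  \<comment> \<open>By Lindelof's theorem countably many of the boxes cover the domain, so the
    exceptional sets add up to a null set.\<close>
  obtain F' where F': "F' \<subseteq> F" "countable F'" "\<Union>F' = \<Union>F"
    using Lindelof[of F] unfolding F_def by auto
  have "AE x in lborel. \<forall>X\<in>F'. x \<in> X \<longrightarrow> v x = 0"
    using F' loc unfolding AE_ball_countable[OF F'(2)] by (auto simp: F_def)
  moreover have "\<Omega> \<subseteq> \<Union>F'"
  proof
    fix x assume "x \<in> \<Omega>"
    then obtain a b where "cbox a b \<subseteq> \<Omega>" "x \<in> box a b"
      using open_contains_cbox[of \<Omega> x] \<Omega> by metis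
    then show "x \<in> \<Union>F'" unfolding F' by (auto simp: F_def)
  qed
  ultimately have "AE x in lborel. x \<in> \<Omega> \<longrightarrow> v x = 0" by (auto elim!: eventually_mono)
  then have "AE x in lebesgue. x \<in> \<Omega> \<longrightarrow> v x = 0" by (rule AE_completion)
  with ae have "AE x in lebesgue. x \<in> \<Omega> \<longrightarrow> u x = 0"
    by eventually_elim (auto simp: w_def)
  then show ?thesis using AE_lebesgue_on[OF \<Omega>] by blast
qed

section \<open>Weak gradients in square integrable form and their uniqueness\<close>

lemma integrable_inner_square:
  fixes w :: "'a \<Rightarrow> 'b::euclidean_space"
  assumes [measurable]: "w \<in> borel_measurable M" and "integrable M (\<lambda>x. (norm (w x))\<^sup>2)" "i \<in> Basis"
  shows "integrable M (\<lambda>x. (w x \<bullet> i)\<^sup>2)"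
proof (rule Bochner_Integration.integrable_bound[OF assms(2)])
  have "(w x \<bullet> i)\<^sup>2 \<le> (norm (w x))\<^sup>2" for x
    using Basis_le_norm[OF assms(3), of "w x"] by (auto simp: abs_le_square_iff[symmetric])
  then show "AE x in M. norm ((w x \<bullet> i)\<^sup>2) \<le> norm ((norm (w x))\<^sup>2)" by simp
qed simp

text \<open>Trades the components of \<open>w\<close> for its Euclidean norm and set integrals for
  the restricted measure, the form in which limits and estimates are handled below.\<close>

lemma has_weak_grad_iff:
  assumes "open \<Omega>"
  shows "has_weak_grad \<Omega> u w \<longleftrightarrow>
    u \<in> borel_measurable (lebesgue_on \<Omega>) \<and> integrable (lebesgue_on \<Omega>) (\<lambda>x. (u x)\<^sup>2) \<and>
    w \<in> borel_measurable (lebesgue_on \<Omega>) \<and> integrable (lebesgue_on \<Omega>) (\<lambda>x. (norm (w x))\<^sup>2) \<and>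
    (\<forall>\<phi>. test_fun \<Omega> \<phi> \<longrightarrow> (\<forall>i\<in>Basis. integral\<^sup>L (lebesgue_on \<Omega>) (\<lambda>x. u x * partial_deriv i \<phi> x)
        = - integral\<^sup>L (lebesgue_on \<Omega>) (\<lambda>x. (w x \<bullet> i) * \<phi> x)))" (is "?L \<longleftrightarrow> ?R")
proof -
  have n: "(norm (w x))\<^sup>2 = (\<Sum>i\<in>Basis. (w x \<bullet> i)\<^sup>2)" for x
    unfolding power2_norm_eq_inner by (subst euclidean_inner) (simp add: power2_eq_square)
  have "(\<forall>i\<in>Basis. (\<lambda>x. w x \<bullet> i) \<in> borel_measurable (lebesgue_on \<Omega>) \<and> integrable (lebesgue_on \<Omega>) (\<lambda>x. (w x \<bullet> i)\<^sup>2))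
     \<longleftrightarrow> w \<in> borel_measurable (lebesgue_on \<Omega>) \<and> integrable (lebesgue_on \<Omega>) (\<lambda>x. (norm (w x))\<^sup>2)" (is "?A \<longleftrightarrow> ?B")
  proof
    assume ?A
    then have "w \<in> borel_measurable (lebesgue_on \<Omega>)"
      by (subst borel_measurable_euclidean_space) blast
    with \<open>?A\<close> show ?B unfolding n by simp
  next
    assume B: ?B
    then have [measurable]: "w \<in> borel_measurable (lebesgue_on \<Omega>)" by simp
    then show ?A
      using B integrable_inner_square[of w] by auto
  qed
  then show ?thesis
    unfolding has_weak_grad_def L2_on_def set_borel_measurable_lebesgue_on[OF assms]
      set_integrable_lebesgue_on[OF assms] set_lebesgue_integral_lebesgue_on[OF assms]
    by blast
qed

lemma integrable_mult_L2:
  fixes u v :: "'a \<Rightarrow> real"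
  assumes [measurable]: "u \<in> borel_measurable M" "v \<in> borel_measurable M"
    and "integrable M (\<lambda>x. (u x)\<^sup>2)" "integrable M (\<lambda>x. (v x)\<^sup>2)"
  shows "integrable M (\<lambda>x. u x * v x)"
proof (rule Bochner_Integration.integrable_bound)
  show "integrable M (\<lambda>x. (u x)\<^sup>2 + (v x)\<^sup>2)" using assms by simp
  have "\<bar>a * b\<bar> \<le> \<bar>a\<^sup>2 + b\<^sup>2\<bar>" for a b :: real
  proof -
    have "2 * (\<bar>a\<bar> * \<bar>b\<bar>) \<le> a\<^sup>2 + b\<^sup>2" using sum_squares_bound[of "\<bar>a\<bar>" "\<bar>b\<bar>"] by simp
    moreover have "0 \<le> \<bar>a\<bar> * \<bar>b\<bar>" by simp
    ultimately have "\<bar>a\<bar> * \<bar>b\<bar> \<le> a\<^sup>2 + b\<^sup>2" by linarith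
    then show ?thesis by (simp add: abs_mult)
  qed
  then show "AE x in M. norm (u x * v x) \<le> norm ((u x)\<^sup>2 + (v x)\<^sup>2)" by simp
qed simp

lemma test_fun_bounded:
  assumes "test_fun \<Omega> \<phi>"
  obtains B where "B \<ge> 0" "\<And>x. \<bar>\<phi> x\<bar> \<le> B" "\<And>i x. i \<in> Basis \<Longrightarrow> \<bar>partial_deriv i \<phi> x\<bar> \<le> B"
proof -
  obtain K where K: "compact K" "\<And>x. x \<notin> K \<Longrightarrow> \<phi> x = 0" using test_fun_support[OF assms] by metis
  have z: "partial_deriv i \<phi> x = 0" if "x \<notin> K" for i x
    using partial_deriv_eq_0_outside[of K \<phi> x i] K that compact_imp_closed by blast
  obtain B where B: "B \<ge> 0" "\<And>x. \<bar>\<phi> x\<bar> \<le> B"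
    using bounded_compact_support[OF K(1) test_fun_continuous(1)[OF assms] K(2)] by metis
  have "\<exists>C\<ge>0. \<forall>x. \<bar>partial_deriv i \<phi> x\<bar> \<le> C" if "i \<in> Basis" for i
    using bounded_compact_support[OF K(1) test_fun_continuous(2)[OF assms that] z] by metis
  then obtain C where C: "\<And>i. i \<in> Basis \<Longrightarrow> C i \<ge> 0" "\<And>i x. i \<in> Basis \<Longrightarrow> \<bar>partial_deriv i \<phi> x\<bar> \<le> C i"
    by metis
  show thesis
  proof (rule that[of "B + sum C Basis"])
    have s: "sum C Basis \<ge> 0" using C(1) by (rule sum_nonneg)
    show "0 \<le> B + sum C Basis" "\<bar>\<phi> x\<bar> \<le> B + sum C Basis" for x
      using B(1) B(2)[of x] s by auto
    show "\<bar>partial_deriv i \<phi> x\<bar> \<le> B + sum C Basis" if "i \<in> Basis" for i x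
      using C(2)[OF that, of x] B(1) member_le_sum[OF that, of C] C(1) by auto
  qed
qed

lemma integrable_L2_mult_bounded:
  fixes u v :: "'a::euclidean_space \<Rightarrow> real"
  assumes \<Omega>: "bounded \<Omega>" "open \<Omega>"
    and [measurable]: "u \<in> borel_measurable (lebesgue_on \<Omega>)" "v \<in> borel_measurable (lebesgue_on \<Omega>)"
    and u: "integrable (lebesgue_on \<Omega>) (\<lambda>x. (u x)\<^sup>2)" and v: "\<And>x. \<bar>v x\<bar> \<le> B"
  shows "integrable (lebesgue_on \<Omega>) (\<lambda>x. u x * v x)"
proof -
  interpret finite_measure "lebesgue_on \<Omega>" by (rule finite_measure_bounded_open[OF \<Omega>])
  have "\<bar>(v x)\<^sup>2\<bar> \<le> B\<^sup>2" for x using v[of x] by (auto simp: abs_le_square_iff[symmetric])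
  then show ?thesis
    using integrable_const_bound[of "\<lambda>x. (v x)\<^sup>2" "B\<^sup>2"] u by (intro integrable_mult_L2) auto
qed

text \<open>\<open>wgrad\<close> is chosen by \<open>SOME\<close>, so an explicitly computed
  gradient can be exchanged for it only through this uniqueness. Each component of the difference
  integrates to 0 against every test function.\<close>

lemma has_weak_grad_unique:
  assumes \<Omega>: "bounded \<Omega>" "open \<Omega>" and w: "has_weak_grad \<Omega> u w" "has_weak_grad \<Omega> u w'"
  shows "AE x in lebesgue_on \<Omega>. w x = w' x"
proof -
  note W = w[unfolded has_weak_grad_iff[OF \<Omega>(2)]]
  have [measurable]: "w \<in> borel_measurable (lebesgue_on \<Omega>)" "w' \<in> borel_measurable (lebesgue_on \<Omega>)"
    using W by auto
  have i2: "integrable (lebesgue_on \<Omega>) (\<lambda>x. (w x \<bullet> i)\<^sup>2)" "integrable (lebesgue_on \<Omega>) (\<lambda>x. (w' x \<bullet> i)\<^sup>2)"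
    if "i \<in> Basis" for i
    using W that by (auto intro!: integrable_inner_square)
  have "AE x in lebesgue_on \<Omega>. w x \<bullet> i - w' x \<bullet> i = 0" if i: "i \<in> Basis" for i
  proof (rule fundamental_lemma[OF \<Omega>(2)])
    have "integrable (lebesgue_on \<Omega>) (\<lambda>x. (w x \<bullet> i) * 1)" "integrable (lebesgue_on \<Omega>) (\<lambda>x. (w' x \<bullet> i) * 1)"
      by (rule integrable_L2_mult_bounded[OF \<Omega>, where B = 1]; use i2[OF i] in simp)+
    then show "integrable (lebesgue_on \<Omega>) (\<lambda>x. w x \<bullet> i - w' x \<bullet> i)" by simp
    fix \<phi> :: "'a \<Rightarrow> real" assume t: "test_fun \<Omega> \<phi>"
    obtain B where B: "\<And>x. \<bar>\<phi> x\<bar> \<le> B" using test_fun_bounded[OF t] by metis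
    have m: "\<phi> \<in> borel_measurable (lebesgue_on \<Omega>)"
      using test_fun_borel[OF t] by (rule borel_measurable_lebesgue_onI)
    have "integrable (lebesgue_on \<Omega>) (\<lambda>x. (w x \<bullet> i) * \<phi> x)" "integrable (lebesgue_on \<Omega>) (\<lambda>x. (w' x \<bullet> i) * \<phi> x)"
      by (rule integrable_L2_mult_bounded[OF \<Omega>, where B = B]; use i2[OF i] B m in simp)+
    moreover have "integral\<^sup>L (lebesgue_on \<Omega>) (\<lambda>x. (w x \<bullet> i) * \<phi> x) = integral\<^sup>L (lebesgue_on \<Omega>) (\<lambda>x. (w' x \<bullet> i) * \<phi> x)"
    proof -
      have "integral\<^sup>L (lebesgue_on \<Omega>) (\<lambda>x. u x * partial_deriv i \<phi> x) = - integral\<^sup>L (lebesgue_on \<Omega>) (\<lambda>x. (w x \<bullet> i) * \<phi> x)"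
        "integral\<^sup>L (lebesgue_on \<Omega>) (\<lambda>x. u x * partial_deriv i \<phi> x) = - integral\<^sup>L (lebesgue_on \<Omega>) (\<lambda>x. (w' x \<bullet> i) * \<phi> x)"
        using W t i by blast+
      then show ?thesis by simp
    qed
    ultimately show "integral\<^sup>L (lebesgue_on \<Omega>) (\<lambda>x. (w x \<bullet> i - w' x \<bullet> i) * \<phi> x) = 0"
      by (simp add: left_diff_distrib)
  qed
  then have "AE x in lebesgue_on \<Omega>. \<forall>i\<in>Basis. w x \<bullet> i - w' x \<bullet> i = 0"
    by (subst AE_finite_all) auto
  then show ?thesis by eventually_elim (auto intro: euclidean_eqI)
qed

section \<open>The Sobolev inequality\<close>

text \<open>Powers on \<open>ennreal\<close> that send \<open>top\<close> to \<open>top\<close>.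
  With them iterated integrals of products of powers make sense before anything is known to be
  integrable.\<close>

definition epowr :: "real \<Rightarrow> ennreal \<Rightarrow> ennreal" where
  "epowr a y = (if y = top then top else ennreal (enn2real y powr a))"

lemma epowr_ennreal: "0 \<le> y \<Longrightarrow> epowr a (ennreal y) = ennreal (y powr a)"
  by (simp add: epowr_def)

lemma epowr_top: "epowr a top = top"
  by (simp add: epowr_def)

lemma epowr_eq_0: "epowr a y = 0 \<longleftrightarrow> y = 0"
  by (cases y) (auto simp: epowr_def)

lemma epowr_mono: "0 \<le> a \<Longrightarrow> x \<le> y \<Longrightarrow> epowr a x \<le> epowr a y"
  by (cases x; cases y) (auto simp: epowr_def top_unique intro!: ennreal_leI powr_mono2)

lemma epowr_measurable [measurable]: "epowr a \<in> borel_measurable borel"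
  unfolding epowr_def by measurable

text \<open>Hoelder's inequality with \<open>card I\<close> equal exponents. After each factor is
  divided by its integral, the geometric mean is bounded pointwise by the arithmetic mean, whose
  integral is 1.\<close>

lemma nn_integral_Holder:
  assumes I: "finite I" "I \<noteq> {}" and [measurable]: "\<And>i. i \<in> I \<Longrightarrow> Y i \<in> borel_measurable M"
  shows "(\<integral>\<^sup>+x. (\<Prod>i\<in>I. epowr (1 / card I) (Y i x)) \<partial>M) \<le> (\<Prod>i\<in>I. epowr (1 / card I) (\<integral>\<^sup>+x. Y i x \<partial>M))"
proof -
  define m where "m = real (card I)"
  have m: "m > 0" using I by (simp add: m_def card_gt_0_iff)
  define T where "T i = (\<integral>\<^sup>+x. Y i x \<partial>M)" for i
  \<comment> \<open>The normalisation requires finite nonzero integrals. A vanishing one is treated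
    before an infinite one, because 0 times \<open>top\<close> is 0 in
    \<open>ennreal\<close>.\<close>
  consider "\<exists>i\<in>I. T i = 0" | "\<forall>i\<in>I. T i \<noteq> 0" "\<exists>i\<in>I. T i = top" | "\<forall>i\<in>I. T i \<noteq> 0 \<and> T i \<noteq> top" by blast
  then have "(\<integral>\<^sup>+x. (\<Prod>i\<in>I. epowr (1 / m) (Y i x)) \<partial>M) \<le> (\<Prod>i\<in>I. epowr (1 / m) (T i))"
  proof cases
    case 1
    then obtain i where i: "i \<in> I" "T i = 0" by blast
    then have "AE x in M. Y i x = 0"
      unfolding T_def by (subst (asm) nn_integral_0_iff_AE) auto
    then have "AE x in M. (\<Prod>i\<in>I. epowr (1 / m) (Y i x)) = 0"
      by eventually_elim (use i I in \<open>auto intro!: prod_zero simp: epowr_eq_0\<close>)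
    then have "(\<integral>\<^sup>+x. (\<Prod>i\<in>I. epowr (1 / m) (Y i x)) \<partial>M) = (\<integral>\<^sup>+x. 0 \<partial>M)"
      by (rule nn_integral_cong_AE)
    then show ?thesis by simp
  next
    case 2
    then obtain i where i: "i \<in> I" "T i = top" by blast
    have "(\<Prod>i\<in>I - {i}. epowr (1 / m) (T i)) \<noteq> 0"
      using I 2 by (auto simp: epowr_eq_0)
    then have "(\<Prod>i\<in>I. epowr (1 / m) (T i)) = top"
      using I i by (simp add: prod.remove[of I i] epowr_top ennreal_top_mult)
    then show ?thesis by simp
  next
    case 3
    define t where "t i = enn2real (T i)" for i
    have t: "T i = ennreal (t i)" "t i > 0" if "i \<in> I" for i
      using 3 that by (auto simp: t_def ennreal_enn2real_if enn2real_positive_iff less_top zero_less_iff_neq_zero)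
    define C where "C = (\<Prod>i\<in>I. t i powr (1 / m))"
    have C: "C > 0" unfolding C_def by (intro prod_pos) (use t in force)
    have pw: "(\<Prod>i\<in>I. epowr (1 / m) (Y i x)) \<le> ennreal C * (\<Sum>i\<in>I. ennreal (1 / (t i * m)) * Y i x)" for x
    proof (cases "\<exists>i\<in>I. Y i x = top")
      case True
      then obtain i where i: "i \<in> I" "Y i x = top" by blast
      have "ennreal (1 / (t i * m)) * Y i x = top"
        using i t(2)[OF i(1)] m by (simp add: ennreal_mult_top)
      then have "(\<Sum>i\<in>I. ennreal (1 / (t i * m)) * Y i x) = top"
        using bexI[of "\<lambda>i. ennreal (1 / (t i * m)) * Y i x = top" i I] i I(1) by (subst ennreal_sum_eq_top) auto
      then show ?thesis using C by (simp add: ennreal_mult_top)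
    next
      case False
      define y where "y i = enn2real (Y i x)" for i
      have y: "Y i x = ennreal (y i)" "y i \<ge> 0" if "i \<in> I" for i
        using False that by (auto simp: y_def ennreal_enn2real_if less_top)
      have "(\<Prod>i\<in>I. y i / t i) powr (1 / m) \<le> (\<Sum>i\<in>I. y i / t i / m)"
        using arith_geom_mean[OF I, of "\<lambda>i. y i / t i"] y t by (simp add: m_def less_imp_le)
      moreover have "(\<Prod>i\<in>I. y i powr (1 / m)) = C * (\<Prod>i\<in>I. y i / t i) powr (1 / m)"
      proof -
        have "(\<Prod>i\<in>I. y i powr (1 / m)) = (\<Prod>i\<in>I. t i powr (1 / m) * (y i / t i) powr (1 / m))"
        proof (intro prod.cong refl)
          fix i assume "i \<in> I"
          then show "y i powr (1 / m) = t i powr (1 / m) * (y i / t i) powr (1 / m)"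
            using t[of i] y[of i] by (subst powr_mult[symmetric]) auto
        qed
        also have "\<dots> = C * (\<Prod>i\<in>I. (y i / t i) powr (1 / m))" by (simp add: C_def prod.distrib)
        also have "(\<Prod>i\<in>I. (y i / t i) powr (1 / m)) = (\<Prod>i\<in>I. y i / t i) powr (1 / m)"
          by (rule prod_powr_distrib[symmetric])
        finally show ?thesis .
      qed
      ultimately have "(\<Prod>i\<in>I. y i powr (1 / m)) \<le> C * (\<Sum>i\<in>I. y i / t i / m)"
        using C by simp
      moreover have "(\<Prod>i\<in>I. epowr (1 / m) (Y i x)) = ennreal (\<Prod>i\<in>I. y i powr (1 / m))"
        using y by (simp add: epowr_ennreal prod_ennreal)
      moreover have "ennreal C * (\<Sum>i\<in>I. ennreal (1 / (t i * m)) * Y i x) = ennreal (C * (\<Sum>i\<in>I. y i / t i / m))"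
      proof -
        have "(\<Sum>i\<in>I. ennreal (1 / (t i * m)) * Y i x) = (\<Sum>i\<in>I. ennreal (y i / t i / m))"
          using y t m by (intro sum.cong refl) (simp add: ennreal_mult[symmetric] less_imp_le)
        also have "\<dots> = ennreal (\<Sum>i\<in>I. y i / t i / m)"
          using y t m by (intro sum_ennreal) (simp add: less_imp_le)
        finally show ?thesis using C y t m by (simp add: ennreal_mult[symmetric] sum_nonneg less_imp_le)
      qed
      ultimately show ?thesis by (simp add: ennreal_leI)
    qed
    have "(\<integral>\<^sup>+x. (\<Prod>i\<in>I. epowr (1 / m) (Y i x)) \<partial>M) \<le> (\<integral>\<^sup>+x. ennreal C * (\<Sum>i\<in>I. ennreal (1 / (t i * m)) * Y i x) \<partial>M)"
      by (intro nn_integral_mono pw)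
    also have "\<dots> = ennreal C * (\<Sum>i\<in>I. ennreal (1 / (t i * m)) * T i)"
      by (simp add: nn_integral_cmult nn_integral_sum T_def)
    also have "(\<Sum>i\<in>I. ennreal (1 / (t i * m)) * T i) = (\<Sum>i\<in>I. ennreal (1 / m))"
      using t m by (intro sum.cong refl) (simp add: ennreal_mult[symmetric] less_imp_le less_imp_neq[symmetric])
    also have "\<dots> = ennreal (\<Sum>i\<in>I. 1 / m)" using m by (intro sum_ennreal) simp
    also have "(\<Sum>i\<in>I. 1 / m) = 1" using m by (simp add: m_def)
    also have "ennreal C * ennreal 1 = (\<Prod>i\<in>I. epowr (1 / m) (T i))"
      unfolding C_def using t by (simp add: epowr_ennreal prod_ennreal less_imp_le)
    finally show ?thesis .
  qed
  then show ?thesis by (simp add: m_def T_def)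
qed

text \<open>The coordinates in \<open>S\<close> are integrated out and the others are read off from
  \<open>x\<close>. The result is again a function on the whole space, so that partial integrals
  over different sets of coordinates can be multiplied and integrated further.\<close>

definition partial_nn_integral :: "'a::euclidean_space set \<Rightarrow> ('a \<Rightarrow> ennreal) \<Rightarrow> 'a \<Rightarrow> ennreal" where
  "partial_nn_integral S h x =
     (\<integral>\<^sup>+\<omega>. h ((\<Sum>b\<in>S. \<omega> b *\<^sub>R b) + (\<Sum>b\<in>Basis - S. (x \<bullet> b) *\<^sub>R b)) \<partial>Pi\<^sub>M S (\<lambda>_. lborel))"

lemma partial_nn_integral_measurable [measurable]:
  assumes S: "S \<subseteq> Basis" and [measurable]: "h \<in> borel_measurable borel"
  shows "partial_nn_integral S h \<in> borel_measurable (borel :: 'a::euclidean_space measure)"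
proof -
  have fin: "finite S" using S finite_Basis finite_subset by blast
  interpret product_sigma_finite "\<lambda>_::'a. lborel :: real measure" by standard
  interpret S: finite_product_sigma_finite "\<lambda>_::'a. lborel :: real measure" S by standard (rule fin)
  have "(\<lambda>p. h ((\<Sum>b\<in>S. snd p b *\<^sub>R b) + (\<Sum>b\<in>Basis - S. (fst p \<bullet> b) *\<^sub>R b)))
      \<in> borel_measurable (borel \<Otimes>\<^sub>M Pi\<^sub>M S (\<lambda>_. lborel))"
    by measurable
  from S.borel_measurable_nn_integral_fst[OF this] show ?thesis
    unfolding partial_nn_integral_def by simp
qed

lemma partial_nn_integral_empty: "partial_nn_integral {} h x = h x"
  by (simp add: partial_nn_integral_def PiM_empty nn_integral_count_space_finite euclidean_representation)

lemma partial_nn_integral_insert: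
  assumes j: "j \<in> Basis" "j \<notin> S" and S: "S \<subseteq> Basis" and [measurable]: "h \<in> borel_measurable borel"
  shows "partial_nn_integral (insert j S) h x = (\<integral>\<^sup>+y. partial_nn_integral S h (x + (y - x \<bullet> j) *\<^sub>R j) \<partial>lborel)"
proof -
  have fin: "finite S" using S finite_Basis finite_subset by blast
  interpret product_sigma_finite "\<lambda>_::'a. lborel :: real measure" by standard
  \<comment> \<open>\<open>x + (y - x \<bullet> j) *\<^sub>R j\<close> is \<open>x\<close> with its
    coordinate along \<open>j\<close> replaced by \<open>y\<close>, so an integral over
    \<open>y\<close> supplies the coordinate that \<open>S\<close> lacks.\<close>
  have eq: "(\<Sum>b\<in>insert j S. (fun_upd \<omega> j y) b *\<^sub>R b) + (\<Sum>b\<in>Basis - insert j S. (x \<bullet> b) *\<^sub>R b) =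
        (\<Sum>b\<in>S. \<omega> b *\<^sub>R b) + (\<Sum>b\<in>Basis - S. ((x + (y - x \<bullet> j) *\<^sub>R j) \<bullet> b) *\<^sub>R b)" for \<omega> and y :: real
  proof -
    have "(\<Sum>b\<in>Basis - S. ((x + (y - x \<bullet> j) *\<^sub>R j) \<bullet> b) *\<^sub>R b) =
       ((x + (y - x \<bullet> j) *\<^sub>R j) \<bullet> j) *\<^sub>R j + (\<Sum>b\<in>Basis - insert j S. ((x + (y - x \<bullet> j) *\<^sub>R j) \<bullet> b) *\<^sub>R b)"
      unfolding Diff_insert[of Basis j S] by (rule sum.remove) (use j in auto)
    also have "((x + (y - x \<bullet> j) *\<^sub>R j) \<bullet> j) = y" using j by (simp add: inner_simps)
    also have "(\<Sum>b\<in>Basis - insert j S. ((x + (y - x \<bullet> j) *\<^sub>R j) \<bullet> b) *\<^sub>R b) = (\<Sum>b\<in>Basis - insert j S. (x \<bullet> b) *\<^sub>R b)"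
      using j by (intro sum.cong refl) (auto simp: inner_simps inner_Basis)
    moreover have "(\<Sum>b\<in>S. (fun_upd \<omega> j y) b *\<^sub>R b) = (\<Sum>b\<in>S. \<omega> b *\<^sub>R b)"
      using j by (intro sum.cong refl) auto
    ultimately show ?thesis using j fin by simp
  qed
  show ?thesis
    unfolding partial_nn_integral_def
    by (subst product_nn_integral_insert_rev[OF fin j(2)]) (measurable, simp only: eq)
qed

lemma partial_nn_integral_indep:
  assumes "j \<in> S" "j \<in> Basis"
  shows "partial_nn_integral S h (x + c *\<^sub>R j) = partial_nn_integral S h x"
proof -
  have "(\<Sum>b\<in>Basis - S. ((x + c *\<^sub>R j) \<bullet> b) *\<^sub>R b) = (\<Sum>b\<in>Basis - S. (x \<bullet> b) *\<^sub>R b)"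
    using assms by (intro sum.cong refl) (auto simp: inner_simps inner_Basis)
  then show ?thesis by (simp add: partial_nn_integral_def)
qed

lemma partial_nn_integral_Basis:
  fixes h :: "'a::euclidean_space \<Rightarrow> ennreal"
  assumes [measurable]: "h \<in> borel_measurable borel"
  shows "partial_nn_integral Basis h x = integral\<^sup>N lborel h"
  unfolding partial_nn_integral_def
  by (subst lborel_eq, subst nn_integral_distr) auto

text \<open>Gagliardo's argument: integrating out one coordinate at a time, the factor that does not
  depend on it is pulled out and Hoelder's inequality applies to the remaining ones.\<close>
lemma Gagliardo_partial:
  fixes h :: "'a::euclidean_space \<Rightarrow> 'a \<Rightarrow> ennreal"
  assumes N: "DIM('a) \<ge> 2" and [measurable]: "\<And>i. h i \<in> borel_measurable borel"
    and "S \<subseteq> Basis"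
  defines "r \<equiv> epowr (1 / (DIM('a) - 1))"
  shows "partial_nn_integral S (\<lambda>x. \<Prod>i\<in>Basis. r (partial_nn_integral {i} (h i) x)) x
     \<le> (\<Prod>i\<in>Basis. r (partial_nn_integral (insert i S) (h i) x))"
proof -
  have "finite S" using assms(3) finite_Basis finite_subset by blast
  then show ?thesis using assms(3)
  proof (induction S arbitrary: x)
    case empty
    then show ?case by (simp add: partial_nn_integral_empty)
  next
    case (insert j S)
    have rm[measurable]: "r \<in> borel_measurable borel" unfolding r_def by measurable
    have j: "j \<in> Basis" "j \<notin> S" "S \<subseteq> Basis" using insert by auto
    have Xm: "(\<lambda>x. \<Prod>i\<in>Basis. r (partial_nn_integral {i} (h i) x)) \<in> borel_measurable borel"
      by (intro borel_measurable_prod_ennreal measurable_compose[OF _ rm] partial_nn_integral_measurable) auto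
    let ?x = "\<lambda>y. x + (y - x \<bullet> j) *\<^sub>R j"
    let ?c = "r (partial_nn_integral (insert j S) (h j) x)"
    have ym: "(\<lambda>y. partial_nn_integral (insert i S) (h i) (?x y)) \<in> borel_measurable lborel" if "i \<in> Basis" for i
      using that j by (intro measurable_compose[OF _ partial_nn_integral_measurable]) auto
    have "partial_nn_integral (insert j S) (\<lambda>x. \<Prod>i\<in>Basis. r (partial_nn_integral {i} (h i) x)) x
      = (\<integral>\<^sup>+y. partial_nn_integral S (\<lambda>x. \<Prod>i\<in>Basis. r (partial_nn_integral {i} (h i) x)) (?x y) \<partial>lborel)"
      by (rule partial_nn_integral_insert[OF j Xm])
    also have "\<dots> \<le> (\<integral>\<^sup>+y. (\<Prod>i\<in>Basis. r (partial_nn_integral (insert i S) (h i) (?x y))) \<partial>lborel)"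
      by (intro nn_integral_mono insert.IH j)
    also have "\<dots> = (\<integral>\<^sup>+y. ?c * (\<Prod>i\<in>Basis - {j}. r (partial_nn_integral (insert i S) (h i) (?x y))) \<partial>lborel)"
      using j(1) by (intro nn_integral_cong) (simp add: prod.remove[of Basis j] partial_nn_integral_indep)
    also have "\<dots> = ?c * (\<integral>\<^sup>+y. (\<Prod>i\<in>Basis - {j}. r (partial_nn_integral (insert i S) (h i) (?x y))) \<partial>lborel)"
      using ym by (intro nn_integral_cmult borel_measurable_prod_ennreal measurable_compose[OF _ rm]) auto
    also have "(\<integral>\<^sup>+y. (\<Prod>i\<in>Basis - {j}. r (partial_nn_integral (insert i S) (h i) (?x y))) \<partial>lborel)
      \<le> (\<Prod>i\<in>Basis - {j}. r (\<integral>\<^sup>+y. partial_nn_integral (insert i S) (h i) (?x y) \<partial>lborel))"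
    proof -
      \<comment> \<open>One factor less than the dimension remains under the integral. This number
        is the reciprocal of the exponent in \<open>r\<close>, as Hoelder's inequality with equal
        exponents demands.\<close>
      have c: "card (Basis - {j}) = DIM('a) - 1" using j by simp
      then have "card (Basis - {j}) > 0" using N by linarith
      then have "Basis - {j} \<noteq> {}" by (metis card.empty less_irrefl)
      with nn_integral_Holder[of "Basis - {j}" "\<lambda>i y. partial_nn_integral (insert i S) (h i) (?x y)" lborel] ym
      show ?thesis unfolding r_def c by simp
    qed
    also have "(\<Prod>i\<in>Basis - {j}. r (\<integral>\<^sup>+y. partial_nn_integral (insert i S) (h i) (?x y) \<partial>lborel))
       = (\<Prod>i\<in>Basis - {j}. r (partial_nn_integral (insert i (insert j S)) (h i) x))"
    proof (intro prod.cong refl arg_cong[of _ _ r])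
      fix i assume i: "i \<in> Basis - {j}"
      have "partial_nn_integral (insert j (insert i S)) (h i) x = (\<integral>\<^sup>+y. partial_nn_integral (insert i S) (h i) (?x y) \<partial>lborel)"
        using i j by (intro partial_nn_integral_insert) auto
      then show "(\<integral>\<^sup>+y. partial_nn_integral (insert i S) (h i) (?x y) \<partial>lborel) = partial_nn_integral (insert i (insert j S)) (h i) x"
        by (simp add: insert_commute)
    qed
    also have "?c * \<dots> = (\<Prod>i\<in>Basis. r (partial_nn_integral (insert i (insert j S)) (h i) x))"
      using j(1) by (simp add: prod.remove[of Basis j])
    finally show ?case by (simp add: mult_left_mono)
  qed
qed

lemma Gagliardo:
  fixes h :: "'a::euclidean_space \<Rightarrow> 'a \<Rightarrow> ennreal"
  assumes N: "DIM('a) \<ge> 2" and [measurable]: "\<And>i. h i \<in> borel_measurable borel"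
  shows "(\<integral>\<^sup>+x. (\<Prod>i\<in>Basis. epowr (1 / (DIM('a) - 1)) (partial_nn_integral {i} (h i) x)) \<partial>lborel)
     \<le> (\<Prod>i\<in>Basis. epowr (1 / (DIM('a) - 1)) (integral\<^sup>N lborel (h i)))"
proof -
  have m: "(\<lambda>x. \<Prod>i\<in>Basis. epowr (1 / (DIM('a) - 1)) (partial_nn_integral {i} (h i) x)) \<in> borel_measurable borel"
    by (intro borel_measurable_prod_ennreal measurable_compose[OF _ epowr_measurable] partial_nn_integral_measurable) auto
  have ins: "insert i Basis = Basis" if "i \<in> Basis" for i :: 'a using that by auto
  show ?thesis
    using Gagliardo_partial[OF N assms(2) subset_refl, where x = 0]
    by (simp add: partial_nn_integral_Basis[OF m] partial_nn_integral_Basis ins)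
qed

text \<open>For \<gamma> > 1 the derivative exists at the origin as well, so a power of
  \<bar>\<phi>\<bar> can be differentiated along lines without regularising it near its
  zeros.\<close>

lemma has_real_derivative_abs_powr:
  assumes "\<gamma> > 1"
  shows "((\<lambda>s. \<bar>s\<bar> powr \<gamma>) has_real_derivative \<gamma> * \<bar>s\<bar> powr (\<gamma> - 1) * sgn s) (at s)"
proof -
  consider "s > 0" | "s < 0" | "s = 0" by linarith
  then show ?thesis
  proof cases
    case 1
    have "((\<lambda>s. s powr \<gamma>) has_real_derivative \<gamma> * s powr (\<gamma> - 1)) (at s)"
      by (rule has_real_derivative_powr[OF 1])
    then have "((\<lambda>s. \<bar>s\<bar> powr \<gamma>) has_real_derivative \<gamma> * s powr (\<gamma> - 1)) (at s)"
      by (rule has_field_derivative_transform_within_open[of _ _ _ "{0<..}"]) (use 1 in auto)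
    then show ?thesis using 1 by simp
  next
    case 2
    have "((\<lambda>s. (- s) powr \<gamma>) has_real_derivative \<gamma> * (- s) powr (\<gamma> - 1) * (- 1)) (at s)"
      using DERIV_chain2[OF has_real_derivative_powr[of "- s" \<gamma>] DERIV_minus[OF DERIV_ident]] 2 by simp
    then have "((\<lambda>s. \<bar>s\<bar> powr \<gamma>) has_real_derivative \<gamma> * (- s) powr (\<gamma> - 1) * (- 1)) (at s)"
      by (rule has_field_derivative_transform_within_open[of _ _ _ "{..<0}"]) (use 2 in auto)
    then show ?thesis using 2 by simp
  next
    case 3
    have "((\<lambda>h::real. \<bar>h\<bar> powr (\<gamma> - 1)) \<longlongrightarrow> \<bar>0\<bar> powr (\<gamma> - 1)) (at 0)"
      using assms by (intro tendsto_powr2 tendsto_intros) auto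
    then have "((\<lambda>h::real. \<bar>h\<bar> powr (\<gamma> - 1)) \<longlongrightarrow> 0) (at 0)" by simp
    then have "((\<lambda>h::real. norm (\<bar>h\<bar> powr \<gamma> / h)) \<longlongrightarrow> 0) (at 0)"
      by (rule Lim_transform_eventually) (auto simp: eventually_at_filter powr_diff)
    then have "((\<lambda>h::real. \<bar>h\<bar> powr \<gamma> / h) \<longlongrightarrow> 0) (at 0)"
      by (rule tendsto_norm_zero_cancel)
    then show ?thesis using 3 by (simp add: has_field_derivative_iff)
  qed
qed

text \<open>On the line through \<open>x\<close> in direction \<open>i\<close> the power is the
  integral of its derivative from a point outside the support. The modulus of the derivative,
  integrated over the whole line, can only be larger.\<close>

lemma abs_powr_le_partial_nn_integral:
  assumes \<phi>: "test_fun \<Omega> \<phi>" and i: "i \<in> Basis" and \<gamma>: "\<gamma> > 1"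
  shows "ennreal (\<bar>\<phi> x\<bar> powr \<gamma>)
    \<le> partial_nn_integral {i} (\<lambda>x. ennreal (\<gamma> * \<bar>\<phi> x\<bar> powr (\<gamma> - 1) * \<bar>partial_deriv i \<phi> x\<bar>)) x"
proof -
  obtain K where K: "compact K" "\<And>x. x \<notin> K \<Longrightarrow> \<phi> x = 0" using test_fun_support[OF \<phi>] by metis
  obtain r where r: "K \<subseteq> ball 0 r"
    using compact_imp_bounded[OF K(1)] bounded_subset_ballD by blast
  note [measurable] = test_fun_borel[OF \<phi>] test_fun_partial_borel[OF \<phi> i]
  define x' where "x' = x - (x \<bullet> i) *\<^sub>R i"
  define q where "q t = \<phi> (x' + t *\<^sub>R i)" for t
  define q' where "q' t = partial_deriv i \<phi> (x' + t *\<^sub>R i)" for t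
  define g where "g t = \<gamma> * \<bar>q t\<bar> powr (\<gamma> - 1) * \<bar>q' t\<bar>" for t
  define b where "b = x \<bullet> i"
  \<comment> \<open>The coordinate \<open>a\<close> lies below \<open>b\<close> and has modulus at
    least \<open>r\<close>, so that the point of the line with this coordinate is outside the ball
    containing the support.\<close>
  define a where "a = min b (- r) - 1"
  have ab: "a \<le> b" by (auto simp: a_def)
  have shift: "x + (y - x \<bullet> i) *\<^sub>R i = x' + y *\<^sub>R i" for y by (simp add: x'_def algebra_simps)
  have qb: "q b = \<phi> x" by (simp add: q_def x'_def b_def)
  have "(x' + a *\<^sub>R i) \<bullet> i = a" using i by (simp add: x'_def inner_simps)
  then have "norm (x' + a *\<^sub>R i) \<ge> \<bar>a\<bar>" using Basis_le_norm[OF i, of "x' + a *\<^sub>R i"] by simp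
  moreover have "\<bar>a\<bar> \<ge> r" by (auto simp: a_def)
  ultimately have "x' + a *\<^sub>R i \<notin> K" using r by (auto simp: subset_iff)
  then have qa: "q a = 0" unfolding q_def by (rule K(2))
  have cq: "continuous_on UNIV q" "continuous_on UNIV q'"
    unfolding q_def q'_def
    by (rule continuous_on_compose2[OF test_fun_continuous(1)[OF \<phi>]] continuous_on_compose2[OF test_fun_continuous(2)[OF \<phi> i]];
        auto intro!: continuous_intros)+
  have cg: "continuous_on UNIV g"
    unfolding g_def using \<gamma> by (intro continuous_intros cq continuous_on_powr') auto
  have gi: "(g has_integral (integral {a..b} g)) {a..b}"
    by (intro integrable_integral integrable_continuous_real continuous_on_subset[OF cg]) auto
  have "((\<lambda>t. \<bar>q t\<bar> powr \<gamma>) has_real_derivative \<gamma> * \<bar>q t\<bar> powr (\<gamma> - 1) * sgn (q t) * q' t) (at t)" for t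
    by (rule DERIV_chain2[OF has_real_derivative_abs_powr[OF \<gamma>]])
       (unfold q_def q'_def, rule has_derivative_line[OF test_fun_differentiable[OF \<phi>]])
  then have "((\<lambda>t. \<gamma> * \<bar>q t\<bar> powr (\<gamma> - 1) * sgn (q t) * q' t) has_integral (\<bar>q b\<bar> powr \<gamma> - \<bar>q a\<bar> powr \<gamma>)) {a..b}"
    by (intro fundamental_theorem_of_calculus[OF ab])
       (auto simp: has_real_derivative_iff_has_vector_derivative[symmetric] intro: has_field_derivative_at_within)
  then have "\<bar>q b\<bar> powr \<gamma> - \<bar>q a\<bar> powr \<gamma> \<le> integral {a..b} g"
  proof (rule has_integral_le[OF _ gi])
    fix t
    have "sgn (q t) * q' t \<le> \<bar>q' t\<bar>" by (cases "q t" "0::real" rule: linorder_cases) auto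
    then have "\<gamma> * \<bar>q t\<bar> powr (\<gamma> - 1) * (sgn (q t) * q' t) \<le> \<gamma> * \<bar>q t\<bar> powr (\<gamma> - 1) * \<bar>q' t\<bar>"
      using \<gamma> by (intro mult_left_mono) auto
    then show "\<gamma> * \<bar>q t\<bar> powr (\<gamma> - 1) * sgn (q t) * q' t \<le> g t" by (simp add: g_def mult_ac)
  qed
  then have "ennreal (\<bar>\<phi> x\<bar> powr \<gamma>) \<le> ennreal (integral {a..b} g)" by (simp add: qa qb ennreal_leI)
  also have "\<dots> = (\<integral>\<^sup>+t. ennreal (indicator {a..b} t * g t) \<partial>lborel)"
    by (rule nn_integral_has_integral_lebesgue[symmetric, OF _ gi]) (use \<gamma> in \<open>auto simp: g_def\<close>)
  also have "\<dots> \<le> (\<integral>\<^sup>+t. ennreal (g t) \<partial>lborel)"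
    using \<gamma> by (intro nn_integral_mono ennreal_leI) (auto simp: indicator_def g_def)
  also have "\<dots> = partial_nn_integral {i} (\<lambda>x. ennreal (\<gamma> * \<bar>\<phi> x\<bar> powr (\<gamma> - 1) * \<bar>partial_deriv i \<phi> x\<bar>)) x"
    by (subst partial_nn_integral_insert)
       (use i in \<open>auto simp: partial_nn_integral_empty shift g_def q_def q'_def\<close>)
  finally show ?thesis .
qed

section \<open>Gradients of test functions and the Sobolev inequality for them\<close>

lemma grad_inner: "i \<in> Basis \<Longrightarrow> grad \<phi> x \<bullet> i = partial_deriv i \<phi> x"
  by (simp add: grad_def)

lemma test_fun_grad_eq_0:
  assumes "compact K" "\<And>x. x \<notin> K \<Longrightarrow> \<phi> x = 0" "x \<notin> K"
  shows "grad \<phi> x = 0"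
  using partial_deriv_eq_0_outside[of K \<phi> x] assms compact_imp_closed[OF assms(1)] by (simp add: grad_def)

lemma test_fun_grad_continuous: "test_fun \<Omega> \<phi> \<Longrightarrow> continuous_on UNIV (grad \<phi>)"
  unfolding grad_def using test_fun_continuous(2) by (intro continuous_intros) auto

definition sobolev_exp :: "'a::euclidean_space itself \<Rightarrow> real" where
  "sobolev_exp _ = 2 * real DIM('a) / (real DIM('a) - 2)"

text \<open>Gagliardo's inequality is applied to \<bar>\<phi>\<bar> to the power \<gamma>. The
  integral of \<bar>\<phi>\<bar> powr p then appears on both sides, on the right with an exponent
  below 1, and is divided out.\<close>

lemma Sobolev_test_fun:
  fixes \<phi> :: "'a::euclidean_space \<Rightarrow> real"
  assumes N: "DIM('a) \<ge> 3" and \<phi>: "test_fun \<Omega> \<phi>"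
  defines "p \<equiv> sobolev_exp TYPE('a)"
  shows "integral\<^sup>L lborel (\<lambda>x. \<bar>\<phi> x\<bar> powr p)
     \<le> (4 * sqrt (integral\<^sup>L lborel (\<lambda>x. (norm (grad \<phi> x))\<^sup>2))) powr p"
proof -
  define n where "n = real DIM('a)"
  have n: "n \<ge> 3" using N by (simp add: n_def)
  \<comment> \<open>Two requirements determine \<gamma>: \<gamma> n / (n - 1) = p produces the
    exponent p on the left of Gagliardo's inequality, and 2 (\<gamma> - 1) = p produces it on the
    right after Cauchy-Schwarz. For n \<ge> 3 it is at most 4, which is the constant of the
    statement.\<close>
  define \<gamma> where "\<gamma> = 2 * (n - 1) / (n - 2)"
  have \<gamma>: "\<gamma> > 1" "\<gamma> \<le> 4" using n by (auto simp: \<gamma>_def field_simps)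
  have p: "p = 2 * n / (n - 2)" by (simp add: p_def sobolev_exp_def n_def)
  have p0: "p > 0" using n by (simp add: p)
  have "\<gamma> * (1 / (n - 1)) = 2 / (n - 2)"
    using n by (simp add: \<gamma>_def divide_eq_eq eq_divide_eq) (simp add: algebra_simps)?
  then have e1: "\<gamma> * (1 / (n - 1)) * n = p" "(\<gamma> - 1) * 2 = p"
    using n by (simp add: p) (use n in \<open>simp add: p \<gamma>_def field_simps\<close>)
  have half_p: "p * (1 / 2) = \<gamma> - 1" using e1(2) by simp
  obtain K where K: "compact K" "\<And>x. x \<notin> K \<Longrightarrow> \<phi> x = 0" using test_fun_support[OF \<phi>] by metis
  note [measurable] = test_fun_borel[OF \<phi>]
  have pm[measurable]: "partial_deriv i \<phi> \<in> borel_measurable borel" if "i \<in> Basis" for i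
    by (rule test_fun_partial_borel[OF \<phi> that])
  have gm[measurable]: "grad \<phi> \<in> borel_measurable borel"
    using test_fun_grad_continuous[OF \<phi>] by (rule borel_measurable_continuous_onI)
  have "continuous_on UNIV (\<lambda>x. \<bar>\<phi> x\<bar> powr p)"
    using p0 by (intro continuous_on_powr' continuous_intros test_fun_continuous(1)[OF \<phi>]) auto
  then have IA: "integrable lborel (\<lambda>x. \<bar>\<phi> x\<bar> powr p)"
    by (rule integrable_compact_support[OF K(1)]) (simp add: K(2))
  have ID: "integrable lborel (\<lambda>x. (norm (grad \<phi> x))\<^sup>2)"
    by (rule integrable_compact_support[OF K(1)])
       (use test_fun_grad_eq_0[OF K] test_fun_grad_continuous[OF \<phi>] in \<open>auto intro!: continuous_intros\<close>)
  define A where "A = integral\<^sup>L lborel (\<lambda>x. \<bar>\<phi> x\<bar> powr p)"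
  define D where "D = integral\<^sup>L lborel (\<lambda>x. (norm (grad \<phi> x))\<^sup>2)"
  have A0: "A \<ge> 0" "D \<ge> 0" by (simp_all add: A_def D_def)
  define h where "h i x = (if i \<in> Basis then ennreal (\<gamma> * \<bar>\<phi> x\<bar> powr (\<gamma> - 1) * \<bar>partial_deriv i \<phi> x\<bar>) else 0)" for i x
  have hm: "h i \<in> borel_measurable borel" for i
    by (cases "i \<in> Basis") (auto simp: h_def cong: measurable_cong)
  have hle: "integral\<^sup>N lborel (h i) \<le> ennreal (\<gamma> * sqrt A * sqrt D)" if i: "i \<in> Basis" for i
  proof -
    note [measurable] = pm[OF i]
    \<comment> \<open>Cauchy-Schwarz as the two-factor case of \<open>nn_integral_Holder\<close>;
      the indices 0 and 1 only name the factors.\<close>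
    let ?Y = "\<lambda>k x. if k = (0::nat) then ennreal (\<bar>\<phi> x\<bar> powr p) else ennreal ((partial_deriv i \<phi> x)\<^sup>2)"
    have "(\<integral>\<^sup>+x. ennreal (\<bar>\<phi> x\<bar> powr (\<gamma> - 1) * \<bar>partial_deriv i \<phi> x\<bar>) \<partial>lborel)
       = (\<integral>\<^sup>+x. (\<Prod>k\<in>{0,1::nat}. epowr (1 / card {0,1::nat}) (?Y k x)) \<partial>lborel)"
    proof (intro nn_integral_cong)
      fix x
      have "\<bar>\<phi> x\<bar> powr (\<gamma> - 1) = (\<bar>\<phi> x\<bar> powr p) powr (1 / 2)"
        by (simp only: powr_powr half_p)
      moreover have "\<bar>partial_deriv i \<phi> x\<bar> = ((partial_deriv i \<phi> x)\<^sup>2) powr (1 / 2)"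
        by (simp add: powr_half_sqrt)
      ultimately show "ennreal (\<bar>\<phi> x\<bar> powr (\<gamma> - 1) * \<bar>partial_deriv i \<phi> x\<bar>) = (\<Prod>k\<in>{0,1::nat}. epowr (1 / card {0,1::nat}) (?Y k x))"
        by (simp add: epowr_ennreal ennreal_mult)
    qed
    also have "\<dots> \<le> (\<Prod>k\<in>{0,1::nat}. epowr (1 / card {0,1::nat}) (\<integral>\<^sup>+x. ?Y k x \<partial>lborel))"
      by (rule nn_integral_Holder) auto
    also have "\<dots> = epowr (1 / 2) (\<integral>\<^sup>+x. ennreal (\<bar>\<phi> x\<bar> powr p) \<partial>lborel) * epowr (1 / 2) (\<integral>\<^sup>+x. ennreal ((partial_deriv i \<phi> x)\<^sup>2) \<partial>lborel)"
      by simp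
    also have "\<dots> \<le> epowr (1 / 2) (ennreal A) * epowr (1 / 2) (ennreal D)"
    proof (intro mult_mono epowr_mono)
      show "(\<integral>\<^sup>+x. ennreal (\<bar>\<phi> x\<bar> powr p) \<partial>lborel) \<le> ennreal A"
        unfolding A_def by (subst nn_integral_eq_integral[OF IA]) auto
      have "(\<integral>\<^sup>+x. ennreal ((partial_deriv i \<phi> x)\<^sup>2) \<partial>lborel) \<le> (\<integral>\<^sup>+x. ennreal ((norm (grad \<phi> x))\<^sup>2) \<partial>lborel)"
      proof (intro nn_integral_mono ennreal_leI)
        fix x
        show "(partial_deriv i \<phi> x)\<^sup>2 \<le> (norm (grad \<phi> x))\<^sup>2"
          using Basis_le_norm[OF i, of "grad \<phi> x"] by (simp add: grad_inner[OF i] abs_le_square_iff[symmetric])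
      qed
      also have "\<dots> = ennreal D"
        unfolding D_def by (subst nn_integral_eq_integral[OF ID]) auto
      finally show "(\<integral>\<^sup>+x. ennreal ((partial_deriv i \<phi> x)\<^sup>2) \<partial>lborel) \<le> ennreal D" .
    qed auto
    also have "\<dots> = ennreal (sqrt A * sqrt D)"
      using A0 by (simp add: epowr_ennreal powr_half_sqrt ennreal_mult)
    finally have *: "(\<integral>\<^sup>+x. ennreal (\<bar>\<phi> x\<bar> powr (\<gamma> - 1) * \<bar>partial_deriv i \<phi> x\<bar>) \<partial>lborel) \<le> ennreal (sqrt A * sqrt D)" .
    have "integral\<^sup>N lborel (h i) = (\<integral>\<^sup>+x. ennreal \<gamma> * ennreal (\<bar>\<phi> x\<bar> powr (\<gamma> - 1) * \<bar>partial_deriv i \<phi> x\<bar>) \<partial>lborel)"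
      using i \<gamma> by (intro nn_integral_cong) (simp add: h_def ennreal_mult mult_ac)
    also have "\<dots> = ennreal \<gamma> * (\<integral>\<^sup>+x. ennreal (\<bar>\<phi> x\<bar> powr (\<gamma> - 1) * \<bar>partial_deriv i \<phi> x\<bar>) \<partial>lborel)"
      by (intro nn_integral_cmult) measurable
    also have "\<dots> \<le> ennreal \<gamma> * ennreal (sqrt A * sqrt D)" by (intro mult_left_mono *) simp
    finally show ?thesis using \<gamma> A0 by (simp add: ennreal_mult[symmetric] mult_ac)
  qed
  define c where "c = 1 / (n - 1)"
  have c: "c > 0" "real (DIM('a) - 1) = n - 1" using n N by (auto simp: c_def n_def of_nat_diff)
  define B where "B = \<gamma> * sqrt A * sqrt D"
  have B0: "B \<ge> 0" using \<gamma> A0 by (simp add: B_def)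
  have "ennreal A = (\<integral>\<^sup>+x. ennreal (\<bar>\<phi> x\<bar> powr p) \<partial>lborel)"
    unfolding A_def by (subst nn_integral_eq_integral[OF IA]) auto
  also have "\<dots> \<le> (\<integral>\<^sup>+x. (\<Prod>i\<in>Basis. epowr c (partial_nn_integral {i} (h i) x)) \<partial>lborel)"
  proof (intro nn_integral_mono)
    fix x
    have "ennreal (\<bar>\<phi> x\<bar> powr p) = ennreal ((\<bar>\<phi> x\<bar> powr \<gamma>) powr c) ^ DIM('a)"
    proof -
      have "((\<bar>\<phi> x\<bar> powr \<gamma>) powr c) ^ DIM('a) = \<bar>\<phi> x\<bar> powr p"
        using e1(1) by (cases "\<phi> x = 0") (auto simp: powr_powr powr_realpow[symmetric] n_def c_def p0 mult_ac)
      then show ?thesis by (simp add: ennreal_power)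
    qed
    also have "\<dots> = (\<Prod>i\<in>(Basis::'a set). epowr c (ennreal (\<bar>\<phi> x\<bar> powr \<gamma>)))"
      by (simp add: epowr_ennreal)
    also have "\<dots> \<le> (\<Prod>i\<in>Basis. epowr c (partial_nn_integral {i} (h i) x))"
    proof (intro prod_mono_ennreal epowr_mono)
      fix i :: 'a assume i: "i \<in> Basis"
      have "h i = (\<lambda>x. ennreal (\<gamma> * \<bar>\<phi> x\<bar> powr (\<gamma> - 1) * \<bar>partial_deriv i \<phi> x\<bar>))"
        using i by (simp add: h_def fun_eq_iff)
      then show "ennreal (\<bar>\<phi> x\<bar> powr \<gamma>) \<le> partial_nn_integral {i} (h i) x"
        using abs_powr_le_partial_nn_integral[OF \<phi> i \<gamma>(1)] by simp
    qed (use c in auto)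
    finally show "ennreal (\<bar>\<phi> x\<bar> powr p) \<le> (\<Prod>i\<in>Basis. epowr c (partial_nn_integral {i} (h i) x))" .
  qed
  also have "\<dots> \<le> (\<Prod>i\<in>Basis. epowr c (integral\<^sup>N lborel (h i)))"
    using Gagliardo[of h] N hm c by (simp add: c_def)
  also have "\<dots> \<le> (\<Prod>i\<in>(Basis::'a set). epowr c (ennreal B))"
    using hle c unfolding B_def by (intro prod_mono_ennreal epowr_mono) auto
  also have "\<dots> = ennreal ((B powr c) ^ DIM('a))"
    using B0 by (simp add: epowr_ennreal ennreal_power)
  finally have "A \<le> (B powr c) ^ DIM('a)" by (subst (asm) ennreal_le_iff) auto
  also have "\<dots> = B powr (n * c)"
    by (cases "B = 0") (use B0 c n in \<open>auto simp: powr_realpow[symmetric] powr_powr n_def mult_ac\<close>)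
  finally have main: "A \<le> B powr (n * c)" .
  have "A \<le> (\<gamma> * sqrt D) powr p"
  proof (cases "A = 0")
    case False
    \<comment> \<open>As \<open>A\<close> is finite and positive, its power on the right can be
      moved to the left, where the exponent 1 - n c / 2 = (n - 2) / (2 (n - 1)) is positive. Raising
      both sides to the power p / (n c) makes the exponent of \<open>A\<close> equal to 1.\<close>
    then have Ap: "A > 0" using A0 by simp
    have "B powr (n * c) = (\<gamma> * sqrt D) powr (n * c) * A powr (n * c / 2)"
      using \<gamma> A0 by (simp add: B_def powr_mult powr_half_sqrt[symmetric] powr_powr mult_ac)
    with main have "A powr 1 \<le> (\<gamma> * sqrt D) powr (n * c) * A powr (n * c / 2)" using Ap by simp
    then have "A powr 1 * A powr (- (n * c / 2)) \<le> (\<gamma> * sqrt D) powr (n * c) * A powr (n * c / 2) * A powr (- (n * c / 2))"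
      by (intro mult_right_mono) auto
    also have "\<dots> = (\<gamma> * sqrt D) powr (n * c)"
      using Ap by (simp add: powr_minus)
    finally have "A powr (1 - n * c / 2) \<le> (\<gamma> * sqrt D) powr (n * c)"
      using powr_add[of A 1 "- (n * c / 2)"] by simp
    then have "(A powr (1 - n * c / 2)) powr (p / (n * c)) \<le> ((\<gamma> * sqrt D) powr (n * c)) powr (p / (n * c))"
      using p0 c n by (intro powr_mono2) auto
    moreover have "(1 - n * c / 2) * (p / (n * c)) = 1" "n * c * (p / (n * c)) = p"
    proof -
      have "1 - n * c / 2 = (n - 2) / (2 * (n - 1))" using n by (simp add: c_def field_simps)
      moreover have "p / (n * c) = (2 * (n - 1)) / (n - 2)" using n by (simp add: c_def p)
      ultimately show "(1 - n * c / 2) * (p / (n * c)) = 1" using n by simp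
      show "n * c * (p / (n * c)) = p" using n c by simp
    qed
    ultimately show ?thesis using Ap by (simp add: powr_powr)
  qed simp
  also have "\<dots> \<le> (4 * sqrt D) powr p"
    using \<gamma> A0 p0 by (intro powr_mono2 mult_right_mono) auto
  finally show ?thesis by (simp add: A_def D_def)
qed

section \<open>Square integrable functions and Nemytskii functionals\<close>

lemma integral_Cauchy_Schwarz:
  fixes f v :: "'a \<Rightarrow> real"
  assumes [measurable]: "f \<in> borel_measurable M" "v \<in> borel_measurable M"
    and I: "integrable M (\<lambda>x. (f x)\<^sup>2)" "integrable M (\<lambda>x. (v x)\<^sup>2)"
  shows "\<bar>\<integral>x. f x * v x \<partial>M\<bar> \<le> sqrt (\<integral>x. (f x)\<^sup>2 \<partial>M) * sqrt (\<integral>x. (v x)\<^sup>2 \<partial>M)"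
proof -
  define a b c where "a = (\<integral>x. (f x)\<^sup>2 \<partial>M)" "b = (\<integral>x. (v x)\<^sup>2 \<partial>M)" "c = (\<integral>x. f x * v x \<partial>M)"
  note abc = this
  have J: "integrable M (\<lambda>x. f x * v x)" by (rule integrable_mult_L2[OF assms])
  have q: "0 \<le> s\<^sup>2 * a + 2 * s * t * c + t\<^sup>2 * b" for s t
  proof -
    have "0 \<le> (\<integral>x. (s * f x + t * v x)\<^sup>2 \<partial>M)" by simp
    also have "\<dots> = (\<integral>x. s\<^sup>2 * (f x)\<^sup>2 + 2 * s * t * (f x * v x) + t\<^sup>2 * (v x)\<^sup>2 \<partial>M)"
      by (intro Bochner_Integration.integral_cong) (auto simp: power2_eq_square algebra_simps)
    also have "\<dots> = s\<^sup>2 * a + 2 * s * t * c + t\<^sup>2 * b"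
      using I J by (simp add: abc)
    finally show ?thesis .
  qed
  have ab: "a \<ge> 0" "b \<ge> 0" by (simp_all add: abc)
  have "c\<^sup>2 \<le> a * b"
  proof (cases "a = 0")
    case True
    have "c = 0"
    proof (rule ccontr)
      assume "c \<noteq> 0"
      \<comment> \<open>For \<open>a = 0\<close> the form is affine in its first argument. At this
        value it equals - b - 2, contradicting its nonnegativity.\<close>
      with q[of "- (b + 1) / c" 1] True ab show False by simp
    qed
    with True show ?thesis by simp
  next
    case False
    then have a: "a > 0" using ab by simp
    have "0 \<le> c\<^sup>2 * a + 2 * c * (- a) * c + (- a)\<^sup>2 * b" by (rule q)
    then have "a * c\<^sup>2 \<le> a * (a * b)" by (simp add: power2_eq_square algebra_simps)
    with a show ?thesis by simp
  qed
  then have "sqrt (c\<^sup>2) \<le> sqrt (a * b)" by (rule real_sqrt_le_mono)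
  then show ?thesis by (simp add: real_sqrt_mult abc)
qed

lemma abs_add_powr_le:
  fixes a b q :: real
  assumes "q > 0"
  shows "\<bar>a + b\<bar> powr q \<le> 2 powr q * (\<bar>a\<bar> powr q + \<bar>b\<bar> powr q)"
proof -
  have "\<bar>a + b\<bar> powr q \<le> (2 * max \<bar>a\<bar> \<bar>b\<bar>) powr q"
    using assms by (intro powr_mono2) auto
  also have "\<dots> = 2 powr q * (max \<bar>a\<bar> \<bar>b\<bar>) powr q" by (simp add: powr_mult)
  also have "(max \<bar>a\<bar> \<bar>b\<bar>) powr q \<le> \<bar>a\<bar> powr q + \<bar>b\<bar> powr q" by (simp add: max_def)
  finally show ?thesis by simp
qed

lemma norm_add_square_le: "(norm (a + b))\<^sup>2 \<le> 2 * (norm a)\<^sup>2 + 2 * (norm b)\<^sup>2"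
  for a b :: "'a::real_normed_vector"
proof -
  have "(norm (a + b))\<^sup>2 \<le> (norm a + norm b)\<^sup>2" by (intro power_mono norm_triangle_ineq) auto
  also have "\<dots> \<le> 2 * (norm a)\<^sup>2 + 2 * (norm b)\<^sup>2"
    using sum_squares_bound[of "norm a" "norm b"] by (simp add: power2_sum)
  finally show ?thesis .
qed

lemma integrable_norm_diff_square:
  fixes f g :: "'a \<Rightarrow> 'b::euclidean_space"
  assumes [measurable]: "f \<in> borel_measurable M" "g \<in> borel_measurable M"
    and "integrable M (\<lambda>x. (norm (f x))\<^sup>2)" "integrable M (\<lambda>x. (norm (g x))\<^sup>2)"
  shows "integrable M (\<lambda>x. (norm (f x - g x))\<^sup>2)"
proof (rule Bochner_Integration.integrable_bound)
  show "integrable M (\<lambda>x. 2 * (norm (f x))\<^sup>2 + 2 * (norm (g x))\<^sup>2)" using assms by simp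
  show "AE x in M. norm ((norm (f x - g x))\<^sup>2) \<le> norm (2 * (norm (f x))\<^sup>2 + 2 * (norm (g x))\<^sup>2)"
    using norm_add_square_le[of "f x" "- g x" for x] by simp
qed simp

lemma tendsto_integral_mult:
  fixes f :: "nat \<Rightarrow> 'a \<Rightarrow> real"
  assumes [measurable]: "\<And>k. f k \<in> borel_measurable M" "u \<in> borel_measurable M" "v \<in> borel_measurable M"
    and i: "\<And>k. integrable M (\<lambda>x. (f k x)\<^sup>2)" "integrable M (\<lambda>x. (u x)\<^sup>2)" "integrable M (\<lambda>x. (v x)\<^sup>2)"
    and l: "(\<lambda>k. \<integral>x. (f k x - u x)\<^sup>2 \<partial>M) \<longlonglongrightarrow> 0"
  shows "(\<lambda>k. \<integral>x. f k x * v x \<partial>M) \<longlonglongrightarrow> (\<integral>x. u x * v x \<partial>M)"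
proof -
  have "(\<lambda>k. sqrt (\<integral>x. (f k x - u x)\<^sup>2 \<partial>M) * sqrt (\<integral>x. (v x)\<^sup>2 \<partial>M)) \<longlonglongrightarrow> sqrt 0 * sqrt (\<integral>x. (v x)\<^sup>2 \<partial>M)"
    by (intro tendsto_mult tendsto_real_sqrt l tendsto_const)
  then have lim: "(\<lambda>k. sqrt (\<integral>x. (f k x - u x)\<^sup>2 \<partial>M) * sqrt (\<integral>x. (v x)\<^sup>2 \<partial>M)) \<longlonglongrightarrow> 0" by simp
  have "norm ((\<integral>x. f k x * v x \<partial>M) - (\<integral>x. u x * v x \<partial>M))
      \<le> sqrt (\<integral>x. (f k x - u x)\<^sup>2 \<partial>M) * sqrt (\<integral>x. (v x)\<^sup>2 \<partial>M)" for k
  proof -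
    have "integrable M (\<lambda>x. (f k x - u x)\<^sup>2)"
      using integrable_norm_diff_square[of "f k" M u] i by simp
    then have "\<bar>\<integral>x. (f k x - u x) * v x \<partial>M\<bar> \<le> sqrt (\<integral>x. (f k x - u x)\<^sup>2 \<partial>M) * sqrt (\<integral>x. (v x)\<^sup>2 \<partial>M)"
      using i by (intro integral_Cauchy_Schwarz) auto
    moreover have "(\<integral>x. (f k x - u x) * v x \<partial>M) = (\<integral>x. f k x * v x \<partial>M) - (\<integral>x. u x * v x \<partial>M)"
      using i by (simp add: left_diff_distrib integrable_mult_L2)
    ultimately show ?thesis by simp
  qed
  then have "(\<lambda>k. (\<integral>x. f k x * v x \<partial>M) - (\<integral>x. u x * v x \<partial>M)) \<longlonglongrightarrow> 0"
    by (intro Lim_null_comparison[OF _ lim]) simp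
  then show ?thesis by (simp add: LIM_zero_iff)
qed

lemma lincomb_square_le:
  "(norm (a *\<^sub>R s + b *\<^sub>R t))\<^sup>2 \<le> 2 * a\<^sup>2 * (norm s)\<^sup>2 + 2 * b\<^sup>2 * (norm t)\<^sup>2" for s t :: "'b::real_normed_vector"
  using norm_add_square_le[of "a *\<^sub>R s" "b *\<^sub>R t"] by (simp add: power_mult_distrib)

lemma integrable_lincomb_square:
  fixes f g :: "'a \<Rightarrow> 'b::euclidean_space"
  assumes "f \<in> borel_measurable M" "g \<in> borel_measurable M"
    and "integrable M (\<lambda>x. (norm (f x))\<^sup>2)" "integrable M (\<lambda>x. (norm (g x))\<^sup>2)"
  shows "integrable M (\<lambda>x. (norm (a *\<^sub>R f x + b *\<^sub>R g x))\<^sup>2)"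
  by (rule Bochner_Integration.integrable_bound[of M "\<lambda>x. 2 * a\<^sup>2 * (norm (f x))\<^sup>2 + 2 * b\<^sup>2 * (norm (g x))\<^sup>2"])
     (use assms in \<open>auto intro!: AE_I2 lincomb_square_le\<close>)

lemma lincomb_square_tendsto_0:
  fixes f g :: "nat \<Rightarrow> 'a \<Rightarrow> 'b::euclidean_space"
  assumes m: "\<And>k. f k \<in> borel_measurable M" "\<And>k. g k \<in> borel_measurable M"
    and I: "\<And>k. integrable M (\<lambda>x. (norm (f k x))\<^sup>2)" "\<And>k. integrable M (\<lambda>x. (norm (g k x))\<^sup>2)"
    and l: "(\<lambda>k. \<integral>x. (norm (f k x))\<^sup>2 \<partial>M) \<longlonglongrightarrow> 0" "(\<lambda>k. \<integral>x. (norm (g k x))\<^sup>2 \<partial>M) \<longlonglongrightarrow> 0"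
  shows "(\<lambda>k. \<integral>x. (norm (a *\<^sub>R f k x + b *\<^sub>R g k x))\<^sup>2 \<partial>M) \<longlonglongrightarrow> 0"
proof -
  have "(\<lambda>k. 2 * a\<^sup>2 * (\<integral>x. (norm (f k x))\<^sup>2 \<partial>M) + 2 * b\<^sup>2 * (\<integral>x. (norm (g k x))\<^sup>2 \<partial>M)) \<longlonglongrightarrow> 2 * a\<^sup>2 * 0 + 2 * b\<^sup>2 * 0"
    by (intro tendsto_intros l)
  then have lim: "(\<lambda>k. 2 * a\<^sup>2 * (\<integral>x. (norm (f k x))\<^sup>2 \<partial>M) + 2 * b\<^sup>2 * (\<integral>x. (norm (g k x))\<^sup>2 \<partial>M)) \<longlonglongrightarrow> 0" by simp
  have "(\<integral>x. (norm (a *\<^sub>R f k x + b *\<^sub>R g k x))\<^sup>2 \<partial>M) \<le> 2 * a\<^sup>2 * (\<integral>x. (norm (f k x))\<^sup>2 \<partial>M) + 2 * b\<^sup>2 * (\<integral>x. (norm (g k x))\<^sup>2 \<partial>M)" for k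
  proof -
    have "(\<integral>x. (norm (a *\<^sub>R f k x + b *\<^sub>R g k x))\<^sup>2 \<partial>M) \<le> (\<integral>x. 2 * a\<^sup>2 * (norm (f k x))\<^sup>2 + 2 * b\<^sup>2 * (norm (g k x))\<^sup>2 \<partial>M)"
      by (rule integral_mono[OF integrable_lincomb_square[OF m I]]) (use I lincomb_square_le in auto)
    then show ?thesis using I by simp
  qed
  then show ?thesis
    by (intro tendsto_sandwich[OF _ _ tendsto_const lim]) auto
qed

lemma norm_add3_square_le:
  "(norm (a + b + c))\<^sup>2 \<le> 4 * (norm a)\<^sup>2 + 4 * (norm b)\<^sup>2 + 2 * (norm c)\<^sup>2"
  for a b c :: "'a::real_normed_vector"
  using norm_add_square_le[of "a + b" c] norm_add_square_le[of a b] by linarith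

text \<open>Approximating \<open>v\<close> by simple functions leaves countably many values, for
  each of which measurability in \<open>x\<close> is given. Continuity in the second argument
  recovers the limit.\<close>

lemma Caratheodory_measurable:
  fixes F :: "'a \<Rightarrow> 'b::{second_countable_topology, metric_space} \<Rightarrow> 'c::metric_space"
  assumes meas: "\<And>z. (\<lambda>x. F x z) \<in> borel_measurable M"
    and cont: "\<And>x. x \<in> space M \<Longrightarrow> continuous_on UNIV (F x)" and v: "v \<in> borel_measurable M"
  shows "(\<lambda>x. F x (v x)) \<in> borel_measurable M"
proof -
  obtain s where s: "\<And>i. simple_function M (s i)" "\<And>x. x \<in> space M \<Longrightarrow> (\<lambda>i. s i x) \<longlonglongrightarrow> v x"
    using borel_measurable_implies_sequence_metric[OF v, of undefined] by blast
  show ?thesis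
  proof (rule borel_measurable_LIMSEQ_metric)
    fix i
    show "(\<lambda>x. F x (s i x)) \<in> borel_measurable M"
    proof (rule measurable_compose_countable'[where I = "s i ` space M" and f = "\<lambda>z x. F x z"])
      show "s i \<in> measurable M (count_space (s i ` space M))"
        using s(1)[of i] unfolding simple_function_def by (auto intro!: measurable_count_space_eq2[THEN iffD2])
      show "countable (s i ` space M)"
        using s(1)[of i] unfolding simple_function_def by (auto intro: countable_finite)
    qed (rule meas)
  next
    fix x assume x: "x \<in> space M"
    show "(\<lambda>i. F x (s i x)) \<longlonglongrightarrow> F x (v x)"
      by (rule continuous_on_tendsto_compose[OF cont[OF x] s(2)[OF x]]) auto
  qed
qed

text \<open>The geometric bound makes the sum \<open>S\<close> of all errors integrable. Summability
  a.e. yields pointwise convergence, and \<open>S\<close> yields one majorant for the whole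
  sequence, so dominated convergence applies to the sequence itself rather than to a
  subsequence.\<close>

lemma Nemytskii_seq:
  fixes u :: "'a \<Rightarrow> real" and w :: "'a \<Rightarrow> 'b::euclidean_space" and F :: "'a \<Rightarrow> real \<times> 'b \<Rightarrow> real"
  assumes q: "q > 0" and C: "C \<ge> 0"
    and [measurable]: "u \<in> borel_measurable M" "w \<in> borel_measurable M"
      "\<And>k. v k \<in> borel_measurable M" "\<And>k. y k \<in> borel_measurable M"
    and I: "integrable M (\<lambda>x. \<bar>u x\<bar> powr q)" "integrable M (\<lambda>x. (norm (w x))\<^sup>2)" "integrable M b"
    and Z: "\<And>k. (\<integral>\<^sup>+x. ennreal (\<bar>v k x - u x\<bar> powr q + (norm (y k x - w x))\<^sup>2) \<partial>M) \<le> ennreal ((1/2) ^ k)"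
    and meas: "\<And>z. (\<lambda>x. F x z) \<in> borel_measurable M"
    and cont: "\<And>x. x \<in> space M \<Longrightarrow> continuous_on UNIV (F x)"
    and bound: "\<And>x s \<xi>. x \<in> space M \<Longrightarrow> \<bar>F x (s, \<xi>)\<bar> \<le> b x + C * \<bar>s\<bar> powr q + C * (norm \<xi>)\<^sup>2"
  shows "(\<lambda>k. \<integral>x. F x (v k x, y k x) \<partial>M) \<longlonglongrightarrow> (\<integral>x. F x (u x, w x) \<partial>M)"
proof -
  define Zk where "Zk k x = \<bar>v k x - u x\<bar> powr q + (norm (y k x - w x))\<^sup>2" for k x
  have [measurable]: "Zk k \<in> borel_measurable M" for k unfolding Zk_def by measurable
  have Z0: "0 \<le> Zk k x" for k x by (simp add: Zk_def)
  have "(\<integral>\<^sup>+x. (\<Sum>k. ennreal (Zk k x)) \<partial>M) = (\<Sum>k. \<integral>\<^sup>+x. ennreal (Zk k x) \<partial>M)"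
    by (rule nn_integral_suminf) measurable
  also have "\<dots> \<le> (\<Sum>k. ennreal ((1/2) ^ k))"
    using Z by (intro suminf_le) (auto simp: Zk_def)
  also have "\<dots> = ennreal (\<Sum>k. (1/2) ^ k)" by (intro suminf_ennreal2 summable_geometric) auto
  finally have fin: "(\<integral>\<^sup>+x. (\<Sum>k. ennreal (Zk k x)) \<partial>M) < top"
    by (simp add: le_less_trans[OF _ ennreal_less_top])
  then have "AE x in M. (\<Sum>k. ennreal (Zk k x)) \<noteq> top"
    using nn_integral_PInf_AE[of "\<lambda>x. (\<Sum>k. ennreal (Zk k x))" M] by auto
  then have sm: "AE x in M. summable (\<lambda>k. Zk k x)"
    by eventually_elim (rule summable_suminf_not_top[OF Z0])
  define S where "S x = (\<Sum>k. Zk k x)" for x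
  have [measurable]: "S \<in> borel_measurable M" unfolding S_def by measurable
  have IS: "integrable M S"
  proof (rule integrableI_bounded)
    have "(\<integral>\<^sup>+x. ennreal (norm (S x)) \<partial>M) = (\<integral>\<^sup>+x. (\<Sum>k. ennreal (Zk k x)) \<partial>M)"
      by (rule nn_integral_cong_AE)
         (use sm in eventually_elim, auto simp: S_def suminf_ennreal2[OF Z0] suminf_nonneg[OF _ Z0])
    with fin show "(\<integral>\<^sup>+x. ennreal (norm (S x)) \<partial>M) < \<infinity>" by simp
  qed simp
  define W where "W x = b x + C * (2 powr q * (\<bar>u x\<bar> powr q + S x)) + C * (2 * (norm (w x))\<^sup>2 + 2 * S x)" for x
  have Fm: "(\<lambda>x. F x (v x, y x)) \<in> borel_measurable M"
    if [measurable]: "v \<in> borel_measurable M" "y \<in> borel_measurable M" for v y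
    by (rule Caratheodory_measurable[OF meas cont]) auto
  show ?thesis
  proof (rule integral_dominated_convergence[where w = W])
    show "(\<lambda>x. F x (u x, w x)) \<in> borel_measurable M" "(\<lambda>x. F x (v k x, y k x)) \<in> borel_measurable M" for k
      by (rule Fm; measurable)+
    show "integrable M W" unfolding W_def using I IS by simp
    show "AE x in M. (\<lambda>k. F x (v k x, y k x)) \<longlonglongrightarrow> F x (u x, w x)"
      using sm AE_space
    proof eventually_elim
      case (elim x)
      have z: "(\<lambda>k. Zk k x) \<longlonglongrightarrow> 0" using summable_LIMSEQ_zero[OF elim(1)] .
      have "(\<lambda>k. \<bar>v k x - u x\<bar> powr q) \<longlonglongrightarrow> 0"
        by (rule tendsto_sandwich[OF _ _ tendsto_const z]) (auto simp: Zk_def)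
      then have "(\<lambda>k. (\<bar>v k x - u x\<bar> powr q) powr (1 / q)) \<longlonglongrightarrow> 0 powr (1 / q)"
        using q by (intro tendsto_powr2) auto
      then have "(\<lambda>k. \<bar>v k x - u x\<bar>) \<longlonglongrightarrow> 0" using q by (simp add: powr_powr)
      then have a: "(\<lambda>k. v k x) \<longlonglongrightarrow> u x" by (simp add: tendsto_rabs_zero_iff LIM_zero_iff)
      have "(\<lambda>k. (norm (y k x - w x))\<^sup>2) \<longlonglongrightarrow> 0"
        by (rule tendsto_sandwich[OF _ _ tendsto_const z]) (auto simp: Zk_def)
      then have "(\<lambda>k. sqrt ((norm (y k x - w x))\<^sup>2)) \<longlonglongrightarrow> sqrt 0" by (rule tendsto_real_sqrt)
      then have b: "(\<lambda>k. y k x) \<longlonglongrightarrow> w x" by (simp add: tendsto_norm_zero_iff LIM_zero_iff)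
      show ?case
        by (rule continuous_on_tendsto_compose[OF cont[OF elim(2)] tendsto_Pair[OF a b]]) auto
    qed
    show "AE x in M. norm (F x (v k x, y k x)) \<le> W x" for k
      using sm AE_space
    proof eventually_elim
      case (elim x)
      have ZS: "Zk k x \<le> S x"
        using sum_le_suminf[OF elim(1), of "{k}"] Z0 by (simp add: S_def)
      then have 1: "\<bar>v k x - u x\<bar> powr q \<le> S x" "(norm (y k x - w x))\<^sup>2 \<le> S x"
        unfolding Zk_def by (smt (verit) powr_ge_zero zero_le_power2)+
      have "\<bar>v k x\<bar> powr q \<le> 2 powr q * (\<bar>u x\<bar> powr q + \<bar>v k x - u x\<bar> powr q)"
        using abs_add_powr_le[OF q, of "u x" "v k x - u x"] by simp
      also have "\<dots> \<le> 2 powr q * (\<bar>u x\<bar> powr q + S x)" using 1 by (intro mult_left_mono) auto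
      finally have 2: "\<bar>v k x\<bar> powr q \<le> 2 powr q * (\<bar>u x\<bar> powr q + S x)" .
      have 3: "(norm (y k x))\<^sup>2 \<le> 2 * (norm (w x))\<^sup>2 + 2 * S x"
        using norm_add_square_le[of "w x" "y k x - w x"] 1 by simp
      have "\<bar>F x (v k x, y k x)\<bar> \<le> b x + C * \<bar>v k x\<bar> powr q + C * (norm (y k x))\<^sup>2"
        by (rule bound[OF elim(2)])
      also have "\<dots> \<le> W x"
        unfolding W_def using 2 3 C by (intro add_mono mult_left_mono) auto
      finally show ?case by simp
    qed
  qed
qed

text \<open>If continuity failed, there would be counterexamples at geometrically decreasing
  distances, and these form a sequence of the kind covered by \<open>Nemytskii_seq\<close>.\<close>

lemma Nemytskii_continuous:
  fixes u :: "'a \<Rightarrow> real" and w :: "'a \<Rightarrow> 'b::euclidean_space" and F :: "'a \<Rightarrow> real \<times> 'b \<Rightarrow> real"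
  assumes q: "q > 0" and C: "C \<ge> 0"
    and uw: "u \<in> borel_measurable M" "w \<in> borel_measurable M"
    and I: "integrable M (\<lambda>x. \<bar>u x\<bar> powr q)" "integrable M (\<lambda>x. (norm (w x))\<^sup>2)" "integrable M b"
    and meas: "\<And>z. (\<lambda>x. F x z) \<in> borel_measurable M"
    and cont: "\<And>x. x \<in> space M \<Longrightarrow> continuous_on UNIV (F x)"
    and bound: "\<And>x s \<xi>. x \<in> space M \<Longrightarrow> \<bar>F x (s, \<xi>)\<bar> \<le> b x + C * \<bar>s\<bar> powr q + C * (norm \<xi>)\<^sup>2"
    and \<epsilon>: "\<epsilon> > 0"
  obtains \<rho> where "\<rho> > 0" "\<And>v y. v \<in> borel_measurable M \<Longrightarrow> y \<in> borel_measurable M \<Longrightarrow>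
      integrable M (\<lambda>x. \<bar>v x - u x\<bar> powr q) \<Longrightarrow> integrable M (\<lambda>x. (norm (y x - w x))\<^sup>2) \<Longrightarrow>
      (\<integral>x. \<bar>v x - u x\<bar> powr q \<partial>M) < \<rho> \<Longrightarrow> (\<integral>x. (norm (y x - w x))\<^sup>2 \<partial>M) < \<rho> \<Longrightarrow>
      \<bar>(\<integral>x. F x (v x, y x) \<partial>M) - (\<integral>x. F x (u x, w x) \<partial>M)\<bar> < \<epsilon>"
proof (rule ccontr)
  assume neg: "\<not> thesis"
  define P where "P \<rho> v y \<longleftrightarrow> v \<in> borel_measurable M \<and> y \<in> borel_measurable M \<and>
      integrable M (\<lambda>x. \<bar>v x - u x\<bar> powr q) \<and> integrable M (\<lambda>x. (norm (y x - w x))\<^sup>2) \<and>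
      (\<integral>x. \<bar>v x - u x\<bar> powr q \<partial>M) < \<rho> \<and> (\<integral>x. (norm (y x - w x))\<^sup>2 \<partial>M) < \<rho> \<and>
      \<not> \<bar>(\<integral>x. F x (v x, y x) \<partial>M) - (\<integral>x. F x (u x, w x) \<partial>M)\<bar> < \<epsilon>" for \<rho> v y
  \<comment> \<open>The exponent is \<open>Suc k\<close> because two integrals of this size are
    added to meet the bound \<open>(1/2) ^ k\<close>.\<close>
  have "\<exists>v y. P ((1/2) ^ Suc k) v y" for k
  proof (rule ccontr)
    assume "\<not> ?thesis"
    then show False using that[of "(1/2) ^ Suc k"] neg unfolding P_def by fastforce
  qed
  then obtain v y where vy: "\<And>k. P ((1/2) ^ Suc k) (v k) (y k)" by metis
  have "(\<lambda>k. \<integral>x. F x (v k x, y k x) \<partial>M) \<longlonglongrightarrow> (\<integral>x. F x (u x, w x) \<partial>M)"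
  proof (rule Nemytskii_seq[OF q C uw _ _ I _ meas cont bound])
    show "v k \<in> borel_measurable M" "y k \<in> borel_measurable M" for k using vy[of k] by (auto simp: P_def)
    fix k
    have i: "integrable M (\<lambda>x. \<bar>v k x - u x\<bar> powr q)" "integrable M (\<lambda>x. (norm (y k x - w x))\<^sup>2)"
      and l: "(\<integral>x. \<bar>v k x - u x\<bar> powr q \<partial>M) < (1/2) ^ Suc k" "(\<integral>x. (norm (y k x - w x))\<^sup>2 \<partial>M) < (1/2) ^ Suc k"
      using vy[of k] by (auto simp: P_def)
    have "(\<integral>\<^sup>+x. ennreal (\<bar>v k x - u x\<bar> powr q + (norm (y k x - w x))\<^sup>2) \<partial>M)
       = ennreal (\<integral>x. \<bar>v k x - u x\<bar> powr q + (norm (y k x - w x))\<^sup>2 \<partial>M)"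
      by (rule nn_integral_eq_integral) (use i in auto)
    also have "\<dots> = ennreal ((\<integral>x. \<bar>v k x - u x\<bar> powr q \<partial>M) + (\<integral>x. (norm (y k x - w x))\<^sup>2 \<partial>M))"
      using i by simp
    also have "\<dots> \<le> ennreal ((1/2) ^ k)" using l by (intro ennreal_leI) simp
    finally show "(\<integral>\<^sup>+x. ennreal (\<bar>v k x - u x\<bar> powr q + (norm (y k x - w x))\<^sup>2) \<partial>M) \<le> ennreal ((1/2) ^ k)" .
  qed
  then obtain k where "\<bar>(\<integral>x. F x (v k x, y k x) \<partial>M) - (\<integral>x. F x (u x, w x) \<partial>M)\<bar> < \<epsilon>"
    using \<epsilon> unfolding LIMSEQ_iff by (metis order_refl real_norm_def)
  with vy[of k] show False by (simp add: P_def)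
qed

section \<open>The space of Sobolev functions vanishing on the boundary\<close>

locale sobolev_domain =
  fixes \<Omega> :: "'a::euclidean_space set" and p :: real
  assumes p_def: "p = sobolev_exp TYPE('a)"
    and bounded_dom: "bounded \<Omega>" and open_dom: "open \<Omega>" and dim: "DIM('a) \<ge> 3"
begin

abbreviation M :: "'a measure" where "M \<equiv> lebesgue_on \<Omega>"

sublocale finite_measure M
  by (rule finite_measure_bounded_open[OF bounded_dom open_dom])

lemma p_gt_2: "p > 2"
  using dim by (simp add: p_def sobolev_exp_def field_simps)

text \<open>Membership in the closure of the test functions together with a named gradient.
  Operations on functions produce explicit gradients, and this relation carries them along until
  they are identified a.e. with \<open>wgrad\<close>.\<close>

definition H01_grad :: "('a \<Rightarrow> real) \<Rightarrow> ('a \<Rightarrow> 'a) \<Rightarrow> bool" where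
  "H01_grad u w \<longleftrightarrow> u \<in> borel_measurable M \<and> w \<in> borel_measurable M \<and>
     integrable M (\<lambda>x. (u x)\<^sup>2) \<and> integrable M (\<lambda>x. (norm (w x))\<^sup>2) \<and>
     (\<exists>\<phi>::nat \<Rightarrow> 'a \<Rightarrow> real. (\<forall>k. test_fun \<Omega> (\<phi> k)) \<and>
        (\<lambda>k. \<integral>x. (\<phi> k x - u x)\<^sup>2 \<partial>M) \<longlonglongrightarrow> 0 \<and>
        (\<lambda>k. \<integral>x. (norm (grad (\<phi> k) x - w x))\<^sup>2 \<partial>M) \<longlonglongrightarrow> 0)"

section \<open>Gradients of limits of test functions\<close>

lemma test_fun_on_dom:
  assumes "test_fun \<Omega> \<phi>"
  shows "\<phi> \<in> borel_measurable M" "grad \<phi> \<in> borel_measurable M"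
    "integrable M (\<lambda>x. (\<phi> x)\<^sup>2)" "integrable M (\<lambda>x. (norm (grad \<phi> x))\<^sup>2)"
proof -
  obtain K where K: "compact K" "\<And>x. x \<notin> K \<Longrightarrow> \<phi> x = 0" using test_fun_support[OF assms] by metis
  show "\<phi> \<in> borel_measurable M" by (rule borel_measurable_lebesgue_onI[OF test_fun_borel[OF assms]])
  show "grad \<phi> \<in> borel_measurable M"
    by (intro borel_measurable_lebesgue_onI borel_measurable_continuous_onI test_fun_grad_continuous[OF assms])
  have "integrable lborel (\<lambda>x. (\<phi> x)\<^sup>2)"
    by (rule integrable_compact_support[OF K(1)])
       (use K(2) test_fun_continuous(1)[OF assms] in \<open>auto intro!: continuous_intros\<close>)
  then show "integrable M (\<lambda>x. (\<phi> x)\<^sup>2)" by (rule integrable_lebesgue_on_lborel[OF open_dom])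
  have "integrable lborel (\<lambda>x. (norm (grad \<phi> x))\<^sup>2)"
    by (rule integrable_compact_support[OF K(1)])
       (use test_fun_grad_eq_0[OF K] test_fun_grad_continuous[OF assms] in \<open>auto intro!: continuous_intros\<close>)
  then show "integrable M (\<lambda>x. (norm (grad \<phi> x))\<^sup>2)" by (rule integrable_lebesgue_on_lborel[OF open_dom])
qed

text \<open>The approximating test functions satisfy the integration by parts formula. Both of its
  sides pass to the limit by Cauchy-Schwarz.\<close>

lemma H01_grad_has_weak_grad:
  assumes "H01_grad u w"
  shows "has_weak_grad \<Omega> u w"
proof -
  obtain \<phi> where \<phi>: "\<And>k. test_fun \<Omega> (\<phi> k)"
    and l: "(\<lambda>k. \<integral>x. (\<phi> k x - u x)\<^sup>2 \<partial>M) \<longlonglongrightarrow> 0" "(\<lambda>k. \<integral>x. (norm (grad (\<phi> k) x - w x))\<^sup>2 \<partial>M) \<longlonglongrightarrow> 0"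
    and [measurable]: "u \<in> borel_measurable M" "w \<in> borel_measurable M"
    and I: "integrable M (\<lambda>x. (u x)\<^sup>2)" "integrable M (\<lambda>x. (norm (w x))\<^sup>2)"
    using assms unfolding H01_grad_def by blast
  note t = test_fun_on_dom[OF \<phi>]
  note [measurable] = t(1,2)
  have "(\<integral>x. u x * partial_deriv i \<psi> x \<partial>M) = - (\<integral>x. (w x \<bullet> i) * \<psi> x \<partial>M)"
    if \<psi>: "test_fun \<Omega> \<psi>" and i: "i \<in> Basis" for \<psi> i
  proof -
    note ts = test_fun_on_dom[OF \<psi>]
    have pd: "partial_deriv i f = (\<lambda>x. grad f x \<bullet> i)" for f by (simp add: fun_eq_iff grad_inner[OF i])
    have [measurable]: "\<psi> \<in> borel_measurable M" "grad \<psi> \<in> borel_measurable M" by (rule ts)+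
    have 1: "(\<lambda>k. \<integral>x. \<phi> k x * partial_deriv i \<psi> x \<partial>M) \<longlonglongrightarrow> (\<integral>x. u x * partial_deriv i \<psi> x \<partial>M)"
      unfolding pd using t(3) I l(1) integrable_inner_square[OF ts(2,4) i]
      by (intro tendsto_integral_mult) auto
    have 2: "(\<lambda>k. \<integral>x. (grad (\<phi> k) x \<bullet> i) * \<psi> x \<partial>M) \<longlonglongrightarrow> (\<integral>x. (w x \<bullet> i) * \<psi> x \<partial>M)"
    proof (rule tendsto_integral_mult)
      show "integrable M (\<lambda>x. (grad (\<phi> k) x \<bullet> i)\<^sup>2)" for k by (rule integrable_inner_square[OF t(2,4) i])
      show "integrable M (\<lambda>x. (w x \<bullet> i)\<^sup>2)" by (rule integrable_inner_square[OF _ I(2) i]) simp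
      have d: "integrable M (\<lambda>x. (norm (grad (\<phi> k) x - w x))\<^sup>2)" for k
        using t(4) I(2) by (intro integrable_norm_diff_square) auto
      have le: "(\<integral>x. (grad (\<phi> k) x \<bullet> i - w x \<bullet> i)\<^sup>2 \<partial>M) \<le> (\<integral>x. (norm (grad (\<phi> k) x - w x))\<^sup>2 \<partial>M)" for k
      proof (rule integral_mono)
        show "integrable M (\<lambda>x. (grad (\<phi> k) x \<bullet> i - w x \<bullet> i)\<^sup>2)"
          using integrable_inner_square[OF _ d[of k] i] by (simp add: inner_diff_left)
        show "(grad (\<phi> k) x \<bullet> i - w x \<bullet> i)\<^sup>2 \<le> (norm (grad (\<phi> k) x - w x))\<^sup>2" for x
          using Basis_le_norm[OF i, of "grad (\<phi> k) x - w x"]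
          by (auto simp: abs_le_square_iff[symmetric] inner_diff_left)
      qed (rule d)
      show "(\<lambda>k. \<integral>x. (grad (\<phi> k) x \<bullet> i - w x \<bullet> i)\<^sup>2 \<partial>M) \<longlonglongrightarrow> 0"
        by (rule tendsto_sandwich[OF _ _ tendsto_const l(2)]) (use le in auto)
    qed (use ts in auto)
    have "(\<integral>x. \<phi> k x * partial_deriv i \<psi> x \<partial>M) = - (\<integral>x. (grad (\<phi> k) x \<bullet> i) * \<psi> x \<partial>M)" for k
    proof -
      obtain K where K: "compact K" "K \<subseteq> \<Omega>" "\<And>x. x \<notin> K \<Longrightarrow> \<psi> x = 0" using test_fun_support[OF \<psi>] by metis
      have z: "partial_deriv i \<psi> x = 0" if "x \<notin> \<Omega>" for x
        using partial_deriv_eq_0_outside[of K \<psi> x i] K that compact_imp_closed by blast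
      note [measurable] = test_fun_borel[OF \<phi>] test_fun_partial_borel[OF \<phi> i] test_fun_borel[OF \<psi>] test_fun_partial_borel[OF \<psi> i]
      have "(\<integral>x. \<phi> k x * partial_deriv i \<psi> x \<partial>M) = integral\<^sup>L lborel (\<lambda>x. \<phi> k x * partial_deriv i \<psi> x)"
        by (rule integral_lebesgue_on_eq_lborel[OF open_dom]) (use z in auto)
      also have "\<dots> = - integral\<^sup>L lborel (\<lambda>x. partial_deriv i (\<phi> k) x * \<psi> x)"
        by (rule integration_by_parts[OF test_fun_Ck[OF \<phi>] \<psi> i])
      also have "integral\<^sup>L lborel (\<lambda>x. partial_deriv i (\<phi> k) x * \<psi> x) = (\<integral>x. partial_deriv i (\<phi> k) x * \<psi> x \<partial>M)"
        by (rule integral_lebesgue_on_eq_lborel[OF open_dom, symmetric]) (use K in auto)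
      finally show ?thesis by (simp add: pd[of "\<phi> k"])
    qed
    with 1 have "(\<lambda>k. - (\<integral>x. (grad (\<phi> k) x \<bullet> i) * \<psi> x \<partial>M)) \<longlonglongrightarrow> (\<integral>x. u x * partial_deriv i \<psi> x \<partial>M)" by simp
    from LIMSEQ_unique[OF this tendsto_minus[OF 2]] show ?thesis .
  qed
  with I show ?thesis unfolding has_weak_grad_iff[OF open_dom] by auto
qed

lemma H01_grad_cong_AE:
  assumes "H01_grad u w" "has_weak_grad \<Omega> u w'"
  shows "H01_grad u w'"
proof -
  have ae: "AE x in M. w x = w' x"
    by (rule has_weak_grad_unique[OF bounded_dom open_dom H01_grad_has_weak_grad[OF assms(1)] assms(2)])
  note W = assms(2)[unfolded has_weak_grad_iff[OF open_dom]]
  have [measurable]: "w \<in> borel_measurable M" "w' \<in> borel_measurable M"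
    using W assms(1) by (auto simp: H01_grad_def)
  have "(\<integral>x. (norm (grad \<phi> x - w x))\<^sup>2 \<partial>M) = (\<integral>x. (norm (grad \<phi> x - w' x))\<^sup>2 \<partial>M)" if "test_fun \<Omega> \<phi>" for \<phi>
    using test_fun_on_dom(2)[OF that] ae by (intro integral_cong_AE) auto
  with assms(1) W show ?thesis unfolding H01_grad_def by auto
qed

lemma H01_grad_imp_H01: "H01_grad u w \<Longrightarrow> u \<in> H01 \<Omega>"
  using H01_grad_has_weak_grad[of u w]
  unfolding H01_def H01_grad_def set_lebesgue_integral_lebesgue_on[OF open_dom] by blast

lemma H01_wgrad:
  assumes "u \<in> H01 \<Omega>"
  shows "H01_grad u (wgrad \<Omega> u)"
proof -
  obtain w where w: "has_weak_grad \<Omega> u w" "\<exists>\<phi>::nat \<Rightarrow> 'a \<Rightarrow> real. (\<forall>k. test_fun \<Omega> (\<phi> k)) \<and>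
        (\<lambda>k. \<integral>x. (\<phi> k x - u x)\<^sup>2 \<partial>M) \<longlonglongrightarrow> 0 \<and>
        (\<lambda>k. \<integral>x. (norm (grad (\<phi> k) x - w x))\<^sup>2 \<partial>M) \<longlonglongrightarrow> 0"
    using assms unfolding H01_def set_lebesgue_integral_lebesgue_on[OF open_dom] by blast
  then have "H01_grad u w" unfolding H01_grad_def has_weak_grad_iff[OF open_dom] by blast
  moreover have "has_weak_grad \<Omega> u (wgrad \<Omega> u)" unfolding wgrad_def using w(1) by (rule someI[of "has_weak_grad \<Omega> u"])
  ultimately show ?thesis by (rule H01_grad_cong_AE)
qed

lemma H01_gradD:
  assumes "H01_grad u w"
  shows "u \<in> borel_measurable M" "w \<in> borel_measurable M"
    "integrable M (\<lambda>x. (u x)\<^sup>2)" "integrable M (\<lambda>x. (norm (w x))\<^sup>2)"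
  using assms by (auto simp: H01_grad_def)

lemma wgrad_AE:
  assumes "H01_grad u w"
  shows "AE x in M. wgrad \<Omega> u x = w x"
  by (rule has_weak_grad_unique[OF bounded_dom open_dom])
     (use assms H01_grad_has_weak_grad H01_wgrad H01_grad_imp_H01 in blast)+

text \<open>Distances can thus be computed from explicit gradients, since integrals do not see the
  null set on which \<open>wgrad\<close> differs.\<close>

lemma H01_dist_eq:
  assumes "H01_grad u w" "H01_grad v z"
  shows "H01_dist \<Omega> u v = sqrt (\<integral>x. (norm (w x - z x))\<^sup>2 \<partial>M)"
proof -
  have [measurable]: "w \<in> borel_measurable M" "z \<in> borel_measurable M"
    "wgrad \<Omega> u \<in> borel_measurable M" "wgrad \<Omega> v \<in> borel_measurable M"
    using assms[THEN H01_gradD(2)] assms[THEN H01_grad_imp_H01, THEN H01_wgrad, THEN H01_gradD(2)] by auto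
  have "(\<integral>x. (norm (wgrad \<Omega> u x - wgrad \<Omega> v x))\<^sup>2 \<partial>M) = (\<integral>x. (norm (w x - z x))\<^sup>2 \<partial>M)"
    using wgrad_AE[OF assms(1)] wgrad_AE[OF assms(2)] by (intro integral_cong_AE) auto
  then show ?thesis by (simp add: H01_dist_def set_lebesgue_integral_lebesgue_on[OF open_dom])
qed

section \<open>Linear combinations, truncations and the Sobolev inequality in the closure\<close>

lemma test_fun_lincomb:
  assumes "test_fun \<Omega> \<phi>" "test_fun \<Omega> \<psi>"
  shows "test_fun \<Omega> (\<lambda>x. a * \<phi> x + b * \<psi> x)"
    and "grad (\<lambda>x. a * \<phi> x + b * \<psi> x) x = a *\<^sub>R grad \<phi> x + b *\<^sub>R grad \<psi> x"
proof -
  obtain K where K: "compact K" "K \<subseteq> \<Omega>" "\<And>x. x \<notin> K \<Longrightarrow> \<phi> x = 0" using test_fun_support[OF assms(1)] by metis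
  obtain L where L: "compact L" "L \<subseteq> \<Omega>" "\<And>x. x \<notin> L \<Longrightarrow> \<psi> x = 0" using test_fun_support[OF assms(2)] by metis
  show "test_fun \<Omega> (\<lambda>x. a * \<phi> x + b * \<psi> x)"
  proof (rule test_funI)
    show "smooth_fun (\<lambda>x. a * \<phi> x + b * \<psi> x)"
      unfolding smooth_fun_def by (intro allI Ck_add Ck_mult Ck_const test_fun_Ck[OF assms(1)] test_fun_Ck[OF assms(2)])
    show "compact (K \<union> L)" using K L by auto
  qed (use K L in auto)
  have "partial_deriv i (\<lambda>x. a * \<phi> x + b * \<psi> x) x = a * partial_deriv i \<phi> x + b * partial_deriv i \<psi> x" for i
    by (rule partial_deriv_eq)
       (intro has_derivative_add has_derivative_mult_right has_derivative_partial_deriv test_fun_differentiable[OF assms(1)] test_fun_differentiable[OF assms(2)])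
  then show "grad (\<lambda>x. a * \<phi> x + b * \<psi> x) x = a *\<^sub>R grad \<phi> x + b *\<^sub>R grad \<psi> x"
    by (simp add: grad_def scaleR_left_distrib sum.distrib scaleR_sum_right)
qed

lemma H01_grad_lincomb:
  assumes u: "H01_grad u w" and v: "H01_grad v z"
  shows "H01_grad (\<lambda>x. a * u x + b * v x) (\<lambda>x. a *\<^sub>R w x + b *\<^sub>R z x)"
proof -
  note U = H01_gradD[OF u] and V = H01_gradD[OF v]
  note [measurable] = U(1,2) V(1,2)
  obtain \<phi> where \<phi>: "\<And>k. test_fun \<Omega> (\<phi> k)" "(\<lambda>k. \<integral>x. (\<phi> k x - u x)\<^sup>2 \<partial>M) \<longlonglongrightarrow> 0"
      "(\<lambda>k. \<integral>x. (norm (grad (\<phi> k) x - w x))\<^sup>2 \<partial>M) \<longlonglongrightarrow> 0"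
    using u unfolding H01_grad_def by blast
  obtain \<psi> where \<psi>: "\<And>k. test_fun \<Omega> (\<psi> k)" "(\<lambda>k. \<integral>x. (\<psi> k x - v x)\<^sup>2 \<partial>M) \<longlonglongrightarrow> 0"
      "(\<lambda>k. \<integral>x. (norm (grad (\<psi> k) x - z x))\<^sup>2 \<partial>M) \<longlonglongrightarrow> 0"
    using v unfolding H01_grad_def by blast
  note t = test_fun_on_dom[OF \<phi>(1)] and s = test_fun_on_dom[OF \<psi>(1)]
  note [measurable] = t(1,2) s(1,2)
  have d: "integrable M (\<lambda>x. (norm (\<phi> k x - u x))\<^sup>2)" "integrable M (\<lambda>x. (norm (\<psi> k x - v x))\<^sup>2)"
    "integrable M (\<lambda>x. (norm (grad (\<phi> k) x - w x))\<^sup>2)" "integrable M (\<lambda>x. (norm (grad (\<psi> k) x - z x))\<^sup>2)" for k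
    by (rule integrable_norm_diff_square; use t s U V in simp)+
  have 1: "(\<lambda>k. \<integral>x. (norm (a *\<^sub>R (\<phi> k x - u x) + b *\<^sub>R (\<psi> k x - v x)))\<^sup>2 \<partial>M) \<longlonglongrightarrow> 0"
    by (rule lincomb_square_tendsto_0) (use d \<phi> \<psi> in auto)
  have 2: "(\<lambda>k. \<integral>x. (norm (a *\<^sub>R (grad (\<phi> k) x - w x) + b *\<^sub>R (grad (\<psi> k) x - z x)))\<^sup>2 \<partial>M) \<longlonglongrightarrow> 0"
    by (rule lincomb_square_tendsto_0) (use d \<phi> \<psi> in auto)
  show ?thesis unfolding H01_grad_def
  proof (intro conjI exI allI)
    show "integrable M (\<lambda>x. (a * u x + b * v x)\<^sup>2)"
      using integrable_lincomb_square[of u M v a b] U V by simp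
    show "integrable M (\<lambda>x. (norm (a *\<^sub>R w x + b *\<^sub>R z x))\<^sup>2)"
      using U V by (intro integrable_lincomb_square) auto
    show "test_fun \<Omega> (\<lambda>x. a * \<phi> k x + b * \<psi> k x)" for k
      by (rule test_fun_lincomb[OF \<phi>(1) \<psi>(1)])
    have "a *\<^sub>R (\<phi> k x - u x) + b *\<^sub>R (\<psi> k x - v x) = a * \<phi> k x + b * \<psi> k x - (a * u x + b * v x)" for k x
      by (simp add: algebra_simps)
    with 1 show "(\<lambda>k. \<integral>x. (a * \<phi> k x + b * \<psi> k x - (a * u x + b * v x))\<^sup>2 \<partial>M) \<longlonglongrightarrow> 0" by simp
    have "a *\<^sub>R (grad (\<phi> k) x - w x) + b *\<^sub>R (grad (\<psi> k) x - z x)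
       = grad (\<lambda>x. a * \<phi> k x + b * \<psi> k x) x - (a *\<^sub>R w x + b *\<^sub>R z x)" for k x
      by (simp add: test_fun_lincomb(2)[OF \<phi>(1) \<psi>(1)] algebra_simps)
    with 2 show "(\<lambda>k. \<integral>x. (norm (grad (\<lambda>x. a * \<phi> k x + b * \<psi> k x) x - (a *\<^sub>R w x + b *\<^sub>R z x)))\<^sup>2 \<partial>M) \<longlonglongrightarrow> 0" by simp
  qed measurable
qed

lemma H01_grad_0: "H01_grad (\<lambda>x. 0) (\<lambda>x. 0)"
proof -
  have "test_fun \<Omega> (\<lambda>x. 0)"
    by (rule test_funI[of _ "{}"]) (auto simp: smooth_fun_def Ck_const)
  moreover have "grad (\<lambda>x. 0) = (\<lambda>x. 0 :: 'a)"
    unfolding grad_def by (simp add: fun_eq_iff partial_deriv_eq[OF has_derivative_const])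
  ultimately show ?thesis unfolding H01_grad_def by (auto intro!: exI[of _ "\<lambda>_ _. 0"])
qed

text \<open>The truncated test functions serve as approximants. Their gradients are products of two
  varying factors, so a linear estimate does not give convergence. It is obtained as continuity at
  \<open>(u, w)\<close>, with exponent 2, of the functional with the integrand \<open>F\<close>,
  whose value there is 0.\<close>

lemma H01_grad_truncation:
  assumes T: "truncation k \<theta> \<psi>" "k > 0" and u: "H01_grad u w"
  shows "H01_grad (\<lambda>x. \<theta> (u x)) (\<lambda>x. \<psi> (u x) *\<^sub>R w x)"
proof -
  note U = H01_gradD[OF u] and D = truncationD[OF T]
  note [measurable] = U(1,2)
  have [measurable]: "\<theta> \<in> borel_measurable borel" "\<psi> \<in> borel_measurable borel"
    using D(5,6) by (auto intro: borel_measurable_continuous_onI)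
  obtain \<phi> where \<phi>: "\<And>k. test_fun \<Omega> (\<phi> k)" "(\<lambda>k. \<integral>x. (\<phi> k x - u x)\<^sup>2 \<partial>M) \<longlonglongrightarrow> 0"
      "(\<lambda>k. \<integral>x. (norm (grad (\<phi> k) x - w x))\<^sup>2 \<partial>M) \<longlonglongrightarrow> 0"
    using u unfolding H01_grad_def by blast
  note t = test_fun_on_dom[OF \<phi>(1)]
  note [measurable] = t(1,2)
  have d: "integrable M (\<lambda>x. (norm (\<phi> k x - u x))\<^sup>2)" "integrable M (\<lambda>x. (norm (grad (\<phi> k) x - w x))\<^sup>2)" for k
    by (rule integrable_norm_diff_square; use t U in simp)+
  have \<theta>le: "(\<theta> s - \<theta> t)\<^sup>2 \<le> (s - t)\<^sup>2" for s t
    using D(1)[of s t] by (simp add: abs_le_square_iff)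
  have \<psi>le: "(norm (\<psi> s *\<^sub>R \<xi>))\<^sup>2 \<le> (norm \<xi>)\<^sup>2" for s and \<xi> :: 'a
    using D(3,4)[of s] by (auto intro!: power_mono mult_left_le_one_le)
  have gr: "grad (\<lambda>x. \<theta> (\<phi> k x)) x = \<psi> (\<phi> k x) *\<^sub>R grad (\<phi> k) x" for k x
  proof -
    have "partial_deriv i (\<lambda>x. \<theta> (\<phi> k x)) x = \<psi> (\<phi> k x) * partial_deriv i (\<phi> k) x" for i
      by (rule partial_deriv_compose[OF test_fun_differentiable[OF \<phi>(1)] D(7)])
    then show ?thesis by (simp add: grad_def scaleR_sum_right)
  qed
  have sq: "\<bar>s\<bar> powr 2 = s\<^sup>2" for s :: real by (simp add: powr_numeral)
  show ?thesis unfolding H01_grad_def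
  proof (intro conjI exI allI)
    show "integrable M (\<lambda>x. (\<theta> (u x))\<^sup>2)"
      by (rule Bochner_Integration.integrable_bound[OF U(3)]) (use \<theta>le[of _ 0] D(2) in auto)
    show "integrable M (\<lambda>x. (norm (\<psi> (u x) *\<^sub>R w x))\<^sup>2)"
      by (rule Bochner_Integration.integrable_bound[OF U(4)]) (use \<psi>le in auto)
    show "test_fun \<Omega> (\<lambda>x. \<theta> (\<phi> k x))" for k
    proof -
      obtain K where K: "compact K" "K \<subseteq> \<Omega>" "\<And>x. x \<notin> K \<Longrightarrow> \<phi> k x = 0" using test_fun_support[OF \<phi>(1)] by metis
      show ?thesis
      proof (rule test_funI[OF _ K(1,2)])
        show "smooth_fun (\<lambda>x. \<theta> (\<phi> k x))"
          using T(1) test_fun_Ck[OF \<phi>(1)] unfolding truncation_def smooth_fun_def by (auto intro: Ck_compose)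
      qed (use K(3) D(2) in auto)
    qed
    have "(\<integral>x. (\<theta> (\<phi> k x) - \<theta> (u x))\<^sup>2 \<partial>M) \<le> (\<integral>x. (\<phi> k x - u x)\<^sup>2 \<partial>M)" for k
    proof (rule integral_mono)
      show "integrable M (\<lambda>x. (\<phi> k x - u x)\<^sup>2)" using d(1)[of k] by simp
      then show "integrable M (\<lambda>x. (\<theta> (\<phi> k x) - \<theta> (u x))\<^sup>2)"
        by (rule Bochner_Integration.integrable_bound) (use \<theta>le in auto)
    qed (use \<theta>le in auto)
    then show "(\<lambda>k. \<integral>x. (\<theta> (\<phi> k x) - \<theta> (u x))\<^sup>2 \<partial>M) \<longlonglongrightarrow> 0"
      by (intro tendsto_sandwich[OF _ _ tendsto_const \<phi>(2)]) auto
    define F where "F x z = (norm (\<psi> (fst z) *\<^sub>R snd z - \<psi> (u x) *\<^sub>R w x))\<^sup>2" for x and z :: "real \<times> 'a"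
    have contF: "continuous_on UNIV (F x)" for x
      unfolding F_def by (intro continuous_intros continuous_on_compose2[OF D(5)]) auto
    have boundF: "\<bar>F x (s, \<xi>)\<bar> \<le> 2 * (norm (w x))\<^sup>2 + 2 * \<bar>s\<bar> powr 2 + 2 * (norm \<xi>)\<^sup>2" for x s \<xi>
    proof -
      have "F x (s, \<xi>) \<le> 2 * (norm (\<psi> s *\<^sub>R \<xi>))\<^sup>2 + 2 * (norm (\<psi> (u x) *\<^sub>R w x))\<^sup>2"
        using norm_add_square_le[of "\<psi> s *\<^sub>R \<xi>" "- (\<psi> (u x) *\<^sub>R w x)"] by (simp add: F_def)
      also have "\<dots> \<le> 2 * (norm \<xi>)\<^sup>2 + 2 * (norm (w x))\<^sup>2"
        using \<psi>le by (intro add_mono mult_left_mono) auto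
      also have "\<dots> \<le> 2 * (norm (w x))\<^sup>2 + 2 * \<bar>s\<bar> powr 2 + 2 * (norm \<xi>)\<^sup>2" by simp
      finally show ?thesis by (simp add: F_def)
    qed
    have measF: "(\<lambda>x. F x z) \<in> borel_measurable M" for z unfolding F_def by measurable
    have I2: "integrable M (\<lambda>x. \<bar>u x\<bar> powr 2)" "integrable M (\<lambda>x. 2 * (norm (w x))\<^sup>2)" using U by (auto simp: sq)
    show "(\<lambda>k. \<integral>x. (norm (grad (\<lambda>x. \<theta> (\<phi> k x)) x - \<psi> (u x) *\<^sub>R w x))\<^sup>2 \<partial>M) \<longlonglongrightarrow> 0"
    proof (rule LIMSEQ_I)
      fix \<epsilon> :: real assume \<epsilon>: "\<epsilon> > 0"
      obtain \<rho> where \<rho>: "\<rho> > 0" "\<And>v y. v \<in> borel_measurable M \<Longrightarrow> y \<in> borel_measurable M \<Longrightarrow>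
          integrable M (\<lambda>x. \<bar>v x - u x\<bar> powr 2) \<Longrightarrow> integrable M (\<lambda>x. (norm (y x - w x))\<^sup>2) \<Longrightarrow>
          (\<integral>x. \<bar>v x - u x\<bar> powr 2 \<partial>M) < \<rho> \<Longrightarrow> (\<integral>x. (norm (y x - w x))\<^sup>2 \<partial>M) < \<rho> \<Longrightarrow>
          \<bar>(\<integral>x. F x (v x, y x) \<partial>M) - (\<integral>x. F x (u x, w x) \<partial>M)\<bar> < \<epsilon>"
        using Nemytskii_continuous[OF zero_less_numeral zero_le_numeral U(1,2) I2(1) U(4) I2(2) measF contF boundF \<epsilon>]
        by blast
      obtain n where n: "\<And>k. k \<ge> n \<Longrightarrow> (\<integral>x. (\<phi> k x - u x)\<^sup>2 \<partial>M) < \<rho> \<and> (\<integral>x. (norm (grad (\<phi> k) x - w x))\<^sup>2 \<partial>M) < \<rho>"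
        using eventually_conj[OF order_tendstoD(2)[OF \<phi>(2) \<rho>(1)] order_tendstoD(2)[OF \<phi>(3) \<rho>(1)]]
        unfolding eventually_sequentially by blast
      have "\<bar>(\<integral>x. F x (\<phi> k x, grad (\<phi> k) x) \<partial>M) - (\<integral>x. F x (u x, w x) \<partial>M)\<bar> < \<epsilon>" if "k \<ge> n" for k
        using n[OF that] d[of k] by (intro \<rho>(2)) (auto simp: sq)
      then show "\<exists>n. \<forall>k\<ge>n. norm ((\<integral>x. (norm (grad (\<lambda>x. \<theta> (\<phi> k x)) x - \<psi> (u x) *\<^sub>R w x))\<^sup>2 \<partial>M) - 0) < \<epsilon>"
        by (intro exI[of _ n]) (simp add: F_def gr)
    qed
  qed measurable
qed

text \<open>Fatou's lemma along an a.e. convergent subsequence carries the inequality over from the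
  test functions. The factor 2 stems from splitting the gradient of an approximant into
  \<open>w\<close> and an error that tends to 0.\<close>

lemma H01_grad_Sobolev:
  assumes u: "H01_grad u w"
  shows "integrable M (\<lambda>x. \<bar>u x\<bar> powr p)"
    and "(\<integral>x. \<bar>u x\<bar> powr p \<partial>M) \<le> (4 * sqrt (2 * (\<integral>x. (norm (w x))\<^sup>2 \<partial>M))) powr p"
proof -
  note U = H01_gradD[OF u]
  note [measurable] = U(1,2)
  obtain \<phi> where \<phi>: "\<And>k. test_fun \<Omega> (\<phi> k)" "(\<lambda>k. \<integral>x. (\<phi> k x - u x)\<^sup>2 \<partial>M) \<longlonglongrightarrow> 0"
      "(\<lambda>k. \<integral>x. (norm (grad (\<phi> k) x - w x))\<^sup>2 \<partial>M) \<longlonglongrightarrow> 0"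
    using u unfolding H01_grad_def by blast
  note t = test_fun_on_dom[OF \<phi>(1)]
  note [measurable] = t(1,2)
  have d: "integrable M (\<lambda>x. (norm (\<phi> k x - u x))\<^sup>2)" "integrable M (\<lambda>x. (norm (grad (\<phi> k) x - w x))\<^sup>2)" for k
    by (rule integrable_norm_diff_square; use t U in simp)+
  obtain r :: "nat \<Rightarrow> nat" where r: "strict_mono r" "AE x in M. (\<lambda>k. (\<phi> (r k) x - u x)\<^sup>2) \<longlonglongrightarrow> 0"
    using tendsto_L1_AE_subseq[of M "\<lambda>k x. (\<phi> k x - u x)\<^sup>2"] d(1) \<phi>(2) by auto
  define D where "D = (\<integral>x. (norm (w x))\<^sup>2 \<partial>M)"
  define B where "B k = (4 * sqrt (2 * (\<integral>x. (norm (grad (\<phi> k) x - w x))\<^sup>2 \<partial>M) + 2 * D)) powr p" for k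
  have Bl: "(\<lambda>k. B (r k)) \<longlonglongrightarrow> (4 * sqrt (2 * 0 + 2 * D)) powr p"
    unfolding B_def using p_gt_2
    by (intro tendsto_powr2 tendsto_intros LIMSEQ_subseq_LIMSEQ[OF \<phi>(3) r(1), unfolded comp_def]) (auto simp: D_def)
  have le: "(\<integral>\<^sup>+x. ennreal (\<bar>\<phi> k x\<bar> powr p) \<partial>M) \<le> ennreal (B k)" for k
  proof -
    obtain K where K: "compact K" "K \<subseteq> \<Omega>" "\<And>x. x \<notin> K \<Longrightarrow> \<phi> k x = 0" using test_fun_support[OF \<phi>(1)] by metis
    note [measurable] = test_fun_borel[OF \<phi>(1)]
    have "continuous_on UNIV (\<lambda>x. \<bar>\<phi> k x\<bar> powr p)"
      using p_gt_2 by (intro continuous_on_powr' continuous_intros test_fun_continuous(1)[OF \<phi>(1)]) auto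
    then have il: "integrable lborel (\<lambda>x. \<bar>\<phi> k x\<bar> powr p)"
      by (rule integrable_compact_support[OF K(1)]) (simp add: K(3))
    have g0: "grad (\<phi> k) x = 0" if "x \<notin> \<Omega>" for x
      using test_fun_grad_eq_0[OF K(1), of "\<phi> k" x] K(2,3) that by auto
    have gm: "grad (\<phi> k) \<in> borel_measurable borel"
      using test_fun_grad_continuous[OF \<phi>(1)] by (rule borel_measurable_continuous_onI)
    have "(\<integral>x. \<bar>\<phi> k x\<bar> powr p \<partial>M) = integral\<^sup>L lborel (\<lambda>x. \<bar>\<phi> k x\<bar> powr p)"
      by (rule integral_lebesgue_on_eq_lborel[OF open_dom]) (use K in auto)
    also have "\<dots> \<le> (4 * sqrt (integral\<^sup>L lborel (\<lambda>x. (norm (grad (\<phi> k) x))\<^sup>2))) powr p"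
      unfolding p_def by (rule Sobolev_test_fun[OF dim \<phi>(1)])
    also have "integral\<^sup>L lborel (\<lambda>x. (norm (grad (\<phi> k) x))\<^sup>2) = (\<integral>x. (norm (grad (\<phi> k) x))\<^sup>2 \<partial>M)"
      by (rule integral_lebesgue_on_eq_lborel[OF open_dom, symmetric]) (use gm g0 in auto)
    also have "(4 * sqrt (\<integral>x. (norm (grad (\<phi> k) x))\<^sup>2 \<partial>M)) powr p \<le> B k"
    proof -
      have "(\<integral>x. (norm (grad (\<phi> k) x))\<^sup>2 \<partial>M) \<le> (\<integral>x. 2 * (norm (grad (\<phi> k) x - w x))\<^sup>2 + 2 * (norm (w x))\<^sup>2 \<partial>M)"
      proof (rule integral_mono)
        show "(norm (grad (\<phi> k) x))\<^sup>2 \<le> 2 * (norm (grad (\<phi> k) x - w x))\<^sup>2 + 2 * (norm (w x))\<^sup>2" for x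
          using norm_add_square_le[of "grad (\<phi> k) x - w x" "w x"] by simp
      qed (use t U d in auto)
      also have "\<dots> = 2 * (\<integral>x. (norm (grad (\<phi> k) x - w x))\<^sup>2 \<partial>M) + 2 * D"
        using d U by (simp add: D_def)
      finally show ?thesis unfolding B_def using p_gt_2 by (intro powr_mono2 mult_left_mono) auto
    qed
    finally have "(\<integral>x. \<bar>\<phi> k x\<bar> powr p \<partial>M) \<le> B k" .
    then show ?thesis
      by (subst nn_integral_eq_integral[OF integrable_lebesgue_on_lborel[OF open_dom il]]) (auto intro: ennreal_leI)
  qed
  have "(\<integral>\<^sup>+x. ennreal (\<bar>u x\<bar> powr p) \<partial>M) = (\<integral>\<^sup>+x. liminf (\<lambda>k. ennreal (\<bar>\<phi> (r k) x\<bar> powr p)) \<partial>M)"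
  proof (rule nn_integral_cong_AE, use r(2) in eventually_elim)
    fix x assume "(\<lambda>k. (\<phi> (r k) x - u x)\<^sup>2) \<longlonglongrightarrow> 0"
    then have "(\<lambda>k. sqrt ((\<phi> (r k) x - u x)\<^sup>2)) \<longlonglongrightarrow> sqrt 0" by (rule tendsto_real_sqrt)
    then have "(\<lambda>k. \<phi> (r k) x) \<longlonglongrightarrow> u x" by (simp add: tendsto_rabs_zero_iff LIM_zero_iff)
    then have "(\<lambda>k. ennreal (\<bar>\<phi> (r k) x\<bar> powr p)) \<longlonglongrightarrow> ennreal (\<bar>u x\<bar> powr p)"
      using p_gt_2 by (intro tendsto_ennrealI tendsto_powr2 tendsto_intros) auto
    then show "ennreal (\<bar>u x\<bar> powr p) = liminf (\<lambda>k. ennreal (\<bar>\<phi> (r k) x\<bar> powr p))"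
      by (intro lim_imp_Liminf[symmetric]) auto
  qed
  also have "\<dots> \<le> liminf (\<lambda>k. \<integral>\<^sup>+x. ennreal (\<bar>\<phi> (r k) x\<bar> powr p) \<partial>M)"
    by (rule nn_integral_liminf) measurable
  also have "\<dots> \<le> liminf (\<lambda>k. ennreal (B (r k)))"
    by (intro Liminf_mono always_eventually allI le)
  also have "\<dots> = ennreal ((4 * sqrt (2 * D)) powr p)"
    using tendsto_ennrealI[OF Bl] by (intro lim_imp_Liminf) auto
  finally have main: "(\<integral>\<^sup>+x. ennreal (\<bar>u x\<bar> powr p) \<partial>M) \<le> ennreal ((4 * sqrt (2 * D)) powr p)" .
  show i: "integrable M (\<lambda>x. \<bar>u x\<bar> powr p)"
    using main by (intro integrableI_bounded) (auto intro: le_less_trans)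
  show "(\<integral>x. \<bar>u x\<bar> powr p \<partial>M) \<le> (4 * sqrt (2 * (\<integral>x. (norm (w x))\<^sup>2 \<partial>M))) powr p"
    using main by (subst (asm) nn_integral_eq_integral[OF i]) (auto simp: D_def)
qed

text \<open>By the Sobolev inequality, convergence in the gradient seminorm controls the arguments of
  every functional of critical growth.\<close>
lemma H01_functional_continuous:
  fixes F :: "'a \<Rightarrow> real \<times> 'a \<Rightarrow> real"
  assumes u: "u \<in> H01 \<Omega>" and C: "C \<ge> 0" and b: "integrable M b"
    and meas: "\<And>z. (\<lambda>x. F x z) \<in> borel_measurable M"
    and cont: "\<And>x. x \<in> \<Omega> \<Longrightarrow> continuous_on UNIV (F x)"
    and bound: "\<And>x s \<xi>. x \<in> \<Omega> \<Longrightarrow> \<bar>F x (s, \<xi>)\<bar> \<le> b x + C * \<bar>s\<bar> powr p + C * (norm \<xi>)\<^sup>2"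
    and \<epsilon>: "\<epsilon> > 0"
  obtains \<rho> where "\<rho> > 0" "\<And>v. v \<in> H01 \<Omega> \<Longrightarrow> H01_dist \<Omega> v u < \<rho> \<Longrightarrow>
      \<bar>(\<integral>x. F x (v x, wgrad \<Omega> v x) \<partial>M) - (\<integral>x. F x (u x, wgrad \<Omega> u x) \<partial>M)\<bar> < \<epsilon>"
proof -
  note Hu = H01_wgrad[OF u]
  note U = H01_gradD[OF Hu]
  obtain \<rho> where \<rho>: "\<rho> > 0" "\<And>v y. v \<in> borel_measurable M \<Longrightarrow> y \<in> borel_measurable M \<Longrightarrow>
      integrable M (\<lambda>x. \<bar>v x - u x\<bar> powr p) \<Longrightarrow> integrable M (\<lambda>x. (norm (y x - wgrad \<Omega> u x))\<^sup>2) \<Longrightarrow>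
      (\<integral>x. \<bar>v x - u x\<bar> powr p \<partial>M) < \<rho> \<Longrightarrow> (\<integral>x. (norm (y x - wgrad \<Omega> u x))\<^sup>2 \<partial>M) < \<rho> \<Longrightarrow>
      \<bar>(\<integral>x. F x (v x, y x) \<partial>M) - (\<integral>x. F x (u x, wgrad \<Omega> u x) \<partial>M)\<bar> < \<epsilon>"
    by (rule Nemytskii_continuous[of p C u M "wgrad \<Omega> u" b F \<epsilon>])
       (use p_gt_2 C U(1,2,4) H01_grad_Sobolev(1)[OF Hu] b meas cont bound \<epsilon> in auto)
  \<comment> \<open>\<open>d\<close> will bound the gradient distance. The Sobolev inequality bounds
    the integral of order p by the first of these expressions, and both tend to 0 with
    \<open>d\<close>.\<close>
  have "((\<lambda>d. (4 * sqrt (2 * d\<^sup>2)) powr p) \<longlongrightarrow> (4 * sqrt (2 * 0\<^sup>2)) powr p) (at_right 0)"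
    "((\<lambda>d::real. d\<^sup>2) \<longlongrightarrow> 0\<^sup>2) (at_right 0)"
    using p_gt_2 by (intro tendsto_powr2 tendsto_intros; simp)+
  then have "eventually (\<lambda>d. (4 * sqrt (2 * d\<^sup>2)) powr p < \<rho> \<and> d\<^sup>2 < \<rho>) (at_right 0)"
    using \<rho>(1) by (intro eventually_conj order_tendstoD(2)) auto
  then obtain d where d: "d > 0" "(4 * sqrt (2 * d\<^sup>2)) powr p < \<rho>" "d\<^sup>2 < \<rho>"
    unfolding eventually_at_right_field by (metis dense)
  show thesis
  proof (rule that[OF d(1)])
    fix v assume v: "v \<in> H01 \<Omega>" and vd: "H01_dist \<Omega> v u < d"
    note Hv = H01_wgrad[OF v]
    note V = H01_gradD[OF Hv]
    have diff: "H01_grad (\<lambda>x. v x - u x) (\<lambda>x. wgrad \<Omega> v x - wgrad \<Omega> u x)"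
      using H01_grad_lincomb[OF Hv Hu, of 1 "-1"] by simp
    note S = H01_grad_Sobolev[OF diff] and DD = H01_gradD[OF diff]
    define e where "e = (\<integral>x. (norm (wgrad \<Omega> v x - wgrad \<Omega> u x))\<^sup>2 \<partial>M)"
    have e0: "e \<ge> 0" by (simp add: e_def)
    have "sqrt e < d" using vd H01_dist_eq[OF Hv Hu] by (simp add: e_def)
    then have ed: "e \<le> d\<^sup>2" using e0 d(1) by (simp add: real_sqrt_less_iff real_less_lsqrt sqrt_le_D less_imp_le)
    have "(\<integral>x. \<bar>v x - u x\<bar> powr p \<partial>M) \<le> (4 * sqrt (2 * e)) powr p" using S(2) by (simp add: e_def)
    also have "\<dots> \<le> (4 * sqrt (2 * d\<^sup>2)) powr p"
      using ed e0 p_gt_2 by (intro powr_mono2 mult_left_mono) auto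
    finally show "\<bar>(\<integral>x. F x (v x, wgrad \<Omega> v x) \<partial>M) - (\<integral>x. F x (u x, wgrad \<Omega> u x) \<partial>M)\<bar> < \<epsilon>"
      using d ed S(1) DD V by (intro \<rho>(2)) (auto simp: e_def)
  qed
qed

end

section \<open>The deformation along a truncation\<close>

text \<open>Young's inequality without its sharp constants: depending on which of \<open>a\<close>
  and \<bar>s\<bar> powr (q - 1) is larger, the product is dominated by one of the two terms
  alone.\<close>

lemma Young_crude:
  fixes s a q :: real
  assumes "a \<ge> 0" "q > 1"
  shows "\<bar>s\<bar> * a \<le> a powr (q / (q - 1)) + \<bar>s\<bar> powr q"
proof (cases "s = 0 \<or> a = 0")
  case False
  then have s: "\<bar>s\<bar> > 0" and a: "a > 0" using assms by auto
  show ?thesis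
  proof (cases "a \<le> \<bar>s\<bar> powr (q - 1)")
    case True
    then have "\<bar>s\<bar> * a \<le> \<bar>s\<bar> powr 1 * \<bar>s\<bar> powr (q - 1)" using s by (simp add: mult_left_mono)
    also have "\<dots> = \<bar>s\<bar> powr (1 + (q - 1))" by (simp only: powr_add)
    also have "1 + (q - 1) = q" by simp
    finally show ?thesis using powr_ge_zero[of a "q / (q - 1)"] by linarith
  next
    case False
    then have "(\<bar>s\<bar> powr (q - 1)) powr (1 / (q - 1)) \<le> a powr (1 / (q - 1))"
      using assms by (intro powr_mono2) auto
    then have "\<bar>s\<bar> \<le> a powr (1 / (q - 1))" using assms s by (simp add: powr_powr)
    then have "\<bar>s\<bar> * a \<le> a powr (1 / (q - 1)) * a powr 1" using a by (simp add: mult_right_mono)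
    also have "\<dots> = a powr (1 / (q - 1) + 1)" by (simp only: powr_add)
    also have "1 / (q - 1) + 1 = q / (q - 1)" using assms by (simp add: field_simps)
    finally show ?thesis using powr_ge_zero[of "\<bar>s\<bar>" q] by linarith
  qed
qed auto

text \<open>The assumptions in the shape that the deformation uses, at every point of
  \<open>\<Omega>\<close>: convexity enters as \<open>j_scale\<close>, the sign condition as
  monotonicity of \<open>j\<close> in \<open>s\<close> away from (-R, R), and the growth of
  \<open>g\<close> as the Lipschitz estimate \<open>G_diff\<close>. \<open>C\<^sub>0\<close> bounds
  \<open>\<Lambda>\<close> in the gradient seminorm.\<close>

locale critical_functional = sobolev_domain \<Omega> p for \<Omega> :: "'a::euclidean_space set" and p +
  fixes j :: "'a \<Rightarrow> real \<Rightarrow> 'a \<Rightarrow> real" and G :: "'a \<Rightarrow> real \<Rightarrow> real" and \<Lambda> :: "('a \<Rightarrow> real) \<Rightarrow> real"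
    and \<alpha> :: "real \<Rightarrow> real" and R :: real and a :: "'a \<Rightarrow> real" and C\<^sub>0 :: real
  assumes j_meas: "\<And>s \<xi>. (\<lambda>x. j x s \<xi>) \<in> borel_measurable M"
    and j_cont: "\<And>x. x \<in> \<Omega> \<Longrightarrow> continuous_on UNIV (\<lambda>z. j x (fst z) (snd z))"
    and j_scale: "\<And>x s c \<xi>. x \<in> \<Omega> \<Longrightarrow> 0 \<le> c \<Longrightarrow> c \<le> 1 \<Longrightarrow> j x s (c *\<^sub>R \<xi>) \<le> c * j x s \<xi>"
    and j_nonneg: "\<And>x s \<xi>. x \<in> \<Omega> \<Longrightarrow> 0 \<le> j x s \<xi>"
    and j_le: "\<And>x s \<xi>. x \<in> \<Omega> \<Longrightarrow> j x s \<xi> \<le> \<alpha> \<bar>s\<bar> * (norm \<xi>)\<^sup>2"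
    and \<alpha>_mono: "mono_on {0..} \<alpha>" and \<alpha>_pos: "\<And>t. t \<ge> 0 \<Longrightarrow> \<alpha> t > 0"
    and R_pos: "R > 0"
    and j_mono_pos: "\<And>x s t \<xi>. x \<in> \<Omega> \<Longrightarrow> R \<le> t \<Longrightarrow> t \<le> s \<Longrightarrow> j x t \<xi> \<le> j x s \<xi>"
    and j_mono_neg: "\<And>x s t \<xi>. x \<in> \<Omega> \<Longrightarrow> s \<le> t \<Longrightarrow> t \<le> - R \<Longrightarrow> j x t \<xi> \<le> j x s \<xi>"
    and G_meas: "\<And>s. (\<lambda>x. G x s) \<in> borel_measurable M"
    and G_cont: "\<And>x. x \<in> \<Omega> \<Longrightarrow> continuous_on UNIV (G x)"
    and G_0: "\<And>x. G x 0 = 0"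
    and G_diff: "\<And>x s t. x \<in> \<Omega> \<Longrightarrow> \<bar>t\<bar> \<le> \<bar>s\<bar> \<Longrightarrow> \<bar>G x s - G x t\<bar> \<le> \<bar>s - t\<bar> * (a x + \<bar>s\<bar> powr (p - 1))"
    and a_meas: "a \<in> borel_measurable M" and a_nonneg: "\<And>x. x \<in> \<Omega> \<Longrightarrow> a x \<ge> 0"
    and a_int: "integrable M (\<lambda>x. a x powr (p / (p - 1)))"
    and \<Lambda>_add: "\<And>u v. u \<in> H01 \<Omega> \<Longrightarrow> v \<in> H01 \<Omega> \<Longrightarrow> \<Lambda> (\<lambda>x. u x + v x) = \<Lambda> u + \<Lambda> v"
    and \<Lambda>_scale: "\<And>u c. u \<in> H01 \<Omega> \<Longrightarrow> \<Lambda> (\<lambda>x. c * u x) = c * \<Lambda> u"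
    and \<Lambda>_bdd: "\<And>u. u \<in> H01 \<Omega> \<Longrightarrow> \<bar>\<Lambda> u\<bar> \<le> C\<^sub>0 * H01_dist \<Omega> u (\<lambda>x. 0)"
    and C\<^sub>0: "C\<^sub>0 \<ge> 0"
begin

definition J :: "('a \<Rightarrow> real) \<Rightarrow> ennreal" where
  "J v = (\<integral>\<^sup>+x. ennreal (j x (v x) (wgrad \<Omega> v x)) \<partial>M)"

definition \<Gamma> :: "('a \<Rightarrow> real) \<Rightarrow> real" where
  "\<Gamma> v = (\<integral>x. G x (v x) \<partial>M)"

definition f :: "('a \<Rightarrow> real) \<Rightarrow> ereal" where
  "f v = enn2ereal (J v) - ereal (\<Gamma> v) - ereal (\<Lambda> v)"

text \<open>The energy with large values of \<open>v\<close> cut off. Its integrand is bounded by a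
  multiple of the squared gradient, so it stays finite and continuous where \<open>J\<close> may be
  infinite.\<close>

definition K :: "(real \<Rightarrow> real) \<Rightarrow> ('a \<Rightarrow> real) \<Rightarrow> real" where
  "K \<psi> v = (\<integral>x. \<psi> (v x) * j x (v x) (wgrad \<Omega> v x) \<partial>M)"

text \<open>A bound for the loss in \<open>\<Gamma>\<close> along the deformation per unit of s; the
  second factor is the Lipschitz constant from \<open>G_diff\<close>.\<close>

definition E :: "(real \<Rightarrow> real) \<Rightarrow> ('a \<Rightarrow> real) \<Rightarrow> real" where
  "E \<theta> v = (\<integral>x. \<bar>v x - \<theta> (v x)\<bar> * (a x + \<bar>v x\<bar> powr (p - 1)) \<partial>M)"

text \<open>The gradient seminorm of v - \<theta>(v), hence the speed of the deformation with
  respect to s.\<close>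

definition tail :: "(real \<Rightarrow> real) \<Rightarrow> ('a \<Rightarrow> real) \<Rightarrow> real" where
  "tail \<psi> v = sqrt (\<integral>x. (norm ((1 - \<psi> (v x)) *\<^sub>R wgrad \<Omega> v x))\<^sup>2 \<partial>M)"

definition deform :: "(real \<Rightarrow> real) \<Rightarrow> ('a \<Rightarrow> real) \<Rightarrow> real \<Rightarrow> 'a \<Rightarrow> real" where
  "deform \<theta> w s x = w x + s * (\<theta> (w x) - w x)"

section \<open>Energy, lower order terms and distances along the deformation\<close>

lemma H01_measurable:
  assumes "v \<in> H01 \<Omega>"
  shows "v \<in> borel_measurable M" "wgrad \<Omega> v \<in> borel_measurable M"
  using H01_gradD[OF H01_wgrad[OF assms]] by auto

lemma j_comp_measurable:
  assumes [measurable]: "v \<in> borel_measurable M" "w \<in> borel_measurable M"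
  shows "(\<lambda>x. j x (v x) (w x)) \<in> borel_measurable M"
  using Caratheodory_measurable[of "\<lambda>x z. j x (fst z) (snd z)" M "\<lambda>x. (v x, w x)"] j_meas j_cont by simp

lemma G_comp_measurable:
  "v \<in> borel_measurable M \<Longrightarrow> (\<lambda>x. G x (v x)) \<in> borel_measurable M"
  using Caratheodory_measurable[of G M v] G_meas G_cont by simp

lemma deform_grad:
  assumes T: "truncation k \<theta> \<psi>" "k > 0" and w: "w \<in> H01 \<Omega>"
  shows "H01_grad (deform \<theta> w s) (\<lambda>x. (1 + s * (\<psi> (w x) - 1)) *\<^sub>R wgrad \<Omega> w x)"
proof -
  note H = H01_wgrad[OF w]
  have "H01_grad (\<lambda>x. (1 - s) * w x + s * \<theta> (w x)) (\<lambda>x. (1 - s) *\<^sub>R wgrad \<Omega> w x + s *\<^sub>R (\<psi> (w x) *\<^sub>R wgrad \<Omega> w x))"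
    by (rule H01_grad_lincomb[OF H H01_grad_truncation[OF T H]])
  also have "(\<lambda>x. (1 - s) * w x + s * \<theta> (w x)) = deform \<theta> w s"
    by (simp add: fun_eq_iff deform_def algebra_simps)
  also have "(\<lambda>x. (1 - s) *\<^sub>R wgrad \<Omega> w x + s *\<^sub>R (\<psi> (w x) *\<^sub>R wgrad \<Omega> w x)) = (\<lambda>x. (1 + s * (\<psi> (w x) - 1)) *\<^sub>R wgrad \<Omega> w x)"
    by (simp add: fun_eq_iff algebra_simps)
  finally show ?thesis .
qed

lemma deform_in_H01: "truncation k \<theta> \<psi> \<Longrightarrow> k > 0 \<Longrightarrow> w \<in> H01 \<Omega> \<Longrightarrow> deform \<theta> w s \<in> H01 \<Omega>"
  using deform_grad H01_grad_imp_H01 by blast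

lemma deform_dist:
  assumes T: "truncation k \<theta> \<psi>" "k > 0" and w: "w \<in> H01 \<Omega>" and s: "s \<ge> 0"
  shows "H01_dist \<Omega> (deform \<theta> w s) w = s * tail \<psi> w"
proof -
  have "H01_dist \<Omega> (deform \<theta> w s) w = sqrt (\<integral>x. (norm ((1 + s * (\<psi> (w x) - 1)) *\<^sub>R wgrad \<Omega> w x - wgrad \<Omega> w x))\<^sup>2 \<partial>M)"
    by (rule H01_dist_eq[OF deform_grad[OF T w] H01_wgrad[OF w]])
  also have "(\<lambda>x. (norm ((1 + s * (\<psi> (w x) - 1)) *\<^sub>R wgrad \<Omega> w x - wgrad \<Omega> w x))\<^sup>2)
      = (\<lambda>x. s\<^sup>2 * (norm ((1 - \<psi> (w x)) *\<^sub>R wgrad \<Omega> w x))\<^sup>2)"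
  proof
    fix x
    have "(1 + s * (\<psi> (w x) - 1)) *\<^sub>R wgrad \<Omega> w x - wgrad \<Omega> w x = (- s) *\<^sub>R ((1 - \<psi> (w x)) *\<^sub>R wgrad \<Omega> w x)"
      by (simp add: algebra_simps)
    then show "(norm ((1 + s * (\<psi> (w x) - 1)) *\<^sub>R wgrad \<Omega> w x - wgrad \<Omega> w x))\<^sup>2 = s\<^sup>2 * (norm ((1 - \<psi> (w x)) *\<^sub>R wgrad \<Omega> w x))\<^sup>2"
      by (simp only: norm_scaleR power_mult_distrib) simp
  qed
  finally show ?thesis using s by (simp add: tail_def real_sqrt_mult)
qed

text \<open>For \<bar>t\<bar> \<le> k nothing moves. Otherwise the path towards \<theta>(t) stays
  beyond k \<ge> R on its side of the origin, so replacing its point by \<open>t\<close> can only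
  increase \<open>j\<close>. The factor in front of \<xi> lies in [0, 1] and is then pulled out by
  \<open>j_scale\<close>.\<close>

lemma j_deform_le:
  assumes T: "truncation k \<theta> \<psi>" "k \<ge> R" and x: "x \<in> \<Omega>" and s: "0 \<le> s" "s \<le> 1"
  shows "j x (t + s * (\<theta> t - t)) ((1 + s * (\<psi> t - 1)) *\<^sub>R \<xi>) \<le> (1 - s) * j x t \<xi> + s * (\<psi> t * j x t \<xi>)"
proof -
  have k: "k > 0" using T R_pos by simp
  note P = truncation_props[OF T(1) k] and D = truncationD[OF T(1) k]
  let ?t = "t + s * (\<theta> t - t)"
  have c: "0 \<le> 1 + s * (\<psi> t - 1)" "1 + s * (\<psi> t - 1) \<le> 1"
  proof -
    have "s * (1 - \<psi> t) \<le> 1 * 1" using s D(3,4)[of t] by (intro mult_mono) auto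
    then show "0 \<le> 1 + s * (\<psi> t - 1)" by (simp add: algebra_simps)
    show "1 + s * (\<psi> t - 1) \<le> 1" using s D(4)[of t] by (simp add: mult_nonneg_nonpos)
  qed
  consider "\<bar>t\<bar> \<le> k" | "t \<ge> k" | "t \<le> - k" by linarith
  then show ?thesis
  proof cases
    case 1
    then show ?thesis using P(3)[of t] by (simp add: algebra_simps)
  next
    case 2
    have "?t \<le> t" using s P(4)[OF 2] by (simp add: mult_nonneg_nonpos)
    moreover have "?t \<ge> \<theta> t"
    proof -
      have "s * (t - \<theta> t) \<le> 1 * (t - \<theta> t)" using s P(4)[OF 2] by (intro mult_right_mono) auto
      then show ?thesis by (simp add: algebra_simps)
    qed
    ultimately have "j x ?t ((1 + s * (\<psi> t - 1)) *\<^sub>R \<xi>) \<le> j x t ((1 + s * (\<psi> t - 1)) *\<^sub>R \<xi>)"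
      using P(4)[OF 2] T(2) by (intro j_mono_pos x) auto
    also have "\<dots> \<le> (1 + s * (\<psi> t - 1)) * j x t \<xi>" by (rule j_scale[OF x c])
    finally show ?thesis by (simp add: algebra_simps)
  next
    case 3
    have "?t \<ge> t" using s P(5)[OF 3] by simp
    moreover have "?t \<le> \<theta> t"
    proof -
      have "s * (\<theta> t - t) \<le> 1 * (\<theta> t - t)" using s P(5)[OF 3] by (intro mult_right_mono) auto
      then show ?thesis by (simp add: algebra_simps)
    qed
    ultimately have "j x ?t ((1 + s * (\<psi> t - 1)) *\<^sub>R \<xi>) \<le> j x t ((1 + s * (\<psi> t - 1)) *\<^sub>R \<xi>)"
      using P(5)[OF 3] T(2) by (intro j_mono_neg x) auto
    also have "\<dots> \<le> (1 + s * (\<psi> t - 1)) * j x t \<xi>" by (rule j_scale[OF x c])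
    finally show ?thesis by (simp add: algebra_simps)
  qed
qed

text \<open>The cutoff vanishes from k + 1 on, so by monotonicity \<alpha> is bounded by its value
  there.\<close>

lemma K_bound:
  assumes T: "truncation k \<theta> \<psi>" "k > 0" and x: "x \<in> \<Omega>"
  shows "0 \<le> \<psi> s * j x s \<xi>" "\<psi> s * j x s \<xi> \<le> \<alpha> (k + 1) * (norm \<xi>)\<^sup>2"
proof -
  note P = truncation_props[OF T] and D = truncationD[OF T]
  show "0 \<le> \<psi> s * j x s \<xi>" using D(3) j_nonneg[OF x] by simp
  show "\<psi> s * j x s \<xi> \<le> \<alpha> (k + 1) * (norm \<xi>)\<^sup>2"
  proof (cases "\<bar>s\<bar> \<ge> k + 1")
    case True
    then show ?thesis using P(6) \<alpha>_pos[of "k + 1"] T(2) by simp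
  next
    case False
    have "\<psi> s * j x s \<xi> \<le> 1 * j x s \<xi>" using D(3,4) j_nonneg[OF x] by (intro mult_right_mono) auto
    also have "\<dots> \<le> \<alpha> \<bar>s\<bar> * (norm \<xi>)\<^sup>2" using j_le[OF x] by simp
    also have "\<dots> \<le> \<alpha> (k + 1) * (norm \<xi>)\<^sup>2"
      using False T(2) by (intro mult_right_mono mono_onD[OF \<alpha>_mono]) auto
    finally show ?thesis .
  qed
qed

lemma K_integrable:
  assumes T: "truncation k \<theta> \<psi>" "k > 0" and v: "v \<in> H01 \<Omega>"
  shows "integrable M (\<lambda>x. \<psi> (v x) * j x (v x) (wgrad \<Omega> v x))"
proof -
  note V = H01_gradD[OF H01_wgrad[OF v]]
  have [measurable]: "\<psi> \<in> borel_measurable borel"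
    using truncationD(5)[OF T] by (rule borel_measurable_continuous_onI)
  note [measurable] = V(1,2) j_comp_measurable[OF V(1,2)]
  show ?thesis
    by (rule Bochner_Integration.integrable_bound[of M "\<lambda>x. \<alpha> (k + 1) * (norm (wgrad \<Omega> v x))\<^sup>2"])
       (use V K_bound[OF T] in \<open>auto intro!: AE_I2 intro: order_trans[OF _ abs_ge_self]\<close>)
qed

lemma J_deform_le:
  assumes T: "truncation k \<theta> \<psi>" "k \<ge> R" and w: "w \<in> H01 \<Omega>" and s: "0 \<le> s" "s \<le> 1"
  shows "J (deform \<theta> w s) \<le> ennreal (1 - s) * J w + ennreal (s * K \<psi> w)"
proof -
  have k: "k > 0" using T R_pos by simp
  note V = H01_gradD[OF H01_wgrad[OF w]]
  have [measurable]: "\<psi> \<in> borel_measurable borel"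
    using truncationD(5)[OF T(1) k] by (rule borel_measurable_continuous_onI)
  note [measurable] = V(1,2) j_comp_measurable[OF V(1,2)]
  have "J (deform \<theta> w s) = (\<integral>\<^sup>+x. ennreal (j x (deform \<theta> w s x) ((1 + s * (\<psi> (w x) - 1)) *\<^sub>R wgrad \<Omega> w x)) \<partial>M)"
    unfolding J_def by (rule nn_integral_cong_AE) (use wgrad_AE[OF deform_grad[OF T(1) k w], of s] in \<open>eventually_elim, simp\<close>)
  also have "\<dots> \<le> (\<integral>\<^sup>+x. ennreal (1 - s) * ennreal (j x (w x) (wgrad \<Omega> w x)) + ennreal (s * (\<psi> (w x) * j x (w x) (wgrad \<Omega> w x))) \<partial>M)"
  proof (rule nn_integral_mono)
    fix x assume "x \<in> space M"
    then have x: "x \<in> \<Omega>" by simp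
    have "ennreal (j x (deform \<theta> w s x) ((1 + s * (\<psi> (w x) - 1)) *\<^sub>R wgrad \<Omega> w x))
        \<le> ennreal ((1 - s) * j x (w x) (wgrad \<Omega> w x) + s * (\<psi> (w x) * j x (w x) (wgrad \<Omega> w x)))"
      unfolding deform_def by (rule ennreal_leI[OF j_deform_le[OF T x s]])
    also have "\<dots> = ennreal (1 - s) * ennreal (j x (w x) (wgrad \<Omega> w x)) + ennreal (s * (\<psi> (w x) * j x (w x) (wgrad \<Omega> w x)))"
      using s j_nonneg[OF x] K_bound(1)[OF T(1) k x] by (simp add: ennreal_plus ennreal_mult)
    finally show "ennreal (j x (deform \<theta> w s x) ((1 + s * (\<psi> (w x) - 1)) *\<^sub>R wgrad \<Omega> w x)) \<le> \<dots>" .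
  qed
  also have "\<dots> = ennreal (1 - s) * J w + (\<integral>\<^sup>+x. ennreal (s * (\<psi> (w x) * j x (w x) (wgrad \<Omega> w x))) \<partial>M)"
    by (simp add: nn_integral_add nn_integral_cmult J_def)
  also have "(\<integral>\<^sup>+x. ennreal (s * (\<psi> (w x) * j x (w x) (wgrad \<Omega> w x))) \<partial>M) = ennreal (s * K \<psi> w)"
  proof -
    have "integrable M (\<lambda>x. s * (\<psi> (w x) * j x (w x) (wgrad \<Omega> w x)))"
      using K_integrable[OF T(1) k w] by simp
    then have "(\<integral>\<^sup>+x. ennreal (s * (\<psi> (w x) * j x (w x) (wgrad \<Omega> w x))) \<partial>M) = ennreal (\<integral>x. s * (\<psi> (w x) * j x (w x) (wgrad \<Omega> w x)) \<partial>M)"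
      by (rule nn_integral_eq_integral) (use s K_bound(1)[OF T(1) k] in auto)
    then show ?thesis by (simp add: K_def)
  qed
  finally show ?thesis .
qed

text \<open>Young's inequality with the conjugate exponents p and p / (p - 1) turns the critical
  growth bound into an integrable majorant.\<close>

lemma growth_le:
  assumes "x \<in> \<Omega>" "\<bar>t\<bar> \<le> \<bar>s\<bar>"
  shows "\<bar>t\<bar> * (a x + \<bar>s\<bar> powr (p - 1)) \<le> a x powr (p / (p - 1)) + 2 * \<bar>s\<bar> powr p"
proof -
  have "\<bar>t\<bar> * (a x + \<bar>s\<bar> powr (p - 1)) \<le> \<bar>s\<bar> * (a x + \<bar>s\<bar> powr (p - 1))"
    using assms a_nonneg by (intro mult_right_mono) auto
  also have "\<dots> = \<bar>s\<bar> * a x + \<bar>s\<bar> powr p"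
    by (cases "s = 0") (auto simp: algebra_simps powr_mult_base)
  also have "\<dots> \<le> a x powr (p / (p - 1)) + 2 * \<bar>s\<bar> powr p"
    using Young_crude[of "a x" p s] a_nonneg assms p_gt_2 by simp
  finally show ?thesis .
qed

lemma G_bound: "x \<in> \<Omega> \<Longrightarrow> \<bar>G x s\<bar> \<le> a x powr (p / (p - 1)) + 2 * \<bar>s\<bar> powr p"
  using G_diff[of x 0 s] growth_le[of x s s] G_0[of x] by simp

lemma growth_integrable:
  assumes v: "v \<in> H01 \<Omega>" and [measurable]: "h \<in> borel_measurable M"
    and "\<And>x. x \<in> \<Omega> \<Longrightarrow> \<bar>h x\<bar> \<le> a x powr (p / (p - 1)) + 2 * \<bar>v x\<bar> powr p"
  shows "integrable M h"
proof (rule Bochner_Integration.integrable_bound)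
  show "integrable M (\<lambda>x. a x powr (p / (p - 1)) + 2 * \<bar>v x\<bar> powr p)"
    using a_int H01_grad_Sobolev(1)[OF H01_wgrad[OF v]] by simp
  show "AE x in M. norm (h x) \<le> norm (a x powr (p / (p - 1)) + 2 * \<bar>v x\<bar> powr p)"
    using assms(3) by (auto intro!: AE_I2 intro: order_trans[OF _ abs_ge_self])
qed simp

lemma \<Gamma>_deform_le:
  assumes T: "truncation k \<theta> \<psi>" "k > 0" and w: "w \<in> H01 \<Omega>" and s: "0 \<le> s" "s \<le> 1"
  shows "\<Gamma> w - \<Gamma> (deform \<theta> w s) \<le> s * E \<theta> w"
proof -
  note P = truncation_props[OF T]
  have [measurable]: "\<theta> \<in> borel_measurable borel"
    using truncationD(6)[OF T] by (rule borel_measurable_continuous_onI)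
  note [measurable] = H01_measurable[OF w] a_meas H01_measurable(1)[OF deform_in_H01[OF T w, of s]]
  have le: "\<bar>deform \<theta> w s x\<bar> \<le> \<bar>w x\<bar>" for x
  proof -
    have "\<bar>(1 - s) * w x + s * \<theta> (w x)\<bar> \<le> (1 - s) * \<bar>w x\<bar> + s * \<bar>\<theta> (w x)\<bar>"
      using s abs_triangle_ineq[of "(1 - s) * w x" "s * \<theta> (w x)"] by (simp add: abs_mult)
    also have "\<dots> \<le> (1 - s) * \<bar>w x\<bar> + s * \<bar>w x\<bar>" using s P(1) by (intro add_left_mono mult_left_mono) auto
    finally show ?thesis by (simp add: deform_def algebra_simps)
  qed
  have I1: "integrable M (\<lambda>x. G x (w x))" "integrable M (\<lambda>x. G x (deform \<theta> w s x))"
    by (rule growth_integrable[OF w] growth_integrable[OF deform_in_H01[OF T w, of s]];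
        intro G_bound G_comp_measurable; measurable)+
  have I2: "integrable M (\<lambda>x. \<bar>w x - \<theta> (w x)\<bar> * (a x + \<bar>w x\<bar> powr (p - 1)))"
  proof (rule growth_integrable[OF w])
    fix x assume x: "x \<in> \<Omega>"
    show "\<bar>\<bar>w x - \<theta> (w x)\<bar> * (a x + \<bar>w x\<bar> powr (p - 1))\<bar> \<le> a x powr (p / (p - 1)) + 2 * \<bar>w x\<bar> powr p"
      using growth_le[OF x P(2)[of "w x"]] a_nonneg[OF x] by (simp add: abs_mult)
  qed measurable
  have "\<Gamma> w - \<Gamma> (deform \<theta> w s) = (\<integral>x. G x (w x) - G x (deform \<theta> w s x) \<partial>M)"
    using I1 by (simp add: \<Gamma>_def)
  also have "\<dots> \<le> (\<integral>x. s * (\<bar>w x - \<theta> (w x)\<bar> * (a x + \<bar>w x\<bar> powr (p - 1))) \<partial>M)"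
  proof (rule integral_mono)
    fix x assume "x \<in> space M"
    then have x: "x \<in> \<Omega>" by simp
    have "G x (w x) - G x (deform \<theta> w s x) \<le> \<bar>w x - deform \<theta> w s x\<bar> * (a x + \<bar>w x\<bar> powr (p - 1))"
      using G_diff[OF x le[of x]] by simp
    also have "\<bar>w x - deform \<theta> w s x\<bar> = s * \<bar>w x - \<theta> (w x)\<bar>"
    proof -
      have "w x - deform \<theta> w s x = s * (w x - \<theta> (w x))" by (simp add: deform_def algebra_simps)
      then show ?thesis using s by (simp add: abs_mult)
    qed
    finally show "G x (w x) - G x (deform \<theta> w s x) \<le> s * (\<bar>w x - \<theta> (w x)\<bar> * (a x + \<bar>w x\<bar> powr (p - 1)))"
      by (simp add: mult_ac)
  qed (use I1 I2 in auto)
  also have "\<dots> = s * E \<theta> w" by (simp add: E_def)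
  finally show ?thesis .
qed

lemma \<Lambda>_deform_le:
  assumes T: "truncation k \<theta> \<psi>" "k > 0" and w: "w \<in> H01 \<Omega>" and s: "0 \<le> s"
  shows "\<Lambda> w - \<Lambda> (deform \<theta> w s) \<le> s * (C\<^sub>0 * tail \<psi> w)"
proof -
  note H = H01_wgrad[OF w]
  have D: "H01_grad (\<lambda>x. \<theta> (w x) - w x) (\<lambda>x. \<psi> (w x) *\<^sub>R wgrad \<Omega> w x - wgrad \<Omega> w x)"
    using H01_grad_lincomb[OF H01_grad_truncation[OF T H] H, of 1 "-1"] by simp
  note DH = H01_grad_imp_H01[OF D]
  have sH: "(\<lambda>x. s * (\<theta> (w x) - w x)) \<in> H01 \<Omega>"
    using H01_grad_imp_H01[OF H01_grad_lincomb[OF D D, of s 0]] by simp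
  have "\<Lambda> (deform \<theta> w s) = \<Lambda> w + s * \<Lambda> (\<lambda>x. \<theta> (w x) - w x)"
    using \<Lambda>_add[OF w sH] \<Lambda>_scale[OF DH, of s] by (simp add: deform_def[abs_def])
  moreover have "\<bar>\<Lambda> (\<lambda>x. \<theta> (w x) - w x)\<bar> \<le> C\<^sub>0 * tail \<psi> w"
  proof -
    have "H01_dist \<Omega> (\<lambda>x. \<theta> (w x) - w x) (\<lambda>x. 0) = sqrt (\<integral>x. (norm (\<psi> (w x) *\<^sub>R wgrad \<Omega> w x - wgrad \<Omega> w x - 0))\<^sup>2 \<partial>M)"
      by (rule H01_dist_eq[OF D H01_grad_0])
    also have "(\<lambda>x. (norm (\<psi> (w x) *\<^sub>R wgrad \<Omega> w x - wgrad \<Omega> w x - 0))\<^sup>2) = (\<lambda>x. (norm ((1 - \<psi> (w x)) *\<^sub>R wgrad \<Omega> w x))\<^sup>2)"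
      by (simp add: fun_eq_iff norm_minus_commute scaleR_left_diff_distrib)
    finally show ?thesis using \<Lambda>_bdd[OF DH] by (simp add: tail_def)
  qed
  then have "- (C\<^sub>0 * tail \<psi> w) \<le> \<Lambda> (\<lambda>x. \<theta> (w x) - w x)" by linarith
  then have "s * - (C\<^sub>0 * tail \<psi> w) \<le> s * \<Lambda> (\<lambda>x. \<theta> (w x) - w x)" using s by (rule mult_left_mono)
  ultimately show ?thesis by simp
qed

lemma f_eqI:
  assumes "f v \<le> ereal \<mu>"
  obtains r where "r \<ge> 0" "J v = ennreal r" "f v = ereal (r - \<Gamma> v - \<Lambda> v)"
proof (cases "J v")
  case (real r)
  then have "f v = ereal (r - \<Gamma> v - \<Lambda> v)" by (simp add: f_def)
  with real that show thesis by blast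
next
  case top
  then show thesis using assms by (simp add: f_def)
qed

text \<open>The energy r = J w is not compared with the energy at any other point. It is at most
  \<mu> + \<Gamma>(w) + \<Lambda>(w), because f(w) \<le> \<mu>, and it enters with weight 1 - s. The
  quantities that remain in the inner bracket all depend continuously on w.\<close>

lemma f_deform_le:
  assumes T: "truncation k \<theta> \<psi>" "k \<ge> R" and w: "w \<in> H01 \<Omega>" and s: "0 \<le> s" "s \<le> 1" and \<mu>: "f w \<le> ereal \<mu>"
  shows "f (deform \<theta> w s)
    \<le> ereal (\<mu> - s * (\<mu> - (K \<psi> w - \<Gamma> w - \<Lambda> w + E \<theta> w + C\<^sub>0 * tail \<psi> w)))"
proof -
  have k: "k > 0" using T R_pos by simp
  obtain r where r: "r \<ge> 0" "J w = ennreal r" "f w = ereal (r - \<Gamma> w - \<Lambda> w)" using f_eqI[OF \<mu>] by metis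
  let ?W = "deform \<theta> w s"
  have K0: "K \<psi> w \<ge> 0"
    unfolding K_def by (intro Bochner_Integration.integral_nonneg) (use K_bound(1)[OF T(1) k] in auto)
  have "J ?W \<le> ennreal (1 - s) * ennreal r + ennreal (s * K \<psi> w)"
    using J_deform_le[OF T w s] r by simp
  also have "\<dots> = ennreal ((1 - s) * r + s * K \<psi> w)"
    using r(1) s K0 by (simp add: ennreal_mult ennreal_plus)
  finally have JW: "J ?W \<le> ennreal ((1 - s) * r + s * K \<psi> w)" .
  then obtain r' where r': "r' \<ge> 0" "J ?W = ennreal r'" "r' \<le> (1 - s) * r + s * K \<psi> w"
    using r(1) s K0 by (cases "J ?W") (auto simp: top_unique ennreal_le_iff simp flip: ennreal_plus)
  have fW: "f ?W = ereal (r' - \<Gamma> ?W - \<Lambda> ?W)" using r' by (simp add: f_def)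
  have "r \<le> \<mu> + \<Gamma> w + \<Lambda> w" using \<mu> r(3) by simp
  then have "(1 - s) * r \<le> (1 - s) * (\<mu> + \<Gamma> w + \<Lambda> w)" using s by (intro mult_left_mono) auto
  then have "r' - \<Gamma> ?W - \<Lambda> ?W \<le> (1 - s) * (\<mu> + \<Gamma> w + \<Lambda> w) + s * K \<psi> w - \<Gamma> ?W - \<Lambda> ?W"
    using r'(3) by linarith
  also have "\<dots> = \<mu> - s * (\<mu> - (K \<psi> w - \<Gamma> w - \<Lambda> w)) + (\<Gamma> w - \<Gamma> ?W) + (\<Lambda> w - \<Lambda> ?W)"
    by (simp add: algebra_simps)
  also have "\<dots> \<le> \<mu> - s * (\<mu> - (K \<psi> w - \<Gamma> w - \<Lambda> w)) + s * E \<theta> w + s * (C\<^sub>0 * tail \<psi> w)"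
    using \<Gamma>_deform_le[OF T(1) k w s] \<Lambda>_deform_le[OF T(1) k w s(1)] by linarith
  also have "\<dots> = \<mu> - s * (\<mu> - (K \<psi> w - \<Gamma> w - \<Lambda> w + E \<theta> w + C\<^sub>0 * tail \<psi> w))"
    by (simp add: algebra_simps)
  finally show ?thesis using fW by simp
qed

section \<open>Continuity of the auxiliary functionals in the gradient seminorm\<close>

lemma tail_square: "(tail \<psi> v)\<^sup>2 = (\<integral>x. (norm ((1 - \<psi> (v x)) *\<^sub>R wgrad \<Omega> v x))\<^sup>2 \<partial>M)"
  by (simp add: tail_def)

lemma tail_nonneg: "tail \<psi> v \<ge> 0"
  by (simp add: tail_def)

lemma K_continuous:
  assumes T: "truncation k \<theta> \<psi>" "k > 0" and u: "u \<in> H01 \<Omega>" and \<epsilon>: "\<epsilon> > 0"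
  obtains \<rho> where "\<rho> > 0" "\<And>v. v \<in> H01 \<Omega> \<Longrightarrow> H01_dist \<Omega> v u < \<rho> \<Longrightarrow> \<bar>K \<psi> v - K \<psi> u\<bar> < \<epsilon>"
proof -
  let ?F = "\<lambda>x z. \<psi> (fst z) * j x (fst z) (snd z)"
  have c: "continuous_on UNIV (?F x)" if "x \<in> \<Omega>" for x
    by (intro continuous_on_mult j_cont[OF that] continuous_on_compose2[OF truncationD(5)[OF T]] continuous_intros) auto
  have b: "\<bar>?F x (s, \<xi>)\<bar> \<le> 0 + \<alpha> (k + 1) * \<bar>s\<bar> powr p + \<alpha> (k + 1) * (norm \<xi>)\<^sup>2" if "x \<in> \<Omega>" for x s \<xi>
  proof -
    have "0 \<le> \<alpha> (k + 1) * \<bar>s\<bar> powr p" using \<alpha>_pos[of "k + 1"] T(2) by simp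
    then show ?thesis using K_bound[OF T that, of s \<xi>] by simp
  qed
  have m: "(\<lambda>x. ?F x z) \<in> borel_measurable M" for z using j_meas by (intro borel_measurable_times) auto
  show thesis
    by (rule H01_functional_continuous[OF u _ _ m c b \<epsilon>])
       (use \<alpha>_pos[of "k + 1"] T(2) that in \<open>auto simp: K_def less_imp_le\<close>)
qed

lemma \<Gamma>_continuous:
  assumes u: "u \<in> H01 \<Omega>" and \<epsilon>: "\<epsilon> > 0"
  obtains \<rho> where "\<rho> > 0" "\<And>v. v \<in> H01 \<Omega> \<Longrightarrow> H01_dist \<Omega> v u < \<rho> \<Longrightarrow> \<bar>\<Gamma> v - \<Gamma> u\<bar> < \<epsilon>"
proof -
  let ?F = "\<lambda>x z. G x (fst z)"
  have c: "continuous_on UNIV (?F x)" if "x \<in> \<Omega>" for x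
    by (intro continuous_on_compose2[OF G_cont[OF that]] continuous_intros) auto
  have b: "\<bar>?F x (s, \<xi>)\<bar> \<le> a x powr (p / (p - 1)) + 2 * \<bar>s\<bar> powr p + 2 * (norm \<xi>)\<^sup>2" if "x \<in> \<Omega>" for x s \<xi>
    using G_bound[OF that, of s] zero_le_power2[of "norm \<xi>"] unfolding fst_conv by linarith
  show thesis
    by (rule H01_functional_continuous[OF u _ a_int G_meas c b \<epsilon>]) (use that in \<open>auto simp: \<Gamma>_def\<close>)
qed

lemma E_integrand_bound:
  assumes T: "truncation k \<theta> \<psi>" "k > 0" and x: "x \<in> \<Omega>"
  shows "\<bar>\<bar>s - \<theta> s\<bar> * (a x + \<bar>s\<bar> powr (p - 1))\<bar> \<le> a x powr (p / (p - 1)) + 2 * \<bar>s\<bar> powr p"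
  using growth_le[OF x truncation_props(2)[OF T, of s]] a_nonneg[OF x] by (simp add: abs_mult)

lemma E_continuous:
  assumes T: "truncation k \<theta> \<psi>" "k > 0" and u: "u \<in> H01 \<Omega>" and \<epsilon>: "\<epsilon> > 0"
  obtains \<rho> where "\<rho> > 0" "\<And>v. v \<in> H01 \<Omega> \<Longrightarrow> H01_dist \<Omega> v u < \<rho> \<Longrightarrow> \<bar>E \<theta> v - E \<theta> u\<bar> < \<epsilon>"
proof -
  let ?F = "\<lambda>x z. \<bar>fst z - \<theta> (fst z)\<bar> * (a x + \<bar>fst z\<bar> powr (p - 1))"
  have c: "continuous_on UNIV (?F x)" for x
    using p_gt_2 by (intro continuous_intros continuous_on_powr' continuous_on_compose2[OF truncationD(6)[OF T]]) auto
  have b: "\<bar>?F x (s, \<xi>)\<bar> \<le> a x powr (p / (p - 1)) + 2 * \<bar>s\<bar> powr p + 2 * (norm \<xi>)\<^sup>2" if "x \<in> \<Omega>" for x s \<xi>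
    using E_integrand_bound[OF T that, of s] zero_le_power2[of "norm \<xi>"] unfolding fst_conv by linarith
  have m: "(\<lambda>x. ?F x z) \<in> borel_measurable M" for z using a_meas by measurable
  show thesis
    by (rule H01_functional_continuous[OF u _ a_int m c b \<epsilon>]) (use that in \<open>auto simp: E_def\<close>)
qed

lemma tail_bound:
  fixes \<xi> :: 'a
  assumes T: "truncation k \<theta> \<psi>" "k > 0"
  shows "(norm ((1 - \<psi> s) *\<^sub>R \<xi>))\<^sup>2 \<le> (norm \<xi>)\<^sup>2"
  using truncationD(3,4)[OF T, of s] by (auto intro!: power_mono mult_left_le_one_le)

text \<open>Stated for the square, since this is the integral functional to which the general
  continuity result applies.\<close>

lemma tail_continuous:
  assumes T: "truncation k \<theta> \<psi>" "k > 0" and u: "u \<in> H01 \<Omega>" and \<epsilon>: "\<epsilon> > 0"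
  obtains \<rho> where "\<rho> > 0" "\<And>v. v \<in> H01 \<Omega> \<Longrightarrow> H01_dist \<Omega> v u < \<rho> \<Longrightarrow> \<bar>(tail \<psi> v)\<^sup>2 - (tail \<psi> u)\<^sup>2\<bar> < \<epsilon>"
proof -
  let ?F = "\<lambda>(x::'a) z. (norm ((1 - \<psi> (fst z)) *\<^sub>R snd z))\<^sup>2 :: real"
  have c: "continuous_on UNIV (?F x)" for x
    by (intro continuous_intros continuous_on_compose2[OF truncationD(5)[OF T]]) auto
  have b: "\<bar>?F x (s, \<xi>)\<bar> \<le> 0 + 1 * \<bar>s\<bar> powr p + 1 * (norm \<xi>)\<^sup>2" for x :: 'a and s and \<xi> :: 'a
    using tail_bound[OF T, of s \<xi>] powr_ge_zero[of "\<bar>s\<bar>" p] unfolding fst_conv snd_conv abs_power2 by linarith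
  show thesis
    by (rule H01_functional_continuous[OF u _ _ _ c b \<epsilon>]) (use that in \<open>auto simp: tail_square simp del: norm_scaleR\<close>)
qed

lemma \<Lambda>_continuous:
  assumes u: "u \<in> H01 \<Omega>" and \<epsilon>: "\<epsilon> > 0"
  obtains \<rho> where "\<rho> > 0" "\<And>v. v \<in> H01 \<Omega> \<Longrightarrow> H01_dist \<Omega> v u < \<rho> \<Longrightarrow> \<bar>\<Lambda> v - \<Lambda> u\<bar> < \<epsilon>"
proof (rule that[of "\<epsilon> / (C\<^sub>0 + 1)"])
  show "\<epsilon> / (C\<^sub>0 + 1) > 0" using \<epsilon> C\<^sub>0 by simp
  fix v assume v: "v \<in> H01 \<Omega>" and d: "H01_dist \<Omega> v u < \<epsilon> / (C\<^sub>0 + 1)"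
  note Hu = H01_wgrad[OF u] and Hv = H01_wgrad[OF v]
  have D: "H01_grad (\<lambda>x. v x - u x) (\<lambda>x. wgrad \<Omega> v x - wgrad \<Omega> u x)"
    using H01_grad_lincomb[OF Hv Hu, of 1 "-1"] by simp
  have mu: "(\<lambda>x. (-1) * u x) \<in> H01 \<Omega>"
    using H01_grad_imp_H01[OF H01_grad_lincomb[OF Hu Hu, of "-1" 0]] by simp
  have "\<Lambda> (\<lambda>x. v x - u x) = \<Lambda> v - \<Lambda> u"
    using \<Lambda>_add[OF v mu] \<Lambda>_scale[OF u, of "-1"] by simp
  then have "\<bar>\<Lambda> v - \<Lambda> u\<bar> \<le> C\<^sub>0 * H01_dist \<Omega> (\<lambda>x. v x - u x) (\<lambda>x. 0)"
    using \<Lambda>_bdd[OF H01_grad_imp_H01[OF D]] by simp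
  also have "H01_dist \<Omega> (\<lambda>x. v x - u x) (\<lambda>x. 0) = H01_dist \<Omega> v u"
    by (simp add: H01_dist_eq[OF D H01_grad_0] H01_dist_eq[OF Hv Hu])
  also have "C\<^sub>0 * H01_dist \<Omega> v u \<le> C\<^sub>0 * (\<epsilon> / (C\<^sub>0 + 1))" using d C\<^sub>0 by (intro mult_left_mono) auto
  also have "\<dots> < \<epsilon>" using C\<^sub>0 \<epsilon> by (simp add: field_simps)
  finally show "\<bar>\<Lambda> v - \<Lambda> u\<bar> < \<epsilon>" .
qed

text \<open>At each point the truncations of level \<open>R + real n\<close> eventually coincide
  with the identity, so both integrands are eventually 0 there and dominated convergence
  applies.\<close>

lemma good_truncation:
  assumes u: "u \<in> H01 \<Omega>" and \<epsilon>: "\<epsilon> > 0"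
  obtains k \<theta> \<psi> where "truncation k \<theta> \<psi>" "k \<ge> R" "E \<theta> u < \<epsilon>" "(tail \<psi> u)\<^sup>2 < \<epsilon>"
proof -
  note U = H01_gradD[OF H01_wgrad[OF u]]
  note [measurable] = U(1,2) a_meas
  have "\<exists>\<theta> \<psi>. truncation (R + real n) \<theta> \<psi>" for n
    using truncation_exists[of "R + real n"] R_pos by (metis add_pos_nonneg of_nat_0_le_iff)
  then obtain \<theta> \<psi> where T: "\<And>n. truncation (R + real n) (\<theta> n) (\<psi> n)" by metis
  have k: "R + real n > 0" for n using R_pos by simp
  have [measurable]: "\<theta> n \<in> borel_measurable borel" "\<psi> n \<in> borel_measurable borel" for n
    using truncationD(5,6)[OF T k] by (auto intro: borel_measurable_continuous_onI)
  have ev: "eventually (\<lambda>n. \<theta> n s = s \<and> \<psi> n s = 1) sequentially" for s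
  proof (rule eventually_sequentiallyI[of "nat \<lceil>\<bar>s\<bar>\<rceil>"])
    fix n assume "n \<ge> nat \<lceil>\<bar>s\<bar>\<rceil>"
    then have "\<bar>s\<bar> \<le> R + real n" using R_pos by linarith
    then show "\<theta> n s = s \<and> \<psi> n s = 1" by (rule truncation_props(3)[OF T k])
  qed
  have "(\<lambda>n. E (\<theta> n) u) \<longlonglongrightarrow> (\<integral>x. 0 \<partial>M)"
    unfolding E_def
  proof (rule integral_dominated_convergence)
    show "integrable M (\<lambda>x. a x powr (p / (p - 1)) + 2 * \<bar>u x\<bar> powr p)"
      using a_int H01_grad_Sobolev(1)[OF H01_wgrad[OF u]] by simp
    show "AE x in M. (\<lambda>n. \<bar>u x - \<theta> n (u x)\<bar> * (a x + \<bar>u x\<bar> powr (p - 1))) \<longlonglongrightarrow> 0"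
    proof (rule AE_I2)
      fix x
      show "(\<lambda>n. \<bar>u x - \<theta> n (u x)\<bar> * (a x + \<bar>u x\<bar> powr (p - 1))) \<longlonglongrightarrow> 0"
        by (rule tendsto_eventually[OF eventually_mono[OF ev[of "u x"]]]) simp
    qed
    show "AE x in M. norm (\<bar>u x - \<theta> n (u x)\<bar> * (a x + \<bar>u x\<bar> powr (p - 1))) \<le> a x powr (p / (p - 1)) + 2 * \<bar>u x\<bar> powr p" for n
      unfolding real_norm_def by (intro AE_I2 E_integrand_bound[OF T k]) simp
  qed measurable
  moreover have "(\<lambda>n. (tail (\<psi> n) u)\<^sup>2) \<longlonglongrightarrow> (\<integral>x. 0 \<partial>M)"
    unfolding tail_square
  proof (rule integral_dominated_convergence[OF _ _ U(4)])
    show "AE x in M. (\<lambda>n. (norm ((1 - \<psi> n (u x)) *\<^sub>R wgrad \<Omega> u x))\<^sup>2) \<longlonglongrightarrow> 0"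
    proof (rule AE_I2)
      fix x
      show "(\<lambda>n. (norm ((1 - \<psi> n (u x)) *\<^sub>R wgrad \<Omega> u x))\<^sup>2) \<longlonglongrightarrow> 0"
        by (rule tendsto_eventually[OF eventually_mono[OF ev[of "u x"]]]) simp
    qed
    show "AE x in M. norm ((norm ((1 - \<psi> n (u x)) *\<^sub>R wgrad \<Omega> u x))\<^sup>2) \<le> (norm (wgrad \<Omega> u x))\<^sup>2" for n
      using tail_bound[OF T k] by (auto simp del: norm_scaleR)
  qed measurable
  ultimately have "eventually (\<lambda>n. E (\<theta> n) u < \<epsilon> \<and> (tail (\<psi> n) u)\<^sup>2 < \<epsilon>) sequentially"
    using \<epsilon> by (intro eventually_conj order_tendstoD(2)) auto
  then obtain n where "E (\<theta> n) u < \<epsilon>" "(tail (\<psi> n) u)\<^sup>2 < \<epsilon>"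
    by (auto simp: eventually_sequentially)
  then show thesis using that[OF T[of n]] by simp
qed

text \<open>At \<open>u\<close> itself the truncated energy is at most J(u), which is finite, so up
  to small terms the expression is at most f(u) = c. Continuity extends the bound to a
  neighbourhood, on which \<open>f\<close> need not be bounded above.\<close>

lemma near_point:
  assumes u: "u \<in> H01 \<Omega>" and fu: "f u = ereal c" and \<kappa>: "\<kappa> > 0"
  obtains k \<theta> \<psi> \<rho> where "truncation k \<theta> \<psi>" "k \<ge> R" "\<rho> > 0"
    "\<And>w. w \<in> H01 \<Omega> \<Longrightarrow> H01_dist \<Omega> w u < \<rho> \<Longrightarrow> tail \<psi> w \<le> \<kappa> \<and>
       K \<psi> w - \<Gamma> w - \<Lambda> w + E \<theta> w + C\<^sub>0 * tail \<psi> w \<le> c + \<kappa>"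
proof -
  \<comment> \<open>\<open>\<tau>\<close> bounds \<open>tail\<close> near \<open>u\<close> in such a
    way that \<open>C\<^sub>0 * \<tau>\<close> uses up at most half of \<kappa>; the
    \<open>+ 1\<close> covers the case \<open>C\<^sub>0 = 0\<close>.\<close>
  define \<tau> where "\<tau> = min \<kappa> (\<kappa> / (2 * (C\<^sub>0 + 1)))"
  have \<tau>: "\<tau> > 0" "\<tau> \<le> \<kappa>" "C\<^sub>0 * \<tau> \<le> \<kappa> / 2"
  proof -
    show "\<tau> > 0" "\<tau> \<le> \<kappa>" using \<kappa> C\<^sub>0 by (auto simp: \<tau>_def)
    have "C\<^sub>0 * \<tau> \<le> C\<^sub>0 * (\<kappa> / (2 * (C\<^sub>0 + 1)))" using C\<^sub>0 by (intro mult_left_mono) (auto simp: \<tau>_def)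
    also have "\<dots> \<le> \<kappa> / 2" using C\<^sub>0 \<kappa> by (simp add: field_simps)
    finally show "C\<^sub>0 * \<tau> \<le> \<kappa> / 2" .
  qed
  \<comment> \<open>Five errors of size \<epsilon> fit into the other half of \<kappa>: the
    oscillations of K, \<Gamma>, \<Lambda> and E, and the value of E at \<open>u\<close>. The second
    bound is due to the square of \<open>tail\<close>, which is below \<epsilon> at \<open>u\<close>
    and changes by less than \<epsilon>.\<close>
  define \<epsilon> where "\<epsilon> = min (\<kappa> / 10) (\<tau>\<^sup>2 / 2)"
  have \<epsilon>: "\<epsilon> > 0" "5 * \<epsilon> \<le> \<kappa> / 2" "2 * \<epsilon> \<le> \<tau>\<^sup>2" using \<kappa> \<tau> by (auto simp: \<epsilon>_def)
  obtain k \<theta> \<psi> where T: "truncation k \<theta> \<psi>" "k \<ge> R" and Eu: "E \<theta> u < \<epsilon>" and tu: "(tail \<psi> u)\<^sup>2 < \<epsilon>"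
    using good_truncation[OF u \<epsilon>(1)] by metis
  have k: "k > 0" using T R_pos by simp
  obtain r where r: "r \<ge> 0" "J u = ennreal r" "f u = ereal (r - \<Gamma> u - \<Lambda> u)"
    using f_eqI[of u c] fu by auto
  have Kr: "K \<psi> u \<le> r"
  proof -
    have "ennreal (K \<psi> u) = (\<integral>\<^sup>+x. ennreal (\<psi> (u x) * j x (u x) (wgrad \<Omega> u x)) \<partial>M)"
      unfolding K_def
      by (rule nn_integral_eq_integral[OF K_integrable[OF T(1) k u], symmetric])
         (use K_bound(1)[OF T(1) k] in auto)
    also have "\<dots> \<le> J u"
      unfolding J_def
    proof (intro nn_integral_mono ennreal_leI)
      fix x assume "x \<in> space M"
      then show "\<psi> (u x) * j x (u x) (wgrad \<Omega> u x) \<le> j x (u x) (wgrad \<Omega> u x)"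
        using j_nonneg truncationD(3,4)[OF T(1) k] by (intro mult_left_le_one_le) auto
    qed
    finally show ?thesis using r by (simp add: ennreal_le_iff)
  qed
  obtain \<rho>1 where 1: "\<rho>1 > 0" "\<And>v. v \<in> H01 \<Omega> \<Longrightarrow> H01_dist \<Omega> v u < \<rho>1 \<Longrightarrow> \<bar>K \<psi> v - K \<psi> u\<bar> < \<epsilon>"
    using K_continuous[OF T(1) k u \<epsilon>(1)] by metis
  obtain \<rho>2 where 2: "\<rho>2 > 0" "\<And>v. v \<in> H01 \<Omega> \<Longrightarrow> H01_dist \<Omega> v u < \<rho>2 \<Longrightarrow> \<bar>\<Gamma> v - \<Gamma> u\<bar> < \<epsilon>"
    using \<Gamma>_continuous[OF u \<epsilon>(1)] by metis
  obtain \<rho>3 where 3: "\<rho>3 > 0" "\<And>v. v \<in> H01 \<Omega> \<Longrightarrow> H01_dist \<Omega> v u < \<rho>3 \<Longrightarrow> \<bar>\<Lambda> v - \<Lambda> u\<bar> < \<epsilon>"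
    using \<Lambda>_continuous[OF u \<epsilon>(1)] by metis
  obtain \<rho>4 where 4: "\<rho>4 > 0" "\<And>v. v \<in> H01 \<Omega> \<Longrightarrow> H01_dist \<Omega> v u < \<rho>4 \<Longrightarrow> \<bar>E \<theta> v - E \<theta> u\<bar> < \<epsilon>"
    using E_continuous[OF T(1) k u \<epsilon>(1)] by metis
  obtain \<rho>5 where 5: "\<rho>5 > 0" "\<And>v. v \<in> H01 \<Omega> \<Longrightarrow> H01_dist \<Omega> v u < \<rho>5 \<Longrightarrow> \<bar>(tail \<psi> v)\<^sup>2 - (tail \<psi> u)\<^sup>2\<bar> < \<epsilon>"
    using tail_continuous[OF T(1) k u \<epsilon>(1)] by metis
  define \<rho> where "\<rho> = min \<rho>1 (min \<rho>2 (min \<rho>3 (min \<rho>4 \<rho>5)))"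
  show thesis
  proof (rule that[OF T, of \<rho>])
    show "\<rho> > 0" using 1 2 3 4 5 by (simp add: \<rho>_def)
    fix w assume w: "w \<in> H01 \<Omega>" and d: "H01_dist \<Omega> w u < \<rho>"
    have d': "H01_dist \<Omega> w u < \<rho>1" "H01_dist \<Omega> w u < \<rho>2" "H01_dist \<Omega> w u < \<rho>3" "H01_dist \<Omega> w u < \<rho>4" "H01_dist \<Omega> w u < \<rho>5"
      using d by (auto simp: \<rho>_def)
    have "(tail \<psi> w)\<^sup>2 \<le> \<tau>\<^sup>2" using 5(2)[OF w d'(5)] tu \<epsilon>(3) by linarith
    then have t: "tail \<psi> w \<le> \<tau>" using \<tau>(1) by (rule power2_le_imp_le[OF _ less_imp_le])
    then have "C\<^sub>0 * tail \<psi> w \<le> \<kappa> / 2" using mult_left_mono[OF t C\<^sub>0] \<tau>(3) by linarith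
    moreover have "c = r - \<Gamma> u - \<Lambda> u" using r fu by simp
    ultimately show "tail \<psi> w \<le> \<kappa> \<and> K \<psi> w - \<Gamma> w - \<Lambda> w + E \<theta> w + C\<^sub>0 * tail \<psi> w \<le> c + \<kappa>"
      using 1(2)[OF w d'(1)] 2(2)[OF w d'(2)] 3(2)[OF w d'(3)] 4(2)[OF w d'(4)] Kr Eu \<epsilon>(2) t \<tau>(2)
      by (auto simp: abs_less_iff)
  qed
qed

text \<open>Continuity at \<open>u\<close> of composition with \<theta>. The integrand measures the
  distance to the truncated gradient frozen at \<open>u\<close>, so the associated functional
  vanishes at \<open>u\<close>.\<close>

lemma truncation_continuous:
  assumes T: "truncation k \<theta> \<psi>" "k > 0" and u: "u \<in> H01 \<Omega>" and \<epsilon>: "\<epsilon> > 0"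
  obtains \<rho> where "\<rho> > 0" "\<And>v. v \<in> H01 \<Omega> \<Longrightarrow> H01_dist \<Omega> v u < \<rho> \<Longrightarrow>
    (\<integral>x. (norm (\<psi> (v x) *\<^sub>R wgrad \<Omega> v x - \<psi> (u x) *\<^sub>R wgrad \<Omega> u x))\<^sup>2 \<partial>M) < \<epsilon>"
proof -
  note U = H01_gradD[OF H01_wgrad[OF u]] and D = truncationD[OF T]
  note [measurable] = U(1,2)
  have [measurable]: "\<psi> \<in> borel_measurable borel" using D(5) by (rule borel_measurable_continuous_onI)
  let ?F = "\<lambda>x z. (norm (\<psi> (fst z) *\<^sub>R snd z - \<psi> (u x) *\<^sub>R wgrad \<Omega> u x))\<^sup>2"
  have \<psi>le: "(norm (\<psi> s *\<^sub>R \<xi>))\<^sup>2 \<le> (norm \<xi>)\<^sup>2" for s and \<xi> :: 'a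
    using D(3,4)[of s] by (auto intro!: power_mono mult_left_le_one_le)
  have c: "continuous_on UNIV (?F x)" for x
    by (intro continuous_intros continuous_on_compose2[OF D(5)]) auto
  have b: "\<bar>?F x (s, \<xi>)\<bar> \<le> 2 * (norm (wgrad \<Omega> u x))\<^sup>2 + 2 * \<bar>s\<bar> powr p + 2 * (norm \<xi>)\<^sup>2" for x s \<xi>
  proof -
    have "?F x (s, \<xi>) \<le> 2 * (norm (\<psi> s *\<^sub>R \<xi>))\<^sup>2 + 2 * (norm (\<psi> (u x) *\<^sub>R wgrad \<Omega> u x))\<^sup>2"
      using norm_add_square_le[of "\<psi> s *\<^sub>R \<xi>" "- (\<psi> (u x) *\<^sub>R wgrad \<Omega> u x)"] by simp
    also have "\<dots> \<le> 2 * (norm \<xi>)\<^sup>2 + 2 * (norm (wgrad \<Omega> u x))\<^sup>2"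
      using \<psi>le by (intro add_mono mult_left_mono) auto
    also have "\<dots> \<le> 2 * (norm (wgrad \<Omega> u x))\<^sup>2 + 2 * \<bar>s\<bar> powr p + 2 * (norm \<xi>)\<^sup>2" by simp
    finally show ?thesis by simp
  qed
  have m: "(\<lambda>x. ?F x z) \<in> borel_measurable M" for z by measurable
  have i: "integrable M (\<lambda>x. 2 * (norm (wgrad \<Omega> u x))\<^sup>2)" using U by simp
  obtain \<rho> where "\<rho> > 0" and \<rho>: "\<And>v. v \<in> H01 \<Omega> \<Longrightarrow> H01_dist \<Omega> v u < \<rho> \<Longrightarrow>
      \<bar>(\<integral>x. ?F x (v x, wgrad \<Omega> v x) \<partial>M) - (\<integral>x. ?F x (u x, wgrad \<Omega> u x) \<partial>M)\<bar> < \<epsilon>"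
    by (rule H01_functional_continuous[where F = ?F and C = 2, OF u _ i m c b \<epsilon>]) (simp, blast)
  then show thesis using that[of \<rho>] by simp
qed

lemma deform_continuous:
  assumes T: "truncation k \<theta> \<psi>" "k > 0" and w: "w \<in> H01 \<Omega>" and \<epsilon>: "\<epsilon> > 0"
  obtains \<rho> where "\<rho> > 0" "\<And>w' s' s. w' \<in> H01 \<Omega> \<Longrightarrow> H01_dist \<Omega> w' w < \<rho> \<Longrightarrow> 0 \<le> s' \<Longrightarrow> s' \<le> 1 \<Longrightarrow>
     \<bar>s' - s\<bar> < \<rho> \<Longrightarrow> H01_dist \<Omega> (deform \<theta> w' s') (deform \<theta> w s) < \<epsilon>"
proof -
  define A where "A = tail \<psi> w"
  have A0: "A \<ge> 0" by (simp add: A_def tail_nonneg)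
  have \<epsilon>2: "\<epsilon>\<^sup>2 / 16 > 0" using \<epsilon> by simp
  obtain \<rho>1 where \<rho>1: "\<rho>1 > 0" "\<And>v. v \<in> H01 \<Omega> \<Longrightarrow> H01_dist \<Omega> v w < \<rho>1 \<Longrightarrow>
    (\<integral>x. (norm (\<psi> (v x) *\<^sub>R wgrad \<Omega> v x - \<psi> (w x) *\<^sub>R wgrad \<Omega> w x))\<^sup>2 \<partial>M) < \<epsilon>\<^sup>2 / 16"
    by (rule truncation_continuous[OF T w \<epsilon>2]) blast
  \<comment> \<open>With these bounds the three terms of the final estimate contribute 4/16, 4/16
    and 2/16 of the square of \<epsilon>. The \<open>+ 1\<close> guards against
    \<open>A = 0\<close>.\<close>
  define \<rho> where "\<rho> = min \<rho>1 (min (\<epsilon> / 4) (\<epsilon> / (4 * (A + 1))))"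
  have \<rho>: "\<rho> > 0" "\<rho> \<le> \<rho>1" "\<rho> \<le> \<epsilon> / 4" "\<rho> * A \<le> \<epsilon> / 4"
  proof -
    show "\<rho> > 0" using \<rho>1(1) \<epsilon> A0 by (simp add: \<rho>_def)
    show "\<rho> \<le> \<rho>1" "\<rho> \<le> \<epsilon> / 4"
      unfolding \<rho>_def by (rule min.cobounded1, rule min.coboundedI2[OF min.cobounded1])
    have "\<rho> * A \<le> (\<epsilon> / (4 * (A + 1))) * A" using A0 by (intro mult_right_mono) (auto simp: \<rho>_def)
    also have "\<dots> \<le> \<epsilon> / 4" using A0 \<epsilon> by (simp add: field_simps)
    finally show "\<rho> * A \<le> \<epsilon> / 4" .
  qed
  show thesis
  proof (rule that[OF \<rho>(1)])
    fix w' s' s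
    assume w': "w' \<in> H01 \<Omega>" and d: "H01_dist \<Omega> w' w < \<rho>" and s': "0 \<le> s'" "s' \<le> 1" and ss: "\<bar>s' - s\<bar> < \<rho>"
    note H = H01_wgrad[OF w] and H' = H01_wgrad[OF w']
    note HT = H01_gradD[OF H01_grad_truncation[OF T H]] and HT' = H01_gradD[OF H01_grad_truncation[OF T H']]
    note V = H01_gradD[OF H] and V' = H01_gradD[OF H']
    define a1 where "a1 x = wgrad \<Omega> w' x - wgrad \<Omega> w x" for x
    define a2 where "a2 x = \<psi> (w' x) *\<^sub>R wgrad \<Omega> w' x - \<psi> (w x) *\<^sub>R wgrad \<Omega> w x" for x
    define a3 where "a3 x = (1 - \<psi> (w x)) *\<^sub>R wgrad \<Omega> w x" for x
    have a3: "a3 x = wgrad \<Omega> w x - \<psi> (w x) *\<^sub>R wgrad \<Omega> w x" for x by (simp add: a3_def algebra_simps)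
    have I1: "integrable M (\<lambda>x. (norm (a1 x))\<^sup>2)"
      unfolding a1_def by (rule integrable_norm_diff_square) (use V V' in auto)
    have I2: "integrable M (\<lambda>x. (norm (a2 x))\<^sup>2)"
      unfolding a2_def by (rule integrable_norm_diff_square[OF HT'(2) HT(2) HT'(4) HT(4)])
    have I3: "integrable M (\<lambda>x. (norm (a3 x))\<^sup>2)"
      unfolding a3 by (rule integrable_norm_diff_square[OF V(2) HT(2) V(4) HT(4)])
    \<comment> \<open>The change of the gradient is split into the effects of moving
      \<open>w\<close>, of moving its truncation, and of changing s. The last one multiplies a
      gradient fixed at \<open>w\<close>, whose norm is \<open>A\<close>.\<close>
    have e: "(1 + s' * (\<psi> (w' x) - 1)) *\<^sub>R wgrad \<Omega> w' x - (1 + s * (\<psi> (w x) - 1)) *\<^sub>R wgrad \<Omega> w x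
        = (1 - s') *\<^sub>R a1 x + s' *\<^sub>R a2 x + (s - s') *\<^sub>R a3 x" for x
      by (simp add: a1_def a2_def a3_def algebra_simps)
    have "(H01_dist \<Omega> (deform \<theta> w' s') (deform \<theta> w s))\<^sup>2
        = (\<integral>x. (norm ((1 - s') *\<^sub>R a1 x + s' *\<^sub>R a2 x + (s - s') *\<^sub>R a3 x))\<^sup>2 \<partial>M)"
      unfolding H01_dist_eq[OF deform_grad[OF T w'] deform_grad[OF T w]] e by simp
    also have "\<dots> \<le> (\<integral>x. 4 * (norm (a1 x))\<^sup>2 + 4 * (norm (a2 x))\<^sup>2 + 2 * (s - s')\<^sup>2 * (norm (a3 x))\<^sup>2 \<partial>M)"
    proof (rule integral_mono')
      show "integrable M (\<lambda>x. 4 * (norm (a1 x))\<^sup>2 + 4 * (norm (a2 x))\<^sup>2 + 2 * (s - s')\<^sup>2 * (norm (a3 x))\<^sup>2)"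
        using I1 I2 I3 by simp
      fix x
      have "(norm ((1 - s') *\<^sub>R a1 x + s' *\<^sub>R a2 x + (s - s') *\<^sub>R a3 x))\<^sup>2
         \<le> 4 * (norm ((1 - s') *\<^sub>R a1 x))\<^sup>2 + 4 * (norm (s' *\<^sub>R a2 x))\<^sup>2 + 2 * (norm ((s - s') *\<^sub>R a3 x))\<^sup>2"
        by (rule norm_add3_square_le)
      also have "\<dots> \<le> 4 * (norm (a1 x))\<^sup>2 + 4 * (norm (a2 x))\<^sup>2 + 2 * ((s - s')\<^sup>2 * (norm (a3 x))\<^sup>2)"
        using s' by (intro add_mono mult_left_mono power_mono)
          (auto simp: power_mult_distrib intro!: mult_left_le_one_le)
      finally show "(norm ((1 - s') *\<^sub>R a1 x + s' *\<^sub>R a2 x + (s - s') *\<^sub>R a3 x))\<^sup>2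
         \<le> 4 * (norm (a1 x))\<^sup>2 + 4 * (norm (a2 x))\<^sup>2 + 2 * (s - s')\<^sup>2 * (norm (a3 x))\<^sup>2" by simp
    qed auto
    also have "\<dots> = 4 * (\<integral>x. (norm (a1 x))\<^sup>2 \<partial>M) + 4 * (\<integral>x. (norm (a2 x))\<^sup>2 \<partial>M) + 2 * (s - s')\<^sup>2 * (\<integral>x. (norm (a3 x))\<^sup>2 \<partial>M)"
      using I1 I2 I3 by simp
    also have "(\<integral>x. (norm (a1 x))\<^sup>2 \<partial>M) = (H01_dist \<Omega> w' w)\<^sup>2"
      unfolding H01_dist_eq[OF H' H] a1_def by simp
    also have "(\<integral>x. (norm (a3 x))\<^sup>2 \<partial>M) = A\<^sup>2" unfolding A_def tail_square a3_def ..
    also have "4 * (H01_dist \<Omega> w' w)\<^sup>2 + 4 * (\<integral>x. (norm (a2 x))\<^sup>2 \<partial>M) + 2 * (s - s')\<^sup>2 * A\<^sup>2 < \<epsilon>\<^sup>2"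
    proof -
      have "0 \<le> H01_dist \<Omega> w' w" unfolding H01_dist_eq[OF H' H] by simp
      then have "(H01_dist \<Omega> w' w)\<^sup>2 \<le> (\<epsilon> / 4)\<^sup>2" using d \<rho>(3) by (intro power_mono) auto
      moreover have "(\<integral>x. (norm (a2 x))\<^sup>2 \<partial>M) < \<epsilon>\<^sup>2 / 16"
        unfolding a2_def using \<rho>1(2)[OF w'] d \<rho>(2) by simp
      moreover have "(s - s')\<^sup>2 * A\<^sup>2 \<le> (\<epsilon> / 4)\<^sup>2"
      proof -
        have "\<bar>s - s'\<bar> * A \<le> \<rho> * A" using ss A0 by (intro mult_right_mono) auto
        also have "\<dots> \<le> \<epsilon> / 4" by (rule \<rho>(4))
        finally have "(\<bar>s - s'\<bar> * A)\<^sup>2 \<le> (\<epsilon> / 4)\<^sup>2" using A0 by (intro power_mono) auto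
        then show ?thesis by (simp add: power_mult_distrib)
      qed
      ultimately have "4 * (H01_dist \<Omega> w' w)\<^sup>2 + 4 * (\<integral>x. (norm (a2 x))\<^sup>2 \<partial>M) + 2 * ((s - s')\<^sup>2 * A\<^sup>2)
          < 4 * (\<epsilon> / 4)\<^sup>2 + 4 * (\<epsilon>\<^sup>2 / 16) + 2 * (\<epsilon> / 4)\<^sup>2" by linarith
      also have "\<dots> \<le> \<epsilon>\<^sup>2" by (simp add: power_divide)
      finally show ?thesis by (simp add: mult_ac)
    qed
    finally show "H01_dist \<Omega> (deform \<theta> w' s') (deform \<theta> w s) < \<epsilon>"
      using \<epsilon> by (simp add: power_less_imp_less_base)
  qed
qed

end

section \<open>Weak slopes of epigraph functions\<close>

context critical_functional
begin

lemma H01_dist_nonneg: "u \<in> H01 \<Omega> \<Longrightarrow> v \<in> H01 \<Omega> \<Longrightarrow> 0 \<le> H01_dist \<Omega> u v"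
  using H01_dist_eq[OF H01_wgrad H01_wgrad] by simp

text \<open>The function is moved by \<open>deform\<close> and the level is lowered at constant
  speed \<sigma>. Near (u, \<eta>) the bound for \<open>f\<close> decreases in s at a rate of at
  least e, so the deformed point remains in the epigraph, and the smallness of \<open>tail\<close>
  keeps the total speed at most 1.\<close>

lemma epi_deformation:
  assumes u: "u \<in> H01 \<Omega>" and fu: "f u < ereal \<eta>" and \<sigma>: "0 < \<sigma>" "\<sigma> < 1"
  obtains \<delta> H where "\<delta> > 0"
    "cont_deform (epi_dist (H01_dist \<Omega>)) {z\<in>epi (H01 \<Omega>) f. epi_dist (H01_dist \<Omega>) z (u, \<eta>) < \<delta>} \<delta> H"
    "\<forall>z\<in>epi (H01 \<Omega>) f. epi_dist (H01_dist \<Omega>) z (u, \<eta>) < \<delta> \<longrightarrow> (\<forall>t\<in>{0..\<delta>}.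
       H z t \<in> epi (H01 \<Omega>) f \<and> epi_dist (H01_dist \<Omega>) (H z t) z \<le> t \<and> snd (H z t) \<le> snd z - \<sigma> * t)"
    "\<forall>w \<mu> t. fst (H (\<lambda>x. - w x, \<mu>) t) = (\<lambda>x. - fst (H (w, \<mu>) t) x)"
proof -
  let ?d = "H01_dist \<Omega>"
  obtain c where c: "f u = ereal c"
    using f_eqI[of u \<eta>] fu by (metis less_imp_le)
  \<comment> \<open>Half of the gap is the guaranteed rate of descent in s; the other half absorbs
    the error \<kappa> and the variation of the level, each at most e / 2.\<close>
  define e where "e = (\<eta> - c) / 2"
  have e: "e > 0" using fu c by (simp add: e_def)
  \<comment> \<open>The second bound makes the horizontal displacement at most \<sigma> t sqrt(1 -
    \<sigma>^2). Its square and that of the vertical displacement \<sigma> t add up to at most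
    t^2.\<close>
  define \<kappa> where "\<kappa> = min (e / 2) (e * sqrt (1 - \<sigma>\<^sup>2))"
  have \<sigma>2: "\<sigma>\<^sup>2 < 1" using \<sigma> by (simp add: power_less_one_iff)
  have \<kappa>: "\<kappa> > 0" "\<kappa> \<le> e / 2" "\<kappa> \<le> e * sqrt (1 - \<sigma>\<^sup>2)" using e \<sigma>2 by (auto simp: \<kappa>_def)
  obtain k \<theta> \<psi> \<rho> where T: "truncation k \<theta> \<psi>" "k \<ge> R" and \<rho>: "\<rho> > 0"
    and near: "\<And>w. w \<in> H01 \<Omega> \<Longrightarrow> ?d w u < \<rho> \<Longrightarrow> tail \<psi> w \<le> \<kappa> \<and>
       K \<psi> w - \<Gamma> w - \<Lambda> w + E \<theta> w + C\<^sub>0 * tail \<psi> w \<le> c + \<kappa>"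
    by (rule near_point[OF u c \<kappa>(1)]) blast
  have k: "k > 0" using T R_pos by simp
  \<comment> \<open>Being at most e / 2, \<open>\<delta>\<close> controls the level as required
    above and also keeps s = \<sigma> t / e in [0, 1].\<close>
  define \<delta> where "\<delta> = min \<rho> (e / 2)"
  define H where "H z t = (deform \<theta> (fst z) (\<sigma> * t / e), snd z - \<sigma> * t)" for z :: "('a \<Rightarrow> real) \<times> real" and t :: real
  have \<delta>: "\<delta> > 0" "\<delta> \<le> \<rho>" "\<delta> \<le> e / 2" using \<rho> e by (auto simp: \<delta>_def)
  have s01: "0 \<le> \<sigma> * t / e" "\<sigma> * t / e \<le> 1" if "t \<in> {0..\<delta>}" for t
  proof -
    show "0 \<le> \<sigma> * t / e" using that \<sigma> e by simp
    have "\<sigma> * t \<le> 1 * t" using that \<sigma> by (intro mult_right_mono) auto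
    then show "\<sigma> * t / e \<le> 1" using that \<delta> e by simp
  qed
  have comp: "\<bar>?d (fst z) (fst z')\<bar> \<le> epi_dist ?d z z'" "\<bar>snd z - snd z'\<bar> \<le> epi_dist ?d z z'" for z z'
    unfolding epi_dist_def by (simp_all add: real_le_rsqrt)
  have good: "H z t \<in> epi (H01 \<Omega>) f \<and> epi_dist ?d (H z t) z \<le> t \<and> snd (H z t) \<le> snd z - \<sigma> * t"
    if z: "z \<in> epi (H01 \<Omega>) f" "epi_dist ?d z (u, \<eta>) < \<delta>" and t: "t \<in> {0..\<delta>}" for z t
  proof -
    obtain w \<mu> where zw: "z = (w, \<mu>)" by (cases z)
    have w: "w \<in> H01 \<Omega>" "f w \<le> ereal \<mu>" using z zw by (auto simp: epi_def)
    have "?d w u < \<rho>" "\<bar>\<mu> - \<eta>\<bar> < \<delta>"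
      using comp[of z "(u, \<eta>)"] z(2) \<delta>(2) zw by auto
    note n = near[OF w(1) this(1)]
    define s where "s = \<sigma> * t / e"
    have s: "0 \<le> s" "s \<le> 1" using s01[OF t] by (auto simp: s_def)
    define \<Phi> where "\<Phi> = K \<psi> w - \<Gamma> w - \<Lambda> w + E \<theta> w + C\<^sub>0 * tail \<psi> w"
    have "f (deform \<theta> w s) \<le> ereal (\<mu> - s * (\<mu> - \<Phi>))"
      unfolding \<Phi>_def by (rule f_deform_le[OF T w(1) s w(2)])
    also have "\<dots> \<le> ereal (\<mu> - \<sigma> * t)"
    proof -
      have "\<Phi> \<le> c + \<kappa>" "2 * e = \<eta> - c" using n by (simp_all add: \<Phi>_def e_def)
      then have "e \<le> \<mu> - \<Phi>" using \<open>\<bar>\<mu> - \<eta>\<bar> < \<delta>\<close> \<delta>(3) \<kappa>(2) by linarith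
      then have "s * e \<le> s * (\<mu> - \<Phi>)" using s by (intro mult_left_mono) auto
      moreover have "s * e = \<sigma> * t" using e by (simp add: s_def)
      ultimately show ?thesis by simp
    qed
    finally have 1: "H z t \<in> epi (H01 \<Omega>) f"
      using deform_in_H01[OF T(1) k w(1)] by (simp add: H_def zw epi_def s_def)
    have "(s * tail \<psi> w)\<^sup>2 + (\<sigma> * t)\<^sup>2 \<le> t\<^sup>2"
    proof -
      have "tail \<psi> w \<le> e * sqrt (1 - \<sigma>\<^sup>2)" using n \<kappa>(3) by linarith
      then have "s * tail \<psi> w \<le> s * (e * sqrt (1 - \<sigma>\<^sup>2))" using s by (intro mult_left_mono) auto
      also have "\<dots> = \<sigma> * t * sqrt (1 - \<sigma>\<^sup>2)" using e by (simp add: s_def)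
      finally have "(s * tail \<psi> w)\<^sup>2 \<le> (\<sigma> * t * sqrt (1 - \<sigma>\<^sup>2))\<^sup>2"
        using s tail_nonneg[of \<psi> w] by (intro power_mono) auto
      also have "\<dots> = \<sigma>\<^sup>2 * (t\<^sup>2 * (1 - \<sigma>\<^sup>2))" using \<sigma>2 by (simp add: power_mult_distrib)
      also have "\<dots> \<le> 1 * (t\<^sup>2 * (1 - \<sigma>\<^sup>2))" using \<sigma>2 by (intro mult_right_mono) auto
      finally show ?thesis by (simp add: power_mult_distrib algebra_simps)
    qed
    then have 2: "epi_dist ?d (H z t) z \<le> t"
      using deform_dist[OF T(1) k w(1) s(1)] t
      unfolding epi_dist_def by (intro real_le_lsqrt) (auto simp: H_def zw s_def)
    show ?thesis using 1 2 by (simp add: H_def)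
  qed
  have cont: "cont_deform (epi_dist ?d) {z\<in>epi (H01 \<Omega>) f. epi_dist ?d z (u, \<eta>) < \<delta>} \<delta> H"
    unfolding cont_deform_def
  proof (intro ballI allI impI)
    fix z t and \<epsilon> :: real
    assume z: "z \<in> {z\<in>epi (H01 \<Omega>) f. epi_dist ?d z (u, \<eta>) < \<delta>}" and t: "t \<in> {0..\<delta>}" and \<epsilon>: "\<epsilon> > 0"
    have w: "fst z \<in> H01 \<Omega>" using z by (auto simp: epi_def)
    have \<epsilon>2: "\<epsilon> / 2 > 0" using \<epsilon> by simp
    obtain r where r: "r > 0" "\<And>w' s' s. w' \<in> H01 \<Omega> \<Longrightarrow> ?d w' (fst z) < r \<Longrightarrow> 0 \<le> s' \<Longrightarrow> s' \<le> 1 \<Longrightarrow>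
       \<bar>s' - s\<bar> < r \<Longrightarrow> ?d (deform \<theta> w' s') (deform \<theta> (fst z) s) < \<epsilon> / 2"
      by (rule deform_continuous[OF T(1) k w \<epsilon>2]) blast
    define q where "q = min r (min (r * e) (\<epsilon> / 4))"
    have q: "q > 0" "q \<le> r" "q \<le> r * e" "q \<le> \<epsilon> / 4" using r(1) e \<epsilon> by (auto simp: q_def)
    show "\<exists>\<rho>>0. \<forall>z'\<in>{z\<in>epi (H01 \<Omega>) f. epi_dist ?d z (u, \<eta>) < \<delta>}. \<forall>t'\<in>{0..\<delta>}.
        epi_dist ?d z' z < \<rho> \<and> \<bar>t' - t\<bar> < \<rho> \<longrightarrow> epi_dist ?d (H z' t') (H z t) < \<epsilon>"
    proof (intro exI[of _ q] conjI ballI impI q)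
      fix z' t'
      assume z': "z' \<in> {z\<in>epi (H01 \<Omega>) f. epi_dist ?d z (u, \<eta>) < \<delta>}" and t': "t' \<in> {0..\<delta>}"
        and d: "epi_dist ?d z' z < q \<and> \<bar>t' - t\<bar> < q"
      have w': "fst z' \<in> H01 \<Omega>" using z' by (auto simp: epi_def)
      have dq: "?d (fst z') (fst z) < q" "\<bar>snd z' - snd z\<bar> < q" using comp[of z' z] d by auto
      have "\<bar>\<sigma> * t' / e - \<sigma> * t / e\<bar> = \<sigma> * \<bar>t' - t\<bar> / e"
        using \<sigma> e by (simp add: abs_mult flip: diff_divide_distrib right_diff_distrib)
      also have "\<dots> \<le> \<bar>t' - t\<bar> / e" using \<sigma> e by (intro divide_right_mono) (auto intro: mult_left_le_one_le)
      also have "\<dots> < r" using d q(3) e by (simp add: pos_divide_less_eq)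
      finally have "\<bar>\<sigma> * t' / e - \<sigma> * t / e\<bar> < r" .
      then have a: "?d (fst (H z' t')) (fst (H z t)) < \<epsilon> / 2"
        unfolding H_def fst_conv using dq(1) q(2) s01[OF t'] by (intro r(2) w') auto
      have b: "\<bar>snd (H z' t') - snd (H z t)\<bar> < \<epsilon> / 2"
      proof -
        have "\<bar>\<sigma> * t' - \<sigma> * t\<bar> \<le> \<bar>t' - t\<bar>"
          using \<sigma> by (simp add: abs_mult mult_left_le_one_le flip: right_diff_distrib)
        moreover have "snd (H z' t') - snd (H z t) = (snd z' - snd z) - (\<sigma> * t' - \<sigma> * t)" by (simp add: H_def)
        ultimately show ?thesis using dq(2) d q(4) by linarith
      qed
      have "0 \<le> ?d (fst (H z' t')) (fst (H z t))"
        using deform_in_H01[OF T(1) k] w w' by (intro H01_dist_nonneg) (auto simp: H_def)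
      then show "epi_dist ?d (H z' t') (H z t) < \<epsilon>"
        using a b sqrt_sum_squares_le_sum_abs[of "?d (fst (H z' t')) (fst (H z t))" "snd (H z' t') - snd (H z t)"]
        unfolding epi_dist_def by linarith
    qed
  qed
  have odd: "fst (H (\<lambda>x. - w x, \<mu>) t) = (\<lambda>x. - fst (H (w, \<mu>) t) x)" for w \<mu> t
    by (simp add: H_def deform_def[abs_def] truncation_props(7)[OF T(1) k] algebra_simps)
  show thesis by (rule that[OF \<delta>(1) cont]) (intro ballI allI impI good odd; assumption)+
qed

end

lemma ereal_Sup_eq_1:
  fixes S :: "ereal set"
  assumes "\<And>x. x \<in> S \<Longrightarrow> x \<le> 1" "\<And>\<sigma>. 0 < \<sigma> \<Longrightarrow> \<sigma> < 1 \<Longrightarrow> ereal \<sigma> \<in> S"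
  shows "Sup S = 1"
proof (rule antisym)
  show "Sup S \<le> 1" using assms(1) by (rule Sup_least)
  show "1 \<le> Sup S"
  proof (rule dense_le)
    fix y :: ereal assume y: "y < 1"
    show "y \<le> Sup S"
    proof (cases y)
      case (real r)
      \<comment> \<open>The lower bound 1/2 keeps \<sigma> positive when \<open>r\<close> is
        not.\<close>
      define \<sigma> where "\<sigma> = max r (1/2)"
      have "ereal \<sigma> \<in> S" using y real by (intro assms(2)) (auto simp: \<sigma>_def one_ereal_def)
      then have "ereal \<sigma> \<le> Sup S" by (rule Sup_upper)
      moreover have "y \<le> ereal \<sigma>" using real by (simp add: \<sigma>_def)
      ultimately show ?thesis by (rule order_trans[rotated])
    qed (use y in auto)
  qed
qed

text \<open>The second component is 1-Lipschitz for \<open>epi_dist\<close>, so the level cannot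
  drop by more than the distance travelled.\<close>

lemma epi_slope_le_1:
  assumes "\<delta> > 0" "epi_dist d y z \<le> \<delta>" "snd y \<le> snd z - \<sigma> * \<delta>"
  shows "\<sigma> \<le> 1"
proof -
  have "\<sigma> * \<delta> \<le> \<bar>snd y - snd z\<bar>" using assms(3) by linarith
  also have "\<dots> \<le> epi_dist d y z" unfolding epi_dist_def by (simp add: real_le_rsqrt)
  also have "\<dots> \<le> \<delta>" by (rule assms(2))
  finally show ?thesis using assms(1) by simp
qed

context critical_functional
begin

lemma epi_dist_self: "epi_dist (H01_dist \<Omega>) z z = 0"
  by (simp add: epi_dist_def H01_dist_def)

lemma weak_slope_epi_eq_1:
  assumes u: "u \<in> H01 \<Omega>" and fu: "f u < ereal \<eta>"
  shows "weak_slope (epi (H01 \<Omega>) f) (epi_dist (H01_dist \<Omega>)) snd (u, \<eta>) = 1"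
  unfolding weak_slope_def
proof (rule ereal_Sup_eq_1)
  let ?d = "epi_dist (H01_dist \<Omega>)" and ?Y = "epi (H01 \<Omega>) f"
  have uY: "(u, \<eta>) \<in> ?Y" using u fu by (simp add: epi_def)
  fix x assume "x \<in> {ereal \<sigma> |\<sigma>. \<sigma> \<ge> 0 \<and> (\<exists>\<delta>>0. \<exists>H. cont_deform ?d {z\<in>?Y. ?d z (u, \<eta>) < \<delta>} \<delta> H \<and>
        (\<forall>z\<in>?Y. ?d z (u, \<eta>) < \<delta> \<longrightarrow> (\<forall>t\<in>{0..\<delta>}. H z t \<in> ?Y \<and> ?d (H z t) z \<le> t \<and> snd (H z t) \<le> snd z - \<sigma> * t)))}"
  then obtain \<sigma> \<delta> H where *: "x = ereal \<sigma>" "\<sigma> \<ge> 0" "\<delta> > 0"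
    "\<And>z t. z \<in> ?Y \<Longrightarrow> ?d z (u, \<eta>) < \<delta> \<Longrightarrow> t \<in> {0..\<delta>} \<Longrightarrow> ?d (H z t) z \<le> t \<and> snd (H z t) \<le> snd z - \<sigma> * t"
    by blast
  \<comment> \<open>The bound results from following the centre \<open>(u, \<eta>)\<close> alone up
    to time \<delta>.\<close>
  have "\<sigma> \<le> 1"
    using *(4)[OF uY, of \<delta>] *(3) epi_dist_self by (intro epi_slope_le_1[OF *(3)]) auto
  then show "x \<le> 1" using * by simp
next
  let ?d = "epi_dist (H01_dist \<Omega>)" and ?Y = "epi (H01 \<Omega>) f"
  fix \<sigma> :: real assume \<sigma>: "0 < \<sigma>" "\<sigma> < 1"
  obtain \<delta> H where H: "\<delta> > 0" "cont_deform ?d {z\<in>?Y. ?d z (u, \<eta>) < \<delta>} \<delta> H"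
    "\<forall>z\<in>?Y. ?d z (u, \<eta>) < \<delta> \<longrightarrow> (\<forall>t\<in>{0..\<delta>}.
       H z t \<in> ?Y \<and> ?d (H z t) z \<le> t \<and> snd (H z t) \<le> snd z - \<sigma> * t)"
    by (rule epi_deformation[OF u fu \<sigma>])
  show "ereal \<sigma> \<in> {ereal \<sigma> |\<sigma>. \<sigma> \<ge> 0 \<and> (\<exists>\<delta>>0. \<exists>H. cont_deform ?d {z\<in>?Y. ?d z (u, \<eta>) < \<delta>} \<delta> H \<and>
        (\<forall>z\<in>?Y. ?d z (u, \<eta>) < \<delta> \<longrightarrow> (\<forall>t\<in>{0..\<delta>}. H z t \<in> ?Y \<and> ?d (H z t) z \<le> t \<and> snd (H z t) \<le> snd z - \<sigma> * t)))}"
    by (intro CollectI exI[of _ \<sigma>] conjI exI[of _ \<delta>] exI[of _ H] refl H less_imp_le[OF \<sigma>(1)])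
qed

lemma weak_slope_Z2_epi_eq_1:
  assumes f0: "f (\<lambda>x. 0) < ereal \<eta>"
  shows "weak_slope_Z2 (H01 \<Omega>) (H01_dist \<Omega>) f \<eta> = 1"
  unfolding weak_slope_Z2_def
proof (rule ereal_Sup_eq_1)
  let ?d = "epi_dist (H01_dist \<Omega>)" and ?Y = "epi (H01 \<Omega>) f"
  have z0: "(\<lambda>x. 0) \<in> H01 \<Omega>" by (rule H01_grad_imp_H01[OF H01_grad_0])
  have uY: "(\<lambda>x. 0, \<eta>) \<in> ?Y" using z0 f0 by (simp add: epi_def)
  {
    fix x assume "x \<in> {ereal \<sigma> |\<sigma>. \<sigma> \<ge> 0 \<and> (\<exists>\<delta>>0. \<exists>H. cont_deform ?d {p\<in>?Y. ?d p (\<lambda>x. 0, \<eta>) < \<delta>} \<delta> H \<and>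
        (\<forall>p\<in>?Y. ?d p (\<lambda>x. 0, \<eta>) < \<delta> \<longrightarrow> (\<forall>t\<in>{0..\<delta>}. H p t \<in> ?Y \<and> ?d (H p t) p \<le> t \<and> snd (H p t) \<le> snd p - \<sigma> * t)) \<and>
        (\<forall>w \<mu>. (w, \<mu>) \<in> ?Y \<and> ?d (w, \<mu>) (\<lambda>x. 0, \<eta>) < \<delta> \<and> (\<lambda>x. - w x, \<mu>) \<in> ?Y \<and> ?d (\<lambda>x. - w x, \<mu>) (\<lambda>x. 0, \<eta>) < \<delta> \<longrightarrow>
           (\<forall>t\<in>{0..\<delta>}. H01_dist \<Omega> (fst (H (\<lambda>x. - w x, \<mu>) t)) (\<lambda>x. - fst (H (w, \<mu>) t) x) = 0)))}"
    then obtain \<sigma> \<delta> H where *: "x = ereal \<sigma>" "\<sigma> \<ge> 0" "\<delta> > 0"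
      "\<And>z t. z \<in> ?Y \<Longrightarrow> ?d z (\<lambda>x. 0, \<eta>) < \<delta> \<Longrightarrow> t \<in> {0..\<delta>} \<Longrightarrow> ?d (H z t) z \<le> t \<and> snd (H z t) \<le> snd z - \<sigma> * t"
      by blast
    have "\<sigma> \<le> 1"
      using *(4)[OF uY, of \<delta>] *(3) epi_dist_self by (intro epi_slope_le_1[OF *(3)]) auto
    then show "x \<le> 1" using * by simp
  next
    fix \<sigma> :: real assume \<sigma>: "0 < \<sigma>" "\<sigma> < 1"
    obtain \<delta> H where H: "\<delta> > 0" "cont_deform ?d {z\<in>?Y. ?d z (\<lambda>x. 0, \<eta>) < \<delta>} \<delta> H"
      "\<forall>z\<in>?Y. ?d z (\<lambda>x. 0, \<eta>) < \<delta> \<longrightarrow> (\<forall>t\<in>{0..\<delta>}.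
         H z t \<in> ?Y \<and> ?d (H z t) z \<le> t \<and> snd (H z t) \<le> snd z - \<sigma> * t)"
      "\<forall>w \<mu> t. fst (H (\<lambda>x. - w x, \<mu>) t) = (\<lambda>x. - fst (H (w, \<mu>) t) x)"
      by (rule epi_deformation[OF z0 f0 \<sigma>])
    have odd: "H01_dist \<Omega> (fst (H (\<lambda>x. - w x, \<mu>) t)) (\<lambda>x. - fst (H (w, \<mu>) t) x) = 0" for w \<mu> t
      using H(4) by (simp add: H01_dist_def)
    show "ereal \<sigma> \<in> {ereal \<sigma> |\<sigma>. \<sigma> \<ge> 0 \<and> (\<exists>\<delta>>0. \<exists>H. cont_deform ?d {p\<in>?Y. ?d p (\<lambda>x. 0, \<eta>) < \<delta>} \<delta> H \<and>
        (\<forall>p\<in>?Y. ?d p (\<lambda>x. 0, \<eta>) < \<delta> \<longrightarrow> (\<forall>t\<in>{0..\<delta>}. H p t \<in> ?Y \<and> ?d (H p t) p \<le> t \<and> snd (H p t) \<le> snd p - \<sigma> * t)) \<and>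
        (\<forall>w \<mu>. (w, \<mu>) \<in> ?Y \<and> ?d (w, \<mu>) (\<lambda>x. 0, \<eta>) < \<delta> \<and> (\<lambda>x. - w x, \<mu>) \<in> ?Y \<and> ?d (\<lambda>x. - w x, \<mu>) (\<lambda>x. 0, \<eta>) < \<delta> \<longrightarrow>
           (\<forall>t\<in>{0..\<delta>}. H01_dist \<Omega> (fst (H (\<lambda>x. - w x, \<mu>) t)) (\<lambda>x. - fst (H (w, \<mu>) t) x) = 0)))}"
      by (intro CollectI exI[of _ \<sigma>] conjI exI[of _ \<delta>] exI[of _ H] refl H(1-3) less_imp_le[OF \<sigma>(1)] allI impI ballI odd)
  }
qed

end

section \<open>Measurability on the domain and primitives\<close>

lemma null_in_sets_lebesgue_on:
  fixes \<Omega> :: "'a::euclidean_space set"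
  assumes "open \<Omega>" "B \<subseteq> \<Omega>" "AE x in lebesgue_on \<Omega>. x \<notin> B"
  shows "B \<in> sets (lebesgue_on \<Omega>)"
proof -
  have "AE x in lebesgue. x \<notin> B"
    using assms AE_lebesgue_on[OF assms(1), of "\<lambda>x. x \<notin> B"] by (auto elim!: eventually_mono)
  then have "B \<in> null_sets lebesgue"
    by (subst completion.null_sets_iff_AE) auto
  then show ?thesis using assms by (subst sets_restrict_space_iff) auto
qed

text \<open>Lebesgue measure is complete, so all subsets of the exceptional set are measurable and a
  change of values there does no harm. This permits redefining integrands on null sets.\<close>

lemma borel_measurable_lebesgue_on_AE:
  fixes \<Omega> :: "'a::euclidean_space set"
  assumes \<Omega>: "open \<Omega>" and h: "h \<in> borel_measurable (lebesgue_on \<Omega>)" and ae: "AE x in lebesgue_on \<Omega>. f x = h x"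
  shows "f \<in> borel_measurable (lebesgue_on \<Omega>)"
proof (rule measurableI)
  fix A :: "'b set" assume A: "A \<in> sets borel"
  define B where "B = {x \<in> \<Omega>. f x \<noteq> h x}"
  have n: "X \<in> sets (lebesgue_on \<Omega>)" if "X \<subseteq> B" for X
    by (rule null_in_sets_lebesgue_on[OF \<Omega>]) (use that ae in \<open>auto simp: B_def elim!: eventually_mono\<close>)
  have "f -` A \<inter> space (lebesgue_on \<Omega>) = ((h -` A \<inter> space (lebesgue_on \<Omega>)) - B) \<union> (f -` A \<inter> B)"
    by (auto simp: B_def)
  also have "\<dots> \<in> sets (lebesgue_on \<Omega>)"
    using measurable_sets[OF h A] n by (intro sets.Un sets.Diff) auto
  finally show "f -` A \<inter> space (lebesgue_on \<Omega>) \<in> sets (lebesgue_on \<Omega>)" .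
qed simp

lemma Gprim_has_derivative:
  assumes "continuous_on UNIV (g x)"
  shows "(Gprim g x has_real_derivative g x s) (at s)"
proof -
  define m where "m = \<bar>s\<bar> + 1"
  have "((\<lambda>u. LBINT y=0..u. g x y) has_vector_derivative (g x s)) (at s within {- m..m})"
    using interval_integral_FTC2[of "- m" 0 m "g x" s] continuous_on_subset[OF assms]
    by (auto simp: m_def zero_ereal_def)
  then have "((\<lambda>u. LBINT y=0..u. g x y) has_vector_derivative (g x s)) (at s)"
    by (subst (asm) at_within_interior) (auto simp: m_def)
  then show ?thesis
    by (simp add: has_real_derivative_iff_has_vector_derivative Gprim_def[abs_def])
qed

lemma Gprim_0: "Gprim g x 0 = 0"
  by (simp add: Gprim_def zero_ereal_def)

text \<open>A Caratheodory function is jointly measurable in the point and the integration variable,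
  so the parameter integral is measurable by Fubini's theorem.\<close>

lemma Gprim_measurable:
  assumes meas: "\<And>s. (\<lambda>x. g x s) \<in> borel_measurable M" and cont: "\<And>x. x \<in> space M \<Longrightarrow> continuous_on UNIV (g x)"
  shows "(\<lambda>x. Gprim g x s) \<in> borel_measurable M"
proof -
  have "(\<lambda>y. g (fst y) (snd y)) \<in> borel_measurable (M \<Otimes>\<^sub>M lborel)"
  proof (rule Caratheodory_measurable[where F = "\<lambda>y. g (fst y)"])
    show "(\<lambda>y. g (fst y) z) \<in> borel_measurable (M \<Otimes>\<^sub>M lborel)" for z
      by (rule measurable_compose[OF measurable_fst meas])
    show "continuous_on UNIV (g (fst y))" if "y \<in> space (M \<Otimes>\<^sub>M lborel)" for y
      using that by (intro cont) (auto simp: space_pair_measure)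
  qed simp
  then have [measurable]: "(\<lambda>(x, t). g x t) \<in> borel_measurable (M \<Otimes>\<^sub>M lborel)" by (simp add: case_prod_beta')
  have [measurable]: "einterval u v \<in> sets borel" for u v by simp
  have "(\<lambda>x. \<integral>t. indicator (einterval u v) t *\<^sub>R g x t \<partial>lborel) \<in> borel_measurable M" for u v
    by (rule lborel.borel_measurable_lebesgue_integral) measurable
  then show ?thesis
    unfolding Gprim_def interval_lebesgue_integral_def set_lebesgue_integral_def by simp
qed

theorem theorem6p1:
  fixes \<Omega> :: "'a::euclidean_space set"
    and j :: "'a \<Rightarrow> real \<Rightarrow> 'a \<Rightarrow> real"
    and g :: "'a \<Rightarrow> real \<Rightarrow> real"
    and \<Lambda> :: "('a \<Rightarrow> real) \<Rightarrow> real"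
    and \<alpha> :: "real \<Rightarrow> real" and \<alpha>0 :: real
  defines "N \<equiv> real DIM('a)"
  defines "f \<equiv> functional \<Omega> j g \<Lambda>"
  assumes dim: "DIM('a) \<ge> 3"
    and \<Omega>: "bounded \<Omega>" "open \<Omega>"
    \<comment> \<open>j measurable in x, C^1 in (s,xi) for a.e. x\<close>
    and j_meas: "\<forall>s \<xi>. set_borel_measurable lebesgue \<Omega> (\<lambda>x. j x s \<xi>)"
    and j_C1: "AE x in lebesgue. x \<in> \<Omega> \<longrightarrow> C1_fun (\<lambda>(s, \<xi>). j x s \<xi>)"
    \<comment> \<open>(H1)\<close>
    and H1: "AE x in lebesgue. x \<in> \<Omega> \<longrightarrow> (\<forall>s. strictly_convex_on UNIV (j x s))"
    \<comment> \<open>(H2)\<close>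
    and H2_\<alpha>0: "\<alpha>0 > 0"
    and H2_\<alpha>: "\<forall>t\<ge>0. \<alpha> t > 0" "mono_on {0..} \<alpha>" "continuous_on {0..} \<alpha>"
    and H2: "AE x in lebesgue. x \<in> \<Omega> \<longrightarrow>
               (\<forall>s \<xi>. \<alpha>0 * (norm \<xi>)\<^sup>2 \<le> j x s \<xi> \<and> j x s \<xi> \<le> \<alpha> \<bar>s\<bar> * (norm \<xi>)\<^sup>2)"
    \<comment> \<open>(H4)\<close>
    and H4: "\<exists>R>0. AE x in lebesgue. x \<in> \<Omega> \<longrightarrow>
               (\<forall>s \<xi>. \<bar>s\<bar> \<ge> R \<longrightarrow> deriv (\<lambda>t. j x t \<xi>) s * s \<ge> 0)"
    \<comment> \<open>g Caratheodory\<close>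
    and g_meas: "\<forall>s. set_borel_measurable lebesgue \<Omega> (\<lambda>x. g x s)"
    and g_cont: "AE x in lebesgue. x \<in> \<Omega> \<longrightarrow> continuous_on UNIV (g x)"
    \<comment> \<open>(G2)\<close>
    and G2: "\<forall>\<epsilon>>0. \<exists>a. set_borel_measurable lebesgue \<Omega> a \<and>
               set_integrable lebesgue \<Omega> (\<lambda>x. \<bar>a x\<bar> powr (2 * N / (N + 2))) \<and>
               (AE x in lebesgue. x \<in> \<Omega> \<longrightarrow>
                  (\<forall>s. \<bar>g x s\<bar> \<le> a x + \<epsilon> * \<bar>s\<bar> powr ((N + 2) / (N - 2))))"
    \<comment> \<open>\<Lambda> \<in> H^{-1}(\<Omega>)\<close>
    and \<Lambda>_add: "\<forall>u\<in>H01 \<Omega>. \<forall>v\<in>H01 \<Omega>. \<Lambda> (\<lambda>x. u x + v x) = \<Lambda> u + \<Lambda> v"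
    and \<Lambda>_scale: "\<forall>u\<in>H01 \<Omega>. \<forall>c. \<Lambda> (\<lambda>x. c * u x) = c * \<Lambda> u"
    and \<Lambda>_bdd: "\<exists>C. \<forall>u\<in>H01 \<Omega>. \<bar>\<Lambda> u\<bar> \<le> C * H01_dist \<Omega> u (\<lambda>x. 0)"
  shows "(\<forall>u \<eta>. (u, \<eta>) \<in> epi (H01 \<Omega>) f \<and> f u < ereal \<eta> \<longrightarrow>
            weak_slope (epi (H01 \<Omega>) f) (epi_dist (H01_dist \<Omega>)) snd (u, \<eta>) = 1)
       \<and> ((AE x in lebesgue. x \<in> \<Omega> \<longrightarrow> (\<forall>s \<xi>. j x (- s) (- \<xi>) = j x s \<xi>)) \<and>
          (AE x in lebesgue. x \<in> \<Omega> \<longrightarrow> (\<forall>s. g x (- s) = - g x s)) \<and>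
          (\<forall>v\<in>H01 \<Omega>. \<Lambda> v = 0)
          \<longrightarrow> (\<forall>\<eta>. f (\<lambda>x. 0) < ereal \<eta> \<longrightarrow> weak_slope_Z2 (H01 \<Omega>) (H01_dist \<Omega>) f \<eta> = 1))"
proof -
  let ?M = "lebesgue_on \<Omega>"
  define p where "p = sobolev_exp TYPE('a)"
  have N: "N \<ge> 3" using dim by (simp add: N_def)
  have p: "p = 2 * N / (N - 2)" by (simp add: p_def sobolev_exp_def N_def)
  \<comment> \<open>The two exponents in (G2) are p - 1 and the conjugate exponent p / (p - 1) of
    the critical exponent p.\<close>
  have p1: "p - 1 = (N + 2) / (N - 2)" using N by (simp add: p field_simps)
  have p2: "p / (p - 1) = 2 * N / (N + 2)" unfolding p1 using N by (simp add: p)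
  note AEM = AE_lebesgue_on[OF \<Omega>(2)] and measM = set_borel_measurable_lebesgue_on[OF \<Omega>(2)]
  obtain R where R: "R > 0"
    "AE x in ?M. \<forall>s \<xi>. \<bar>s\<bar> \<ge> R \<longrightarrow> deriv (\<lambda>t. j x t \<xi>) s * s \<ge> 0"
    using H4 unfolding AEM by blast
  \<comment> \<open>The choice \<epsilon> = 1 gives the growth bound the coefficient that
    \<open>G_diff\<close> has.\<close>
  have "\<exists>a. set_borel_measurable lebesgue \<Omega> a \<and>
        set_integrable lebesgue \<Omega> (\<lambda>x. \<bar>a x\<bar> powr (2 * N / (N + 2))) \<and>
        (AE x in lebesgue. x \<in> \<Omega> \<longrightarrow> (\<forall>s. \<bar>g x s\<bar> \<le> a x + 1 * \<bar>s\<bar> powr ((N + 2) / (N - 2))))"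
    using G2 zero_less_one by blast
  then obtain a where a: "a \<in> borel_measurable ?M" "integrable ?M (\<lambda>x. \<bar>a x\<bar> powr (2 * N / (N + 2)))"
    "AE x in ?M. \<forall>s. \<bar>g x s\<bar> \<le> a x + \<bar>s\<bar> powr (p - 1)"
    unfolding AEM measM set_integrable_lebesgue_on[OF \<Omega>(2)] p1 by auto
  obtain C where C: "\<forall>u\<in>H01 \<Omega>. \<bar>\<Lambda> u\<bar> \<le> C * H01_dist \<Omega> u (\<lambda>x. 0)" using \<Lambda>_bdd by blast
  \<comment> \<open>The a.e. hypotheses are finitely many, so almost every point satisfies all of
    them at once.\<close>
  define good where "good x \<longleftrightarrow> C1_fun (\<lambda>(s, \<xi>). j x s \<xi>) \<and> (\<forall>s. strictly_convex_on UNIV (j x s)) \<and>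
      (\<forall>s \<xi>. \<alpha>0 * (norm \<xi>)\<^sup>2 \<le> j x s \<xi> \<and> j x s \<xi> \<le> \<alpha> \<bar>s\<bar> * (norm \<xi>)\<^sup>2) \<and>
      (\<forall>s \<xi>. \<bar>s\<bar> \<ge> R \<longrightarrow> deriv (\<lambda>t. j x t \<xi>) s * s \<ge> 0) \<and> continuous_on UNIV (g x) \<and>
      (\<forall>s. \<bar>g x s\<bar> \<le> a x + \<bar>s\<bar> powr (p - 1))" for x
  have ae: "AE x in ?M. good x"
    using j_C1[unfolded AEM] H1[unfolded AEM] H2[unfolded AEM] R(2) g_cont[unfolded AEM] a(3)
    by eventually_elim (simp add: good_def)
  \<comment> \<open>Setting the data to 0 at the remaining points makes the locale assumptions hold
    everywhere: the zero integrand is not strictly convex, but it satisfies the scaling inequality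
    \<open>j_scale\<close>.\<close>
  define j' where "j' x s \<xi> = (if good x then j x s \<xi> else 0)" for x s \<xi>
  define g' where "g' x s = (if good x then g x s else 0)" for x s
  have g'_meas: "(\<lambda>x. g' x s) \<in> borel_measurable ?M" for s
    by (rule borel_measurable_lebesgue_on_AE[OF \<Omega>(2), of "\<lambda>x. g x s"])
       (use g_meas ae in \<open>auto simp: measM g'_def elim!: eventually_mono\<close>)
  have g'_cont: "continuous_on UNIV (g' x)" for x
  proof (cases "good x")
    case True
    then have "continuous_on UNIV (g x)" by (simp add: good_def)
    then show ?thesis using True by (simp add: g'_def[abs_def])
  qed (simp add: g'_def[abs_def])
  have g'_le: "\<bar>g' x s\<bar> \<le> \<bar>a x\<bar> + \<bar>s\<bar> powr (p - 1)" for x s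
  proof (cases "good x")
    case True
    then have "\<bar>g x s\<bar> \<le> a x + \<bar>s\<bar> powr (p - 1)" by (simp add: good_def)
    then show ?thesis using True by (simp add: g'_def)
  qed (simp add: g'_def)
  have p1_pos: "p - 1 > 0" unfolding p1 using N by simp
  have j_diff: "(\<lambda>t. j x t \<xi>) differentiable (at t)" if gx: "good x" for x \<xi> t
  proof -
    obtain D where D: "((\<lambda>(s, \<xi>). j x s \<xi>) has_derivative D) (at (t, \<xi>))"
      using gx unfolding good_def C1_fun_def by blast
    have "((\<lambda>t. (\<lambda>(s, \<xi>). j x s \<xi>) (t, \<xi>)) has_derivative (\<lambda>h. D (h, 0))) (at t)"
      by (rule has_derivative_compose[of "\<lambda>t. (t, \<xi>)" "\<lambda>h. (h, 0)", OF _ D])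
         (auto intro!: derivative_eq_intros)
    then show ?thesis by (auto simp: differentiable_def)
  qed
  have j_deriv: "((\<lambda>t. j x t \<xi>) has_real_derivative deriv (\<lambda>t. j x t \<xi>) t) (at t)" if "good x" for x \<xi> t
    using j_diff[OF that] by (simp add: DERIV_deriv_iff_real_differentiable)
  \<comment> \<open>The modulus of \<open>a\<close> and \<open>max C 0\<close> provide the signs
    that the locale requires.\<close>
  interpret F: critical_functional \<Omega> p j' "Gprim g'" \<Lambda> \<alpha> R "\<lambda>x. \<bar>a x\<bar>" "max C 0"
  proof unfold_locales
    show "p = sobolev_exp TYPE('a)" by (rule p_def)
    show "bounded \<Omega>" "open \<Omega>" "DIM('a) \<ge> 3" by (rule \<Omega> dim)+
    show "(\<lambda>x. j' x s \<xi>) \<in> borel_measurable ?M" for s \<xi>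
      by (rule borel_measurable_lebesgue_on_AE[OF \<Omega>(2), of "\<lambda>x. j x s \<xi>"])
         (use j_meas ae in \<open>auto simp: measM j'_def elim!: eventually_mono\<close>)
    show "continuous_on UNIV (\<lambda>z. j' x (fst z) (snd z))" for x
    proof (cases "good x")
      case True
      then obtain D where D: "\<And>z. ((\<lambda>(s, \<xi>). j x s \<xi>) has_derivative blinfun_apply (D z)) (at z)"
        unfolding good_def C1_fun_def by blast
      have "continuous_on UNIV (\<lambda>(s, \<xi>). j x s \<xi>)"
        by (rule has_derivative_continuous_on[OF has_derivative_at_withinI[OF D]])
      then show ?thesis using True by (simp add: j'_def case_prod_beta')
    qed (simp add: j'_def)
    show "0 \<le> j' x s \<xi>" for x s \<xi>
    proof (cases "good x")
      case True
      then have "\<alpha>0 * (norm \<xi>)\<^sup>2 \<le> j x s \<xi>" by (simp add: good_def)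
      moreover have "0 \<le> \<alpha>0 * (norm \<xi>)\<^sup>2" using H2_\<alpha>0 by simp
      ultimately show ?thesis using True by (simp add: j'_def)
    qed (simp add: j'_def)
    show "j' x s \<xi> \<le> \<alpha> \<bar>s\<bar> * (norm \<xi>)\<^sup>2" for x s \<xi>
    proof (cases "good x")
      case True
      then have "j x s \<xi> \<le> \<alpha> \<bar>s\<bar> * (norm \<xi>)\<^sup>2" by (simp add: good_def)
      then show ?thesis using True by (simp add: j'_def)
    qed (use H2_\<alpha>(1) in \<open>simp add: j'_def less_imp_le\<close>)
    show "j' x s (c *\<^sub>R \<xi>) \<le> c * j' x s \<xi>" if c: "0 \<le> c" "c \<le> 1" for x s c \<xi>
    proof (cases "good x")
      case True
      \<comment> \<open>At \<xi> = 0 the two bounds of (H2) force \<open>j\<close> to vanish.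
        Convexity on the segment from 0 to \<xi> then becomes the scaling inequality.\<close>
      have z: "j x s 0 = 0"
      proof -
        have "\<alpha>0 * (norm (0::'a))\<^sup>2 \<le> j x s 0 \<and> j x s 0 \<le> \<alpha> \<bar>s\<bar> * (norm (0::'a))\<^sup>2"
          using True unfolding good_def by blast
        then show ?thesis by simp
      qed
      have sc: "strictly_convex_on UNIV (j x s)" using True by (simp add: good_def)
      \<comment> \<open>Strict convexity speaks of distinct points and interior parameters, so the
        degenerate cases are settled by hand.\<close>
      consider "c = 0" | "c = 1" | "\<xi> = 0" | "0 < c" "c < 1" "\<xi> \<noteq> 0" using c by linarith
      then have "j x s (c *\<^sub>R \<xi>) \<le> c * j x s \<xi>"
      proof cases
        case 4
        then have "j x s ((1 - c) *\<^sub>R 0 + c *\<^sub>R \<xi>) < (1 - c) * j x s 0 + c * j x s \<xi>"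
          using sc unfolding strictly_convex_on_def by (metis UNIV_I)
        then show ?thesis using z by simp
      qed (use z in auto)
      then show ?thesis using True by (simp add: j'_def)
    qed (simp add: j'_def)
    show "mono_on {0..} \<alpha>" "R > 0" by (rule H2_\<alpha> R)+
    show "\<alpha> t > 0" if "t \<ge> 0" for t using H2_\<alpha>(1) that by blast
    show "j' x t \<xi> \<le> j' x s \<xi>" if "R \<le> t" "t \<le> s" for x s t \<xi>
    proof (cases "good x")
      case True
      have "j x t \<xi> \<le> j x s \<xi>"
      proof (rule DERIV_nonneg_imp_nondecreasing[OF that(2)])
        fix r assume r: "t \<le> r" "r \<le> s"
        then have "R \<le> \<bar>r\<bar>" "r > 0" using that(1) R(1) by auto
        then have "deriv (\<lambda>t. j x t \<xi>) r * r \<ge> 0" using True by (simp add: good_def)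
        then have "deriv (\<lambda>t. j x t \<xi>) r \<ge> 0" using \<open>r > 0\<close> by (simp add: zero_le_mult_iff)
        then show "\<exists>y. ((\<lambda>t. j x t \<xi>) has_real_derivative y) (at r) \<and> 0 \<le> y"
          using j_deriv[OF True] by blast
      qed
      then show ?thesis using True by (simp add: j'_def)
    qed (simp add: j'_def)
    show "j' x t \<xi> \<le> j' x s \<xi>" if "s \<le> t" "t \<le> - R" for x s t \<xi>
    proof (cases "good x")
      case True
      have "j x t \<xi> \<le> j x s \<xi>"
      proof (rule DERIV_nonpos_imp_nonincreasing[OF that(1)])
        fix r assume r: "s \<le> r" "r \<le> t"
        then have "R \<le> \<bar>r\<bar>" "r < 0" using that(2) R(1) by auto
        then have "deriv (\<lambda>t. j x t \<xi>) r * r \<ge> 0" using True by (simp add: good_def)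
        then have "deriv (\<lambda>t. j x t \<xi>) r \<le> 0" using \<open>r < 0\<close> by (simp add: zero_le_mult_iff)
        then show "\<exists>y. ((\<lambda>t. j x t \<xi>) has_real_derivative y) (at r) \<and> y \<le> 0"
          using j_deriv[OF True] by blast
      qed
      then show ?thesis using True by (simp add: j'_def)
    qed (simp add: j'_def)
    show "(\<lambda>x. Gprim g' x s) \<in> borel_measurable ?M" for s
      by (rule Gprim_measurable[OF g'_meas g'_cont])
    show "continuous_on UNIV (Gprim g' x)" for x
      by (rule DERIV_continuous_on[OF has_field_derivative_at_within[OF Gprim_has_derivative[OF g'_cont]]])
    show "Gprim g' x 0 = 0" for x by (rule Gprim_0)
    show "\<bar>Gprim g' x s - Gprim g' x t\<bar> \<le> \<bar>s - t\<bar> * (\<bar>a x\<bar> + \<bar>s\<bar> powr (p - 1))" if "\<bar>t\<bar> \<le> \<bar>s\<bar>" for x s t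
    proof -
      have "norm (Gprim g' x s - Gprim g' x t) \<le> (\<bar>a x\<bar> + \<bar>s\<bar> powr (p - 1)) * norm (s - t)"
      \<comment> \<open>The symmetric interval contains \<open>t\<close> since \<bar>t\<bar> \<le>
        \<bar>s\<bar>. The growth bound is largest at its ends and therefore serves as a Lipschitz
        constant on all of it.\<close>
      proof (rule field_differentiable_bound[of "{- \<bar>s\<bar>..\<bar>s\<bar>}" _ "g' x"])
        show "(Gprim g' x has_field_derivative g' x z) (at z within {- \<bar>s\<bar>..\<bar>s\<bar>})" for z
          by (rule has_field_derivative_at_within[OF Gprim_has_derivative[OF g'_cont]])
        show "norm (g' x z) \<le> \<bar>a x\<bar> + \<bar>s\<bar> powr (p - 1)" if "z \<in> {- \<bar>s\<bar>..\<bar>s\<bar>}" for z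
        proof -
          have "\<bar>z\<bar> powr (p - 1) \<le> \<bar>s\<bar> powr (p - 1)" using that p1_pos by (intro powr_mono2) auto
          then show ?thesis using g'_le[of x z] by simp
        qed
      qed (use that in auto)
      then show ?thesis by (simp add: mult.commute)
    qed
    show "(\<lambda>x. \<bar>a x\<bar>) \<in> borel_measurable ?M" using a(1) by simp
    show "integrable ?M (\<lambda>x. \<bar>a x\<bar> powr (p / (p - 1)))" using a(2) by (simp add: p2)
    show "\<Lambda> (\<lambda>x. u x + v x) = \<Lambda> u + \<Lambda> v" if "u \<in> H01 \<Omega>" "v \<in> H01 \<Omega>" for u v
      using \<Lambda>_add that by blast
    show "\<Lambda> (\<lambda>x. c * u x) = c * \<Lambda> u" if "u \<in> H01 \<Omega>" for u c using \<Lambda>_scale that by blast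
    show "\<bar>\<Lambda> u\<bar> \<le> max C 0 * H01_dist \<Omega> u (\<lambda>x. 0)" if "u \<in> H01 \<Omega>" for u
    proof -
      have "0 \<le> H01_dist \<Omega> u (\<lambda>x. 0)" by (simp add: H01_dist_def set_lebesgue_integral_def)
      then have "C * H01_dist \<Omega> u (\<lambda>x. 0) \<le> max C 0 * H01_dist \<Omega> u (\<lambda>x. 0)" by (intro mult_right_mono) auto
      then show ?thesis using C that by (meson order_trans)
    qed
  qed auto
  \<comment> \<open>The modified data differ from the given ones on a null set, so the functionals
    agree on \<open>H01 \<Omega>\<close>; the epigraph, and with it both slopes, sees
    \<open>f\<close> only there.\<close>
  have f_eq: "f v = F.f v" if v: "v \<in> H01 \<Omega>" for v
  proof -
    have "(\<integral>\<^sup>+x\<in>\<Omega>. ennreal (j x (v x) (wgrad \<Omega> v x)) \<partial>lebesgue) = (\<integral>\<^sup>+x. ennreal (j x (v x) (wgrad \<Omega> v x)) \<partial>?M)"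
      using \<Omega>(2) by (subst nn_integral_restrict_space) auto
    also have "\<dots> = F.J v"
      unfolding F.J_def by (rule nn_integral_cong_AE) (use ae in \<open>eventually_elim, simp add: j'_def\<close>)
    finally have 1: "(\<integral>\<^sup>+x\<in>\<Omega>. ennreal (j x (v x) (wgrad \<Omega> v x)) \<partial>lebesgue) = F.J v" .
    have aeG: "AE x in ?M. Gprim g x (v x) = Gprim g' x (v x)"
      using ae by eventually_elim (simp add: Gprim_def g'_def)
    have m: "(\<lambda>x. Gprim g' x (v x)) \<in> borel_measurable ?M"
      by (rule F.G_comp_measurable[OF F.H01_measurable(1)[OF v]])
    have "(LINT x:\<Omega>|lebesgue. Gprim g x (v x)) = (\<integral>x. Gprim g x (v x) \<partial>?M)"
      by (rule set_lebesgue_integral_lebesgue_on[OF \<Omega>(2)])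
    also have "\<dots> = F.\<Gamma> v"
      unfolding F.\<Gamma>_def
      by (rule integral_cong_AE[OF borel_measurable_lebesgue_on_AE[OF \<Omega>(2) m aeG] m aeG])
    finally show ?thesis unfolding f_def functional_def F.f_def 1 by simp
  qed
  have epi_eq: "epi (H01 \<Omega>) f = epi (H01 \<Omega>) F.f"
    using f_eq by (auto simp: epi_def)
  have Z2_eq: "weak_slope_Z2 (H01 \<Omega>) (H01_dist \<Omega>) f \<eta> = weak_slope_Z2 (H01 \<Omega>) (H01_dist \<Omega>) F.f \<eta>" for \<eta>
    unfolding weak_slope_Z2_def epi_eq ..
  have z0: "(\<lambda>x. 0) \<in> H01 \<Omega>" by (rule F.H01_grad_imp_H01[OF F.H01_grad_0])
  show ?thesis
  proof (intro conjI allI impI)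
    fix u \<eta> assume "(u, \<eta>) \<in> epi (H01 \<Omega>) f \<and> f u < ereal \<eta>"
    then show "weak_slope (epi (H01 \<Omega>) f) (epi_dist (H01_dist \<Omega>)) snd (u, \<eta>) = 1"
      unfolding epi_eq using F.weak_slope_epi_eq_1[of u \<eta>] f_eq[of u] by (auto simp: epi_def)
  next
    fix \<eta> assume "f (\<lambda>x. 0) < ereal \<eta>"
    then show "weak_slope_Z2 (H01 \<Omega>) (H01_dist \<Omega>) f \<eta> = 1"
      unfolding Z2_eq using F.weak_slope_Z2_epi_eq_1[of \<eta>] f_eq[OF z0] by simp
  qed
qed

end
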